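(* Let $f$ be an $n$-ary quasigroup of order $4$ that has no transversals. Then $n$ is even and $f$ is $\mathbb{Z}_4$-linear.
   Context: Let $\Sigma_q=\{0,\dots,q-1\}$. An $n$-ary quasigroup of order $q$ is a map $f:\Sigma_q^n\to\Sigma_q$ such that the equation $x_0=f(x_1,\dots,x_n)$ has a unique solution in any one of the variables $x_0,\dots,x_n$ when the other $n$ variables are fixed arbitrarily. A transversal in $f$ is a set of $q$ vectors $\alpha^i=(a^i_0,\dots,a^i_n)\in\Sigma_q^{n+1}$, $i=1,\dots,q$, such that $a^i_0=f(a^i_1,\dots,a^i_n)$ for all $i$ and $a^i_k\neq a^j_k$ for all $i\neq j$ and all $k$. Two $n$-ary quasigroups $f,g$ of order $q$ are isotopic if there are permutations $\sigma_0,\dots,\sigma_n$ of $\Sigma_q$ with $f(x_1,\dots,x_n)=\sigma_0^{-1}(g(\sigma_1(x_1),\dots,\sigma_n(x_n)))$ for all arguments. The $n$-ary iterated group $\mathbb{Z}_4$ is the $n$-ary quasigroup $g$ on $\Sigma_4=\mathbb{Z}_4$ with $x_0=g(x_1,\dots,x_n)\iff x_0+x_1+\dots+x_n\equiv 0\pmod 4$. An $n$-ary quasigroup of order $4$ is $\mathbb{Z}_4$-linear if it is isotopic to the $n$-ary iterated group $\mathbb{Z}_4$. *)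

theory Defs
  imports "HOL-Library.FuncSet" "HOL-Combinatorics.Permutations" "HOL-Number_Theory.Cong"
begin

text \<open>
  The alphabet \<open>{0, \<dots>, q - 1}\<close> is \<open>{..<q}\<close>. An \<open>n\<close>-tuple of arguments is an extensional function
  on \<open>{1..n}\<close>, and an \<open>(n + 1)\<close>-tuple \<open>(x\<^sub>0, \<dots>, x\<^sub>n)\<close> is one on \<open>{0..n}\<close>; thus an \<open>n\<close>-ary operation
  is only ever looked at on \<open>{1..n} \<rightarrow>\<^sub>E {..<q}\<close>.
\<close>

definition satisfies_eq :: "nat \<Rightarrow> ((nat \<Rightarrow> nat) \<Rightarrow> nat) \<Rightarrow> (nat \<Rightarrow> nat) \<Rightarrow> bool" where
  "satisfies_eq n f x \<longleftrightarrow> x 0 = f (restrict x {1..n})"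

definition nary_quasigroup :: "nat \<Rightarrow> nat \<Rightarrow> ((nat \<Rightarrow> nat) \<Rightarrow> nat) \<Rightarrow> bool" where
  "nary_quasigroup n q f \<longleftrightarrow>
     f \<in> ({1..n} \<rightarrow>\<^sub>E {..<q}) \<rightarrow> {..<q} \<and>
     (\<forall>k\<in>{0..n}. \<forall>x\<in>{0..n} \<rightarrow>\<^sub>E {..<q}. \<exists>!v. v \<in> {..<q} \<and> satisfies_eq n f (x(k := v)))"

definition transversal :: "nat \<Rightarrow> nat \<Rightarrow> ((nat \<Rightarrow> nat) \<Rightarrow> nat) \<Rightarrow> (nat \<Rightarrow> nat) set \<Rightarrow> bool" where
  "transversal n q f T \<longleftrightarrow>
     T \<subseteq> {0..n} \<rightarrow>\<^sub>E {..<q} \<and> card T = q \<and>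
     (\<forall>a\<in>T. satisfies_eq n f a) \<and>
     (\<forall>a\<in>T. \<forall>b\<in>T. a \<noteq> b \<longrightarrow> (\<forall>k\<in>{0..n}. a k \<noteq> b k))"

definition isotopic ::
    "nat \<Rightarrow> nat \<Rightarrow> ((nat \<Rightarrow> nat) \<Rightarrow> nat) \<Rightarrow> ((nat \<Rightarrow> nat) \<Rightarrow> nat) \<Rightarrow> bool" where
  "isotopic n q f g \<longleftrightarrow>
     (\<exists>\<sigma> :: nat \<Rightarrow> nat \<Rightarrow> nat.
        (\<forall>i\<in>{0..n}. \<sigma> i permutes {..<q}) \<and>
        (\<forall>x\<in>{1..n} \<rightarrow>\<^sub>E {..<q}. f x = inv (\<sigma> 0) (g (\<lambda>i\<in>{1..n}. \<sigma> i (x i)))))"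

definition iterated_Z4 :: "nat \<Rightarrow> (nat \<Rightarrow> nat) \<Rightarrow> nat" where
  "iterated_Z4 n x = (THE x0. x0 \<in> {..<4} \<and> [x0 + (\<Sum>i=1..n. x i) = 0] (mod 4))"

definition Z4_linear :: "nat \<Rightarrow> ((nat \<Rightarrow> nat) \<Rightarrow> nat) \<Rightarrow> bool" where
  "Z4_linear n f \<longleftrightarrow> isotopic n 4 f (iterated_Z4 n)"

lemma ex1_add_cong_0_mod_4: "\<exists>!v::nat. v \<in> {..<4} \<and> [v + s = 0] (mod 4)"
proof -
  have less_4: "r = 0 \<or> r = 1 \<or> r = 2 \<or> r = 3" if "r < 4" for r :: nat
    using that by linarith
  have eq: "[v + s = 0] (mod 4) \<longleftrightarrow> (v + s mod 4) mod 4 = 0" for v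
    by (simp add: cong_def mod_add_right_eq)
  have sol: "(v + r) mod 4 = 0 \<longleftrightarrow> v = (4 - r) mod 4" if "v < 4" "r < 4" for v r :: nat
    using less_4[OF that(1)] less_4[OF that(2)] by (elim disjE) simp_all
  have "v \<in> {..<4} \<and> [v + s = 0] (mod 4) \<longleftrightarrow> v = (4 - s mod 4) mod 4" for v
    using sol[of v "s mod 4"] by (auto simp: eq)
  then show ?thesis by simp
qed

lemma iterated_Z4_iff:
  assumes "x0 < 4"
  shows "x0 = iterated_Z4 n x \<longleftrightarrow> [x0 + (\<Sum>i=1..n. x i) = 0] (mod 4)"
proof -
  let ?P = "\<lambda>v. v \<in> {..<4} \<and> [v + (\<Sum>i=1..n. x i) = 0] (mod 4)"
  have ex1: "\<exists>!v. ?P v" by (rule ex1_add_cong_0_mod_4)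
  have P: "?P (iterated_Z4 n x)" unfolding iterated_Z4_def by (rule theI'[OF ex1])
  show ?thesis
  proof
    show "[x0 + (\<Sum>i=1..n. x i) = 0] (mod 4)" if "x0 = iterated_Z4 n x"
      unfolding that using P by (rule conjunct2)
    assume "[x0 + (\<Sum>i=1..n. x i) = 0] (mod 4)"
    then have "?P x0" using assms by (simp only: lessThan_iff simp_thms)
    then show "x0 = iterated_Z4 n x" using P ex1 by blast
  qed
qed

lemma iterated_Z4_less: "iterated_Z4 n x < 4"
  using conjunct1[OF theI'[OF ex1_add_cong_0_mod_4[of "\<Sum>i=1..n. x i"]]]
  unfolding iterated_Z4_def lessThan_iff .

lemma nary_quasigroup_iterated_Z4: "nary_quasigroup n 4 (iterated_Z4 n)"
  unfolding nary_quasigroup_def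
proof (intro conjI ballI)
  show "iterated_Z4 n \<in> ({1..n} \<rightarrow>\<^sub>E {..<4}) \<rightarrow> {..<4}"
    by (simp add: iterated_Z4_less)
next
  fix k x assume k: "k \<in> {0..n}" and x: "x \<in> {0..n} \<rightarrow>\<^sub>E {..<(4::nat)}"
  define s where "s = sum x ({0..n} - {k})"
  have "satisfies_eq n (iterated_Z4 n) (x(k := v)) \<longleftrightarrow> [v + s = 0] (mod 4)" if "v < 4" for v
  proof -
    have "(x(k := v)) 0 < 4"
      using x that by (auto simp: PiE_iff)
    then have "satisfies_eq n (iterated_Z4 n) (x(k := v)) \<longleftrightarrow>
        [(x(k := v)) 0 + (\<Sum>i=1..n. (x(k := v)) i) = 0] (mod 4)"
      unfolding satisfies_eq_def by (simp only: iterated_Z4_iff) simp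
    also have "(x(k := v)) 0 + (\<Sum>i=1..n. (x(k := v)) i) = sum (x(k := v)) {0..n}"
      by (simp only: sum.atLeast_Suc_atMost[of 0 n] One_nat_def le0)
    also have "\<dots> = v + s"
      using k unfolding s_def
      by (subst sum.remove[of _ k]) (auto intro!: sum.cong)
    finally show ?thesis .
  qed
  then show "\<exists>!v. v \<in> {..<4} \<and> satisfies_eq n (iterated_Z4 n) (x(k := v))"
    using ex1_add_cong_0_mod_4[of s] by auto
qed

end

theory Submission
  imports Defs
begin

text \<open>
  Identify the alphabet with the Klein four-group and view the graph of the quasigroup as a code
  on the coordinates \<open>0, \<dots>, n\<close> in which any coordinate is determined by the others.
  A code is semilinear if it is invariant under adding a fixed nowhere zero vector \<open>\<alpha>\<close> at any
  two coordinates. For a semilinear code without transversals the Boolean function that describes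
  it modulo \<open>\<alpha>\<close> satisfies enough parity conditions to be affine on the vectors of even weight,
  and then the code is linear over the cyclic group of order 4. Semilinearity is inherited from the
  subcodes on four coordinates, and up to isotopy the only quaternary code that is not semilinear
  is \<open>c + d = \<pi>(a + b)\<close> modulo 4 with a transposition \<open>\<pi>\<close>. If such a subcode occurs in a code
  without transversals, then the absence of transversals forces invariance under
  \<open>(a, b) \<mapsto> (a + 1, b - 1)\<close> for all values of the remaining coordinates. Hence the subcodes with
  \<open>a\<close>, \<open>b\<close> fixed have no transversals either, by induction they are linear over the cyclic group,
  and comparing their invariant translations with those of the subcodes with \<open>c\<close>, \<open>d\<close> fixed gives
  a contradiction.
\<close>

text \<open>The Klein four-group is the right alphabet because its nonzero translations are exactly
  the fixed-point-free involutions of four letters. In particular the half turn of every cyclic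
  labeling is a translation, so labelings of different subcodes can be compared inside one group.
  The obstacle is that a code may have several nowhere zero translations, and then nothing forces
  those of overlapping subcodes to match. They are unique exactly where a code is not full. If all
  squares are full, so is the code; otherwise a single square that is not full is the anchor along
  which translations are glued. On four coordinates the gluing fails only when two layers have
  conflicting translations, and this conflict pins down \<open>twisted\<close>. The solver sees at
  most three unknown codes on four coordinates, whatever the size of \<open>I\<close>: a word
  without zeros outside the twisted subcode extends to three rows that differ from each other and
  from zero there, and the remaining words follow by induction on their zeros. The number of
  remaining coordinates is odd by induction; the comparison of half turns needs three of them, and
  the case of a single one is a finite statement on Latin squares.\<close>

type_synonym q = "bool \<times> bool"

section \<open>The Klein four-group and codes over it\<close>

definition xor :: "q \<Rightarrow> q \<Rightarrow> q" (infixl "\<oplus>" 65) where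
  "a \<oplus> b = (fst a \<noteq> fst b, snd a \<noteq> snd b)"

abbreviation c0 :: q where "c0 \<equiv> (False, False)"
abbreviation c1 :: q where "c1 \<equiv> (True, False)"
abbreviation c2 :: q where "c2 \<equiv> (False, True)"
abbreviation c3 :: q where "c3 \<equiv> (True, True)"

lemma xor_simps [simp]: "a \<oplus> c0 = a" "c0 \<oplus> a = a" "a \<oplus> a = c0" "a \<oplus> b \<oplus> b = a"
  "(a \<oplus> b = a) = (b = c0)" "(a = a \<oplus> b) = (b = c0)" "(a \<oplus> b = a \<oplus> c) = (b = c)" "(b \<oplus> a = c \<oplus> a) = (b = c)"
  by (auto simp: xor_def prod_eq_iff)

lemma xor_commute: "a \<oplus> b = b \<oplus> a"
  and xor_assoc: "a \<oplus> b \<oplus> c = a \<oplus> (b \<oplus> c)"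
  and xor_left_commute: "a \<oplus> (b \<oplus> c) = b \<oplus> (a \<oplus> c)"
  by (auto simp: xor_def)
lemmas xor_ac = xor_commute xor_assoc xor_left_commute

text \<open>Words are total functions and a code ignores the coordinates outside \<open>I\<close>.
  So fixing coordinates or passing to a subset keeps the type, and inductions over index sets need
  no transport.\<close>

definition mds :: "'i set \<Rightarrow> (('i \<Rightarrow> q) \<Rightarrow> bool) \<Rightarrow> bool" where
  "mds I M \<longleftrightarrow> finite I \<and> (\<forall>x y. (\<forall>i\<in>I. x i = y i) \<longrightarrow> M x = M y) \<and> (\<forall>i\<in>I. \<forall>x. \<exists>!v. M (x(i := v)))"

definition transversal_free :: "'i set \<Rightarrow> (('i \<Rightarrow> q) \<Rightarrow> bool) \<Rightarrow> bool" where
  "transversal_free I M \<longleftrightarrow> \<not> (\<exists>x1 x2 x3 x4. M x1 \<and> M x2 \<and> M x3 \<and> M x4 \<and>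
     (\<forall>i\<in>I. distinct [x1 i, x2 i, x3 i, x4 i]))"

definition invariant :: "'i set \<Rightarrow> (('i \<Rightarrow> q) \<Rightarrow> bool) \<Rightarrow> ('i \<Rightarrow> q) \<Rightarrow> bool" where
  "invariant I M \<alpha> \<longleftrightarrow> (\<forall>x. \<forall>i\<in>I. \<forall>j\<in>I. i \<noteq> j \<longrightarrow> M x \<longrightarrow> M (x(i := x i \<oplus> \<alpha> i, j := x j \<oplus> \<alpha> j)))"

definition semilinear :: "'i set \<Rightarrow> (('i \<Rightarrow> q) \<Rightarrow> bool) \<Rightarrow> bool" where
  "semilinear I M \<longleftrightarrow> (\<exists>\<alpha>. (\<forall>i\<in>I. \<alpha> i \<noteq> c0) \<and> invariant I M \<alpha>)"

definition Z4_code :: "'i set \<Rightarrow> (('i \<Rightarrow> q) \<Rightarrow> bool) \<Rightarrow> bool" where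
  "Z4_code I M \<longleftrightarrow> (\<exists>\<sigma> :: 'i \<Rightarrow> q \<Rightarrow> nat. (\<forall>i\<in>I. bij_betw (\<sigma> i) UNIV {..<4}) \<and>
     (\<forall>x. M x \<longleftrightarrow> 4 dvd (\<Sum>i\<in>I. \<sigma> i (x i))))"

section \<open>Codewords, moves between them, and relabelings\<close>

lemma mds_finite: "mds I M \<Longrightarrow> finite I"
  by (simp add: mds_def)

lemma mds_agree: "mds I M \<Longrightarrow> (\<And>i. i \<in> I \<Longrightarrow> x i = y i) \<Longrightarrow> M x = M y"
  unfolding mds_def by blast

lemma mds_ex: "mds I M \<Longrightarrow> i \<in> I \<Longrightarrow> \<exists>v. M (x(i := v))"
  unfolding mds_def by blast

lemma mds_unique: "mds I M \<Longrightarrow> i \<in> I \<Longrightarrow> M (x(i := v)) \<Longrightarrow> M (x(i := w)) \<Longrightarrow> v = w"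
  unfolding mds_def by blast

lemma mds_unique_self: "mds I M \<Longrightarrow> i \<in> I \<Longrightarrow> M x \<Longrightarrow> M (x(i := w)) \<Longrightarrow> w = x i"
  using mds_unique[of I M i x w "x i"] by simp

lemma mds_unique_agree:
  assumes "mds I M" "o' \<in> I" "M x" "M y" "\<And>i. i \<in> I \<Longrightarrow> i \<noteq> o' \<Longrightarrow> x i = y i"
  shows "x o' = y o'"
proof -
  have "M (x(o' := y o'))"
    using assms mds_agree[of I M "x(o' := y o')" y] by auto
  then show ?thesis
    using mds_unique_self[OF assms(1-3)] by metis
qed

text \<open>Any codeword turns into any other by correcting one coordinate at a time while
  \<open>k\<close> absorbs the change, which it always can; when all the others are right, so is
  \<open>k\<close>. Hence a property that survives such moves spreads from one codeword to
  all.\<close>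

lemma mds_connect:
  assumes M: "mds I M" and "k \<in> I" "M x" "M y" "P x"
    and step: "\<And>u i a b. M u \<Longrightarrow> P u \<Longrightarrow> i \<in> I \<Longrightarrow> i \<noteq> k \<Longrightarrow> M (u(i := a, k := b)) \<Longrightarrow> P (u(i := a, k := b))"
    and agree: "\<And>u v. (\<And>i. i \<in> I \<Longrightarrow> u i = v i) \<Longrightarrow> P u \<Longrightarrow> P v"
  shows "P y"
proof -
  have "finite F \<Longrightarrow> F \<subseteq> I - {k} \<Longrightarrow> \<exists>u. M u \<and> P u \<and> (\<forall>i\<in>F. u i = y i)" for F
  proof (induction F rule: finite_induct)
    case empty
    then show ?case using assms by auto
  next
    case (insert i F)
    then obtain u where u: "M u" "P u" "\<forall>i\<in>F. u i = y i" by auto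
    obtain b where b: "M (u(i := y i, k := b))"
      using mds_ex[OF M \<open>k \<in> I\<close>] by blast
    then have "P (u(i := y i, k := b))"
      using step u insert.prems by auto
    moreover have "\<forall>j\<in>insert i F. (u(i := y i, k := b)) j = y j" using u insert.prems by auto
    ultimately show ?case using b by blast
  qed
  from this[of "I - {k}"] obtain u where u: "M u" "P u" "\<forall>i\<in>I - {k}. u i = y i"
    using mds_finite[OF M] by auto
  have "u k = y k"
    using mds_unique_agree[OF M \<open>k \<in> I\<close> u(1) \<open>M y\<close>] u(3) by auto
  then show ?thesis using agree[OF _ u(2), of y] u(3) by auto
qed

lemma mds_relabel:
  assumes M: "mds I M" and \<phi>: "\<And>i. i \<in> I \<Longrightarrow> bij (\<phi> i)"
  shows "mds I (\<lambda>x. M (\<lambda>i. \<phi> i (x i)))"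
  unfolding mds_def
proof (intro conjI allI impI ballI)
  show "finite I" using M by (rule mds_finite)
next
  fix x y :: "'a \<Rightarrow> q"
  assume "\<forall>i\<in>I. x i = y i"
  then show "M (\<lambda>i. \<phi> i (x i)) = M (\<lambda>i. \<phi> i (y i))"
    by (intro mds_agree[OF M]) simp
next
  fix i and x :: "'a \<Rightarrow> q"
  assume i: "i \<in> I"
  have eq: "(\<lambda>j. \<phi> j ((x(i := v)) j)) = (\<lambda>j. \<phi> j (x j))(i := \<phi> i v)" for v by auto
  have "\<exists>!w. M ((\<lambda>j. \<phi> j (x j))(i := w))" using M i unfolding mds_def by blast
  then show "\<exists>!v. M (\<lambda>j. \<phi> j ((x(i := v)) j))"
    unfolding eq using \<phi>[OF i] by (metis bij_pointE)
qed

lemma transversal_free_relabel: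
  assumes M: "transversal_free I M" and \<phi>: "\<And>i. i \<in> I \<Longrightarrow> bij (\<phi> i)"
  shows "transversal_free I (\<lambda>x. M (\<lambda>i. \<phi> i (x i)))"
  unfolding transversal_free_def
proof clarify
  fix x1 x2 x3 x4
  assume *: "M (\<lambda>i. \<phi> i (x1 i))" "M (\<lambda>i. \<phi> i (x2 i))" "M (\<lambda>i. \<phi> i (x3 i))" "M (\<lambda>i. \<phi> i (x4 i))"
    and "\<forall>i\<in>I. distinct [x1 i, x2 i, x3 i, x4 i]"
  then have "\<forall>i\<in>I. distinct [\<phi> i (x1 i), \<phi> i (x2 i), \<phi> i (x3 i), \<phi> i (x4 i)]"
    using \<phi> by (auto simp: bij_def inj_eq)
  with * show False using M unfolding transversal_free_def by blast
qed

lemma Z4_code_relabel: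
  assumes M: "Z4_code I (\<lambda>x. M (\<lambda>i. \<phi> i (x i)))" and \<phi>: "\<And>i. bij (\<phi> i)"
  shows "Z4_code I M"
proof -
  obtain \<sigma> :: "'a \<Rightarrow> q \<Rightarrow> nat" where \<sigma>: "\<forall>i\<in>I. bij_betw (\<sigma> i) UNIV {..<4}"
      "\<And>x. M (\<lambda>i. \<phi> i (x i)) \<longleftrightarrow> 4 dvd (\<Sum>i\<in>I. \<sigma> i (x i))"
    using M unfolding Z4_code_def by auto
  have "M x \<longleftrightarrow> 4 dvd (\<Sum>i\<in>I. \<sigma> i (inv (\<phi> i) (x i)))" for x
    using \<sigma>(2)[of "\<lambda>i. inv (\<phi> i) (x i)"] \<phi> by (simp add: bij_is_surj surj_f_inv_f)
  moreover have "\<forall>i\<in>I. bij_betw (\<lambda>v. \<sigma> i (inv (\<phi> i) v)) UNIV {..<4}"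
    using \<sigma>(1) \<phi> bij_betw_trans[of "inv (\<phi> _)" UNIV UNIV] by (fastforce simp: o_def bij_imp_bij_inv)
  ultimately show ?thesis
    unfolding Z4_code_def by (intro exI[of _ "\<lambda>i v. \<sigma> i (inv (\<phi> i) v)"]) simp
qed

section \<open>Semilinear codes without transversals\<close>

lemma odd_card_fun_upd:
  assumes "finite I" "i \<in> I"
  shows "odd (card {j\<in>I. Q ((u(i := a)) j)}) \<longleftrightarrow> (odd (card {j\<in>I. Q (u j)}) \<noteq> (Q a \<noteq> Q (u i)))"
proof -
  let ?K = "{j\<in>I - {i}. Q (u j)}"
  have K: "finite ?K" "i \<notin> ?K" using assms by auto
  have "{j\<in>I. Q ((u(i := a)) j)} = (if Q a then insert i ?K else ?K)"
    "{j\<in>I. Q (u j)} = (if Q (u i) then insert i ?K else ?K)"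
    using assms by auto
  then show ?thesis using K by auto
qed

lemma odd_card_sym_diff:
  assumes "finite A" "finite B"
  shows "odd (card (sym_diff A B)) \<longleftrightarrow> (odd (card A) \<noteq> odd (card B))"
proof -
  have "card (A \<union> B) + card (A \<inter> B) = card A + card B"
    using card_Un_Int[OF assms] by simp
  moreover have "card (sym_diff A B) + card (A \<inter> B) = card (A \<union> B)"
    using assms by (subst card_Un_disjoint[symmetric]) (auto intro!: arg_cong[of _ _ card])
  ultimately have "card (sym_diff A B) + 2 * card (A \<inter> B) = card A + card B" by linarith
  then show ?thesis by (metis even_add even_mult_iff even_numeral)
qed

definition vec :: "'i set \<Rightarrow> 'i set \<Rightarrow> 'i \<Rightarrow> q" where
  "vec P S = (\<lambda>i. (i \<in> P, i \<in> S))"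

text \<open>Relabeling brings every semilinear code to this form: a codeword goes to zero and the
  translation to the constant \<open>c2\<close>, so that \<open>fst\<close> is the class of a letter
  modulo the translation.\<close>

locale normal_semilinear =
  fixes I :: "'i set" and M :: "('i \<Rightarrow> q) \<Rightarrow> bool"
  assumes M: "mds I M" and zero: "M (\<lambda>_. c0)" and inv: "invariant I M (\<lambda>_. c2)" and ne: "I \<noteq> {}"
begin

lemma fin: "finite I"
  using M by (rule mds_finite)

lemma fin_sub: "A \<subseteq> I \<Longrightarrow> finite A"
  using fin by (rule rev_finite_subset)

text \<open>Modulo the translation the code is a binary code that contains zero and in which any
  coordinate is determined by the others, so its words have even weight.\<close>

lemma parity:
  assumes "M x"
  shows "even (card {i\<in>I. fst (x i)})"
proof -
  obtain k where k: "k \<in> I" using ne by auto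
  show ?thesis
  proof (rule mds_connect[OF M k zero assms])
    fix u i a b
    assume u: "M u" "even (card {i\<in>I. fst (u i)})" and i: "i \<in> I" "i \<noteq> k" and ab: "M (u(i := a, k := b))"
    have t: "M (u(i := u i \<oplus> c2, k := u k \<oplus> c2))"
      using inv u i k unfolding invariant_def by blast
    have uniq: "a = a' \<longleftrightarrow> b = b'" if "M (u(i := a', k := b'))" for a' b'
      using mds_unique[OF M k, of "u(i := a)" b b'] mds_unique[OF M i(1), of "u(k := b)" a a'] that ab i
      by (auto simp: fun_upd_twist)
    \<comment> \<open>The old letter and its translate at \<open>i\<close> go with the old letter
      and its translate at \<open>k\<close>; so either both classes change or neither does.\<close>
    have "(a = u i \<longleftrightarrow> b = u k) \<and> (a = u i \<oplus> c2 \<longleftrightarrow> b = u k \<oplus> c2)"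
      using uniq[of "u i" "u k"] uniq[OF t] u by simp
    moreover have "fst v = fst w \<longleftrightarrow> v = w \<or> v = w \<oplus> c2" for v w :: q
      by (auto simp: xor_def prod_eq_iff)
    ultimately have "fst a = fst (u i) \<longleftrightarrow> fst b = fst (u k)" by metis
    then show "even (card {j\<in>I. fst ((u(i := a, k := b)) j)})"
      using u i odd_card_fun_upd[OF fin k, of fst "u(i := a)" b] odd_card_fun_upd[OF fin i(1), of fst u a]
      by (metis fun_upd_other)
  next
    fix u v :: "'i \<Rightarrow> q"
    assume "\<And>i. i \<in> I \<Longrightarrow> u i = v i" "even (card {i\<in>I. fst (u i)})"
    then show "even (card {i\<in>I. fst (v i)})" by (metis (mono_tags, lifting) Collect_cong)
  qed simp
qed

definition lam :: "'i set \<Rightarrow> bool" where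
  "lam P \<longleftrightarrow> \<not> M (vec P {})"

lemma vec_eq: "M x = M (vec {i\<in>I. fst (x i)} {i\<in>I. snd (x i)})"
  by (rule mds_agree[OF M]) (auto simp: vec_def)

text \<open>Among the letters that keep the class at \<open>i\<close>, exactly one gives a codeword,
  so membership alternates as elements are added to \<open>S\<close>. The Boolean function
  \<open>lam\<close> on even sets thus describes the whole code.\<close>

lemma M_vec:
  assumes P: "P \<subseteq> I" and S: "S \<subseteq> I"
  shows "M (vec P S) \<longleftrightarrow> even (card P) \<and> (odd (card S) \<longleftrightarrow> lam P)"
proof (cases "even (card P)")
  case False
  have "{i\<in>I. fst (vec P S i)} = P" using P by (auto simp: vec_def)
  then show ?thesis using False parity[of "vec P S"] by auto
next
  case True
  have "finite S" using fin_sub S by auto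
  then have "M (vec P S) \<longleftrightarrow> (odd (card S) \<longleftrightarrow> lam P)"
    using S
  proof (induction S rule: finite_induct)
    case empty
    then show ?case by (simp add: lam_def)
  next
    case (insert i S)
    then have i: "i \<in> I" by auto
    let ?x = "vec P S"
    have a: "?x(i := (i \<in> P, True)) = vec P (insert i S)" "?x(i := (i \<in> P, False)) = vec P S"
      using insert.hyps by (auto simp: vec_def)
    have "{j\<in>I. fst (?x j)} = P" using P by (auto simp: vec_def)
    then have "\<not> M (?x(i := v))" if "fst v \<noteq> (i \<in> P)" for v
      using that parity[of "?x(i := v)"] odd_card_fun_upd[OF fin i, of fst ?x v] True
      by (auto simp: vec_def)
    moreover obtain v where "M (?x(i := v))" using mds_ex[OF M i] by blast
    ultimately have "M (?x(i := (i \<in> P, True))) \<or> M (?x(i := (i \<in> P, False)))"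
      by (metis (full_types) prod.collapse)
    moreover have "\<not> (M (?x(i := (i \<in> P, True))) \<and> M (?x(i := (i \<in> P, False))))"
      using mds_unique[OF M i] by blast
    ultimately show ?case using insert unfolding a by auto
  qed
  with True show ?thesis by simp
qed

lemma lam_empty: "\<not> lam {}"
  using zero by (simp add: lam_def vec_def)

text \<open>If \<open>card I\<close> is even, both the zero and the all-one vector of classes occur.
  Over each of them take a set of second components and its complement, whose sizes have the same
  parity.\<close>

lemma even_card_transversal:
  assumes "even (card I)"
  shows "\<not> transversal_free I M"
proof -
  obtain k where k: "k \<in> I" using ne by auto
  define S where "S = (if lam I then {k} else {})"
  have S: "S \<subseteq> I" "odd (card S) \<longleftrightarrow> lam I" using k by (auto simp: S_def)
  have "odd (card (I - S)) \<longleftrightarrow> lam I"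
    using assms S fin card_mono[OF fin S(1)] by (simp add: card_Diff_subset fin_sub)
  then have "M (vec {} {})" "M (vec {} I)" "M (vec I S)" "M (vec I (I - S))"
    using M_vec assms S lam_empty by auto
  moreover have "\<forall>i\<in>I. distinct [vec {} {} i, vec {} I i, vec I S i, vec I (I - S) i]"
    by (auto simp: vec_def)
  ultimately show ?thesis unfolding transversal_free_def by blast
qed

end

lemma odd_card_Diff:
  assumes "finite B" "A \<subseteq> B"
  shows "odd (card (B - A)) \<longleftrightarrow> (odd (card B) \<noteq> odd (card A))"
proof -
  have "card (B - A) + card A = card B"
    using assms card_mono[of B A] by (simp add: card_Diff_subset finite_subset)
  then have "even (card B) \<longleftrightarrow> (even (card (B - A)) \<longleftrightarrow> even (card A))"
    unfolding even_add[symmetric] by simp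
  then show ?thesis by blast
qed

lemma odd_card_Un_disjoint:
  assumes "finite A" "finite B" "A \<inter> B = {}"
  shows "odd (card (A \<union> B)) \<longleftrightarrow> (odd (card A) \<noteq> odd (card B))"
  using assms by (simp add: card_Un_disjoint)

lemma even_card_sym_diff_Un:
  assumes "finite P" "finite X" "finite Y" "X \<inter> Y = {}" "even (card P)" "odd (card X)" "odd (card Y)"
  shows "even (card (sym_diff P (X \<union> Y)))"
  using odd_card_sym_diff[of P "X \<union> Y"] odd_card_Un_disjoint[of X Y] assms by simp

lemma sym_diff_assoc: "sym_diff (sym_diff A B) C = sym_diff A (sym_diff B C)"
  by auto

lemma sym_diff_commute: "sym_diff A B = sym_diff B A"
  by auto

context normal_semilinear
begin

lemma ex_odd_iff: "k \<in> B \<Longrightarrow> \<exists>T\<subseteq>B. odd (card T) \<longleftrightarrow> c"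
  by (cases c) (auto intro: exI[of _ "{k}"] exI[of _ "{}"])

text \<open>On each block the four sets \<open>P\<close>, \<open>P2\<close>, \<open>P3\<close>,
  \<open>P4\<close> form two pairs: equal within a pair, complementary between the pairs. A
  transversal needs second components that are complementary within each pair, so altogether they
  have an even number of entries. This is the only obstruction: if the four values of
  \<open>lam\<close> had an even sum, there would be a transversal.\<close>

lemma lam_quadruple:
  assumes tf: "transversal_free I M" and P: "P \<subseteq> I" "even (card P)"
    and B: "B2 \<union> B3 \<union> B4 = I" "B2 \<inter> B3 = {}" "B2 \<inter> B4 = {}" "B3 \<inter> B4 = {}"
    and odd: "odd (card B2)" "odd (card B3)" "odd (card B4)"
  shows "(lam P \<noteq> lam (sym_diff P (B3 \<union> B4))) \<noteq> (lam (sym_diff P (B2 \<union> B4)) \<noteq> lam (sym_diff P (B2 \<union> B3)))"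
proof (rule ccontr)
  define P2 P3 P4 where Ps: "P2 = sym_diff P (B3 \<union> B4)" "P3 = sym_diff P (B2 \<union> B4)" "P4 = sym_diff P (B2 \<union> B3)"
  assume "\<not> ?thesis"
  then have l: "(lam P \<noteq> lam P2) = (lam P3 \<noteq> lam P4)" by (simp add: Ps)
  have fB: "finite B2" "finite B3" "finite B4" "finite P" using B(1) fin fin_sub[OF P(1)] by (metis finite_Un)+
  have sub: "P2 \<subseteq> I" "P3 \<subseteq> I" "P4 \<subseteq> I" using P B by (auto simp: Ps)
  have ev: "even (card P2)" "even (card P3)" "even (card P4)"
    unfolding Ps
    using even_card_sym_diff_Un[OF fB(4,2,3) B(4) P(2) odd(2,3)] even_card_sym_diff_Un[OF fB(4,1,3) B(3) P(2) odd(1,3)]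
      even_card_sym_diff_Un[OF fB(4,1,2) B(2) P(2) odd(1,2)]
    by blast+
  have ne: "B2 \<noteq> {}" "B3 \<noteq> {}" "B4 \<noteq> {}" using odd by auto
  obtain T2 T3 T4 where T: "T2 \<subseteq> B2" "odd (card T2) \<longleftrightarrow> \<not> lam P2" "T3 \<subseteq> B3" "odd (card T3) \<longleftrightarrow> lam P3"
      "T4 \<subseteq> B4" "odd (card T4) \<longleftrightarrow> \<not> lam P4"
    using ne ex_odd_iff by (metis all_not_in_conv)
  \<comment> \<open>\<open>T2\<close>, \<open>T3\<close>, \<open>T4\<close> are free and set the
    parities of \<open>S2\<close>, \<open>S3\<close>, \<open>S4\<close>; the parity of
    \<open>S1\<close> is then right because of \<open>l\<close>.\<close>
  define S1 S2 S3 S4 where S: "S1 = T2 \<union> (T3 \<union> T4)" "S2 = B2 - T2" "S3 = (B3 - T3) \<union> B4"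
    "S4 = (B4 - T4) \<union> (B2 \<union> B3)"
  have fT: "finite T2" "finite T3" "finite T4" using T fB finite_subset by blast+
  have dj: "T2 \<inter> (T3 \<union> T4) = {}" "T3 \<inter> T4 = {}" "(B3 - T3) \<inter> B4 = {}" "(B4 - T4) \<inter> (B2 \<union> B3) = {}"
    using T B by auto
  have "odd (card S1) \<longleftrightarrow> lam P"
    unfolding S using fT dj T l by (auto simp: odd_card_Un_disjoint simp del: card_Un_disjoint)
  moreover have "odd (card S2) \<longleftrightarrow> lam P2"
    unfolding S using fB T odd by (simp add: odd_card_Diff)
  moreover have "odd (card S3) \<longleftrightarrow> lam P3"
    unfolding S using fB dj T odd by (simp add: odd_card_Un_disjoint odd_card_Diff)
  moreover have "odd (card S4) \<longleftrightarrow> lam P4"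
    unfolding S using fB dj T odd B by (simp add: odd_card_Un_disjoint odd_card_Diff)
  moreover have "S1 \<subseteq> I" "S2 \<subseteq> I" "S3 \<subseteq> I" "S4 \<subseteq> I" using T B by (auto simp: S)
  ultimately have "M (vec P S1)" "M (vec P2 S2)" "M (vec P3 S3)" "M (vec P4 S4)"
    using M_vec P sub ev by simp_all
  moreover have "distinct [vec P S1 i, vec P2 S2 i, vec P3 S3 i, vec P4 S4 i]" if "i \<in> I" for i
  proof -
    consider "i \<in> B2" "i \<notin> B3" "i \<notin> B4" | "i \<notin> B2" "i \<in> B3" "i \<notin> B4" | "i \<notin> B2" "i \<notin> B3" "i \<in> B4"
      using \<open>i \<in> I\<close> B by blast
    then show ?thesis
      using T by cases (auto simp: vec_def Ps S)
  qed
  ultimately show False using tf unfolding transversal_free_def by blast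
qed

text \<open>The sizes in a quadruple add up to \<open>2 * card I\<close> with \<open>card I\<close>
  odd. Correcting by half the size therefore turns the odd sums of \<open>lam\<close> into even
  sums, as an affine function has them. In the cyclic labels the correction reappears as the
  carry.\<close>

definition nu :: "'i set \<Rightarrow> bool" where
  "nu P \<longleftrightarrow> (lam P \<noteq> odd (card P div 2))"

lemma nu_quadruple:
  assumes tf: "transversal_free I M" and P: "P \<subseteq> I" "even (card P)"
    and B: "B2 \<union> B3 \<union> B4 = I" "B2 \<inter> B3 = {}" "B2 \<inter> B4 = {}" "B3 \<inter> B4 = {}"
    and odd: "odd (card B2)" "odd (card B3)" "odd (card B4)"
  shows "(nu P \<noteq> nu (sym_diff P (B3 \<union> B4))) \<longleftrightarrow> (nu (sym_diff P (B2 \<union> B4)) \<noteq> nu (sym_diff P (B2 \<union> B3)))"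
proof -
  define P2 P3 P4 where Ps: "P2 = sym_diff P (B3 \<union> B4)" "P3 = sym_diff P (B2 \<union> B4)" "P4 = sym_diff P (B2 \<union> B3)"
  have fB: "finite B2" "finite B3" "finite B4" "finite P" using B(1) fin fin_sub[OF P(1)] by (metis finite_Un)+
  have dec: "card A = card (A \<inter> B2) + card (A \<inter> B3) + card (A \<inter> B4)" if "A \<subseteq> I" for A
  proof -
    have "A = (A \<inter> B2 \<union> A \<inter> B3) \<union> A \<inter> B4" using that B by auto
    also have "card \<dots> = card (A \<inter> B2) + card (A \<inter> B3) + card (A \<inter> B4)"
      using fB B by (subst card_Un_disjoint card_Un_disjoint; auto)+
    finally show ?thesis .
  qed
  have diff: "card (B - P) + card (P \<inter> B) = card B" if "finite B" for B
    using that card_Diff_subset_Int[of B P] card_mono[of B "P \<inter> B"] by (simp add: Int_commute)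
  have sub: "P2 \<subseteq> I" "P3 \<subseteq> I" "P4 \<subseteq> I" using P B by (auto simp: Ps)
  have i: "P2 \<inter> B2 = P \<inter> B2" "P2 \<inter> B3 = B3 - P" "P2 \<inter> B4 = B4 - P"
    "P3 \<inter> B2 = B2 - P" "P3 \<inter> B3 = P \<inter> B3" "P3 \<inter> B4 = B4 - P"
    "P4 \<inter> B2 = B2 - P" "P4 \<inter> B3 = B3 - P" "P4 \<inter> B4 = P \<inter> B4"
    using B by (auto simp: Ps)
  define d where "d = card B2 + card B3 + card B4"
  \<comment> \<open>Every element of \<open>I\<close> lies in exactly two of the four sets.\<close>
  have sum: "card P + card P2 + card P3 + card P4 = 2 * d"
    using dec[OF P(1)] dec[OF sub(1)] dec[OF sub(2)] dec[OF sub(3)] diff[OF fB(1)] diff[OF fB(2)] diff[OF fB(3)]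
    unfolding i d_def by simp
  have "odd d" using odd by (simp add: d_def)
  have ev: "even (card P2)" "even (card P3)" "even (card P4)"
    unfolding Ps
    using even_card_sym_diff_Un[OF fB(4,2,3) B(4) P(2) odd(2,3)] even_card_sym_diff_Un[OF fB(4,1,3) B(3) P(2) odd(1,3)]
      even_card_sym_diff_Un[OF fB(4,1,2) B(2) P(2) odd(1,2)]
    by blast+
  have "card P div 2 + card P2 div 2 + card P3 div 2 + card P4 div 2 = d"
    using sum P(2) ev by (auto elim!: evenE)
  then have "odd (card P div 2 + card P2 div 2 + card P3 div 2 + card P4 div 2)"
    using \<open>odd d\<close> by simp
  then have "((odd (card P div 2) \<noteq> odd (card P2 div 2)) \<noteq> (odd (card P3 div 2) \<noteq> odd (card P4 div 2)))"
    unfolding even_add by blast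
  then show ?thesis
    using lam_quadruple[OF tf P B odd, folded Ps] unfolding nu_def Ps[symmetric] by argo
qed

text \<open>If \<open>a\<close> is \<open>c\<close> or \<open>e\<close>, this is the quadruple with
  blocks \<open>{c}\<close>, \<open>{e}\<close> and the rest. For any other \<open>a\<close> choose
  a further element \<open>b\<close>: the quadruple of \<open>sym_diff P {a, b}\<close> with blocks
  \<open>{a}\<close>, \<open>{b, c, e}\<close> and the rest is combined with the first case for the
  pair \<open>{a, b}\<close>.\<close>

lemma nu_pair_shift:
  assumes tf: "transversal_free I M" and P: "P \<subseteq> I" "even (card P)" and "odd (card I)"
    and ce: "c \<in> I" "e \<in> I" "c \<noteq> e" and a: "a \<in> I"
  shows "(nu P \<noteq> nu (sym_diff P {c, e})) \<longleftrightarrow>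
    (nu (sym_diff P (I - {a})) \<noteq> nu (sym_diff (sym_diff P (I - {a})) {c, e}))"
proof -
  have ends: "(nu P \<noteq> nu (sym_diff P {c, e})) \<longleftrightarrow>
      (nu (sym_diff P (I - {c})) \<noteq> nu (sym_diff (sym_diff P (I - {c})) {c, e}))"
    if P: "P \<subseteq> I" "even (card P)" and ce: "c \<in> I" "e \<in> I" "c \<noteq> e" for P c e
  proof -
    have "odd (card (I - {c, e}))"
      using \<open>odd (card I)\<close> fin ce by (subst odd_card_Diff) auto
    moreover have "sym_diff P ({c} \<union> {e}) = sym_diff P {c, e}"
      "sym_diff P (I - {c, e} \<union> {e}) = sym_diff P (I - {c})"
      "sym_diff P (I - {c, e} \<union> {c}) = sym_diff (sym_diff P (I - {c})) {c, e}"
      using ce P by auto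
    ultimately show ?thesis
      using nu_quadruple[OF tf P, of "I - {c, e}" "{c}" "{e}"] ce by auto
  qed
  show ?thesis
  proof (cases "a \<in> {c, e}")
    case True
    then show ?thesis using ends[OF P ce] ends[OF P ce(2,1) ce(3)[symmetric]] by (auto simp: insert_commute)
  next
    case False
    show ?thesis
    proof (cases "I = {a, c, e}")
      \<comment> \<open>Here no \<open>b\<close> is left, but the shift by \<open>I - {a}\<close> is
        the pair \<open>{c, e}\<close> itself.\<close>
      case True
      then have "I - {a} = {c, e}" using False by auto
      moreover have "sym_diff (sym_diff P {c, e}) {c, e} = P" by auto
      ultimately show ?thesis by auto
    next
      case I: False
      then obtain b where b: "b \<in> I" "b \<notin> {a, c, e}" using a ce by blast
      let ?P = "sym_diff P {a, b}"
      have "odd (card ?P) \<longleftrightarrow> odd (card P)"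
        using P fin_sub b by (subst odd_card_sym_diff) auto
      then have P': "?P \<subseteq> I" "even (card ?P)" using P a b by auto
      have 4: "card {a, b, c, e} = 4" using b False ce by auto
      have "odd (card (I - {a, b, c, e}))"
        using \<open>odd (card I)\<close> fin a b ce 4 by (subst odd_card_Diff) auto
      moreover have "odd (card {b, c, e})" using b ce by simp
      moreover have "sym_diff ?P ({a} \<union> {b, c, e}) = sym_diff P {c, e}"
        "sym_diff ?P (I - {a, b, c, e} \<union> {b, c, e}) = sym_diff (sym_diff ?P (I - {a})) {}"
        "sym_diff ?P (I - {a, b, c, e} \<union> {a}) = sym_diff (sym_diff P (I - {a})) {c, e}"
        using a b ce P False by auto
      ultimately have "(nu ?P \<noteq> nu (sym_diff P {c, e})) \<longleftrightarrow>
          (nu (sym_diff ?P (I - {a})) \<noteq> nu (sym_diff (sym_diff P (I - {a})) {c, e}))"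
        using nu_quadruple[OF tf P', of "I - {a, b, c, e}" "{a}" "{b, c, e}"] a b ce False by auto
      moreover have "(nu P \<noteq> nu ?P) \<longleftrightarrow>
          (nu (sym_diff P (I - {a})) \<noteq> nu (sym_diff ?P (I - {a})))"
        using ends[OF P a b(1)] b(2) unfolding sym_diff_assoc sym_diff_commute[of "{a, b}" "I - {a}"] by blast
      ultimately show ?thesis by blast
    qed
  qed
qed

text \<open>Shifts by \<open>I - {a}\<close> and by \<open>I - {b}\<close> compose to a shift by
  \<open>{a, b}\<close>. So removing two elements of \<open>P\<close> does not change the increment
  along \<open>{c, e}\<close>.\<close>

lemma nu_pair_const:
  assumes tf: "transversal_free I M" and P: "P \<subseteq> I" "even (card P)" and "odd (card I)"
    and ce: "c \<in> I" "e \<in> I" "c \<noteq> e"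
  shows "(nu P \<noteq> nu (sym_diff P {c, e})) \<longleftrightarrow> (nu {} \<noteq> nu {c, e})"
  using P
proof (induction "card P" arbitrary: P rule: less_induct)
  case less
  note I = \<open>odd (card I)\<close>
  show ?case
  proof (cases "P = {}")
    case False
    have fP: "finite P" using less.prems fin_sub by simp
    obtain a where a: "a \<in> P" using False by auto
    have "P \<noteq> {a}" using less.prems by auto
    then obtain b where b: "b \<in> P" "b \<noteq> a" using a by auto
    let ?Q = "P - {a, b}" and ?R = "sym_diff P (I - {a})"
    have ab: "a \<in> I" "b \<in> I" using a b less.prems by auto
    have Q: "card ?Q < card P" using a fP by (intro psubset_card_mono) auto
    have "odd (card ?Q) \<longleftrightarrow> odd (card P)" using a b fP by (subst odd_card_Diff) auto
    then have Q': "?Q \<subseteq> I" "even (card ?Q)" using less.prems by auto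
    have "odd (card ?R) \<longleftrightarrow> odd (card P)"
      using fP fin ab I by (simp add: odd_card_sym_diff odd_card_Diff)
    then have R: "?R \<subseteq> I" "even (card ?R)" using less.prems by auto
    have "sym_diff ?R (I - {b}) = ?Q" using a b ab less.prems by auto
    then have "(nu P \<noteq> nu (sym_diff P {c, e})) \<longleftrightarrow> (nu ?Q \<noteq> nu (sym_diff ?Q {c, e}))"
      using nu_pair_shift[OF tf less.prems I ce ab(1)] nu_pair_shift[OF tf R I ce ab(2)] by simp
    then show ?thesis using less.hyps[OF Q Q'] by simp
  qed auto
qed

lemma nu_affine:
  assumes tf: "transversal_free I M" and "odd (card I)"
  obtains L where "\<And>P. P \<subseteq> I \<Longrightarrow> even (card P) \<Longrightarrow> nu P \<longleftrightarrow> odd (card (P \<inter> L))"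
proof -
  obtain a where a: "a \<in> I" using ne by auto
  \<comment> \<open>On even sets a constant added to a linear form is invisible, so the form may be
    chosen to vanish at \<open>a\<close>.\<close>
  define L where "L = {i. i \<noteq> a \<and> nu {a, i}}"
  have nu0: "\<not> nu {}" by (simp add: nu_def lam_empty)
  have pair: "nu {c, e} \<longleftrightarrow> ((c \<in> L) \<noteq> (e \<in> L))" if ce: "c \<in> I" "e \<in> I" "c \<noteq> e" for c e
  proof (cases "a \<in> {c, e}")
    case True
    then show ?thesis using that by (auto simp: L_def insert_commute)
  next
    case False
    have "sym_diff {a, c} {c, e} = {a, e}" using False ce by auto
    then have "(nu {a, c} \<noteq> nu {a, e}) \<longleftrightarrow> (nu {} \<noteq> nu {c, e})"
      using nu_pair_const[OF tf, of "{a, c}" c e] False a that assms(2) by simp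
    then show ?thesis using nu0 False by (auto simp: L_def)
  qed
  have "nu P \<longleftrightarrow> odd (card (P \<inter> L))" if "P \<subseteq> I" "even (card P)" for P
    using that
  proof (induction "card P" arbitrary: P rule: less_induct)
    case less
    show ?case
    proof (cases "P = {}")
      case False
      have fP: "finite P" using less.prems fin_sub by simp
      obtain c where c: "c \<in> P" using False by auto
      have "P \<noteq> {c}" using less.prems by auto
      then obtain e where e: "e \<in> P" "e \<noteq> c" using c by auto
      let ?Q = "P - {c, e}"
      have Q: "card ?Q < card P" using c fP by (intro psubset_card_mono) auto
      have "odd (card ?Q) \<longleftrightarrow> odd (card P)" using c e fP by (subst odd_card_Diff) auto
      then have Q': "?Q \<subseteq> I" "even (card ?Q)" using less.prems by auto
      have ce: "c \<in> I" "e \<in> I" "c \<noteq> e" using c e less.prems by auto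
      have "sym_diff ?Q {c, e} = P" using c e by auto
      then have 1: "(nu ?Q \<noteq> nu P) \<longleftrightarrow> ((c \<in> L) \<noteq> (e \<in> L))"
        using nu_pair_const[OF tf Q' assms(2) ce] pair[OF ce] nu0 by simp
      have "P \<inter> L = ?Q \<inter> L \<union> {c, e} \<inter> L" using c e by auto
      then have "odd (card (P \<inter> L)) \<longleftrightarrow> (odd (card (?Q \<inter> L)) \<noteq> odd (card ({c, e} \<inter> L)))"
        using fP by (simp add: odd_card_Un_disjoint disjoint_iff del: card_Un_disjoint)
      moreover have "odd (card ({c, e} \<inter> L)) \<longleftrightarrow> ((c \<in> L) \<noteq> (e \<in> L))"
        using ce by (cases "c \<in> L"; cases "e \<in> L") auto
      ultimately show ?thesis using 1 less.hyps[OF Q Q'] by blast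
    qed (simp add: nu0)
  qed
  then show ?thesis using that by blast
qed

lemma Z4_code_if_transversal_free:
  assumes tf: "transversal_free I M"
  shows "odd (card I)" "Z4_code I M"
proof -
  show odd: "odd (card I)" using even_card_transversal tf by blast
  obtain L where L: "\<And>P. P \<subseteq> I \<Longrightarrow> even (card P) \<Longrightarrow> nu P \<longleftrightarrow> odd (card (P \<inter> L))"
    using nu_affine[OF tf odd] by blast
  \<comment> \<open>The letters get the numbers 0 to 3 in binary, with 1 and 3 exchanged at the
    coordinates in \<open>L\<close>. The low bits add up to \<open>card ?P\<close>, and half of it
    is the carry that \<open>nu\<close> splits off from \<open>lam\<close>.\<close>
  define \<sigma> :: "'i \<Rightarrow> q \<Rightarrow> nat" where
    "\<sigma> i v = of_bool (fst v) + 2 * of_bool (snd v \<noteq> (fst v \<and> i \<in> L))" for i v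
  have UN: "(UNIV :: q set) = {c0, c1, c2, c3}" by auto
  have "bij_betw (\<sigma> i) UNIV {..<4}" for i
    by (cases "i \<in> L") (auto simp: bij_betw_def inj_on_def \<sigma>_def UN lessThan_Suc eval_nat_numeral)
  moreover have "M x \<longleftrightarrow> 4 dvd (\<Sum>i\<in>I. \<sigma> i (x i))" for x
  proof -
    let ?P = "{i\<in>I. fst (x i)}" and ?S = "{i\<in>I. snd (x i)}"
    let ?T = "sym_diff ?S (?P \<inter> L)"
    have "(\<Sum>i\<in>I. \<sigma> i (x i)) = (\<Sum>i\<in>I. of_bool (i \<in> ?P)) + 2 * (\<Sum>i\<in>I. of_bool (i \<in> ?T))"
      unfolding sum_distrib_left sum.distrib[symmetric] by (rule sum.cong) (auto simp: \<sigma>_def)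
    also have "\<dots> = card (I \<inter> {i. i \<in> ?P}) + 2 * card (I \<inter> {i. i \<in> ?T})"
      using fin by (simp only: sum_of_bool_eq of_nat_id)
    also have "I \<inter> {i. i \<in> ?P} = ?P" by auto
    also have "I \<inter> {i. i \<in> ?T} = ?T" by auto
    finally have sum: "(\<Sum>i\<in>I. \<sigma> i (x i)) = card ?P + 2 * card ?T" .
    have T: "odd (card ?T) \<longleftrightarrow> (odd (card ?S) \<noteq> odd (card (?P \<inter> L)))"
      using fin by (intro odd_card_sym_diff) auto
    have "4 dvd card ?P + 2 * card ?T \<longleftrightarrow> even (card ?P) \<and> (odd (card ?T) \<longleftrightarrow> odd (card ?P div 2))"
      by presburger
    also have "\<dots> \<longleftrightarrow> even (card ?P) \<and> (odd (card ?S) \<longleftrightarrow> lam ?P)"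
      using L[of ?P] T by (auto simp: nu_def)
    also have "\<dots> \<longleftrightarrow> M x"
      using M_vec[of ?P ?S] vec_eq[of x] by auto
    finally show ?thesis unfolding sum by simp
  qed
  ultimately show "Z4_code I M" unfolding Z4_code_def by blast
qed

end

section \<open>Semilinearity is determined by quaternary subcodes\<close>

definition sh :: "('i \<Rightarrow> q) \<Rightarrow> 'i \<Rightarrow> 'i \<Rightarrow> ('i \<Rightarrow> q) \<Rightarrow> 'i \<Rightarrow> q" where
  "sh \<alpha> i j x = x(i := x i \<oplus> \<alpha> i, j := x j \<oplus> \<alpha> j)"

lemma sh_commute: "i \<noteq> j \<Longrightarrow> k \<noteq> l \<Longrightarrow> sh \<alpha> i j (sh \<beta> k l x) = sh \<beta> k l (sh \<alpha> i j x)"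
  by (auto simp: sh_def fun_eq_iff xor_ac)

lemma sh_sh [simp]: "i \<noteq> j \<Longrightarrow> sh \<alpha> i j (sh \<alpha> i j x) = x"
  by (auto simp: sh_def fun_eq_iff)

lemma sh_compose: "i \<noteq> p \<Longrightarrow> p \<noteq> j \<Longrightarrow> i \<noteq> j \<Longrightarrow> sh \<alpha> p j (sh \<alpha> i p x) = sh \<alpha> i j x"
  by (auto simp: sh_def fun_eq_iff)

lemma sh_swap: "i \<noteq> j \<Longrightarrow> sh \<alpha> i j x = sh \<alpha> j i x"
  by (auto simp: sh_def fun_eq_iff)

lemma sh_upd: "k \<noteq> i \<Longrightarrow> k \<noteq> j \<Longrightarrow> (sh \<alpha> i j x)(k := v) = sh \<alpha> i j (x(k := v))"
  by (auto simp: sh_def fun_eq_iff)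

lemma sh_cong: "\<alpha> i = \<beta> i \<Longrightarrow> \<alpha> j = \<beta> j \<Longrightarrow> sh \<alpha> i j x = sh \<beta> i j x"
  by (simp add: sh_def)

lemma sh_apply: "sh \<alpha> i j x k = (if k = i \<or> k = j then x k \<oplus> \<alpha> k else x k)"
  by (auto simp: sh_def)

lemma sh_override: "i \<in> T \<Longrightarrow> j \<in> T \<Longrightarrow> override_on w (sh \<alpha> i j x) T = sh \<alpha> i j (override_on w x T)"
  by (auto simp: sh_def fun_eq_iff override_on_def)

lemma invariantI:
  "(\<And>x i j. i \<in> I \<Longrightarrow> j \<in> I \<Longrightarrow> i \<noteq> j \<Longrightarrow> M x \<Longrightarrow> M (sh \<alpha> i j x)) \<Longrightarrow> invariant I M \<alpha>"
  unfolding invariant_def sh_def by blast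

lemma invariantD: "invariant I M \<alpha> \<Longrightarrow> i \<in> I \<Longrightarrow> j \<in> I \<Longrightarrow> i \<noteq> j \<Longrightarrow> M x \<Longrightarrow> M (sh \<alpha> i j x)"
  unfolding invariant_def sh_def by blast

lemma invariant_cong: "invariant I M \<alpha> \<Longrightarrow> (\<And>i. i \<in> I \<Longrightarrow> \<alpha> i = \<beta> i) \<Longrightarrow> invariant I M \<beta>"
  unfolding invariant_def by simp

lemma invariant_zero: "mds I M \<Longrightarrow> invariant I M (\<lambda>_. c0)"
  unfolding invariant_def by simp

lemma invariant_xor:
  assumes "invariant I M \<alpha>" "invariant I M \<beta>"
  shows "invariant I M (\<lambda>i. \<alpha> i \<oplus> \<beta> i)"
proof (rule invariantI)
  fix x i j assume ij: "i \<in> I" "j \<in> I" "i \<noteq> j" and "M x"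
  then have "M (sh \<beta> i j (sh \<alpha> i j x))"
    using assms by (blast intro: invariantD)
  also have "sh \<beta> i j (sh \<alpha> i j x) = sh (\<lambda>i. \<alpha> i \<oplus> \<beta> i) i j x"
    using ij by (auto simp: sh_def fun_eq_iff xor_assoc)
  finally show "M (sh (\<lambda>i. \<alpha> i \<oplus> \<beta> i) i j x)" .
qed

text \<open>In a codeword only one change at \<open>j\<close> compensates the change at
  \<open>i\<close>.\<close>

lemma invariant_unique:
  assumes M: "mds I M" and inv: "invariant I M \<alpha>" "invariant I M \<beta>" and ij: "i \<in> I" "j \<in> I" "\<alpha> i = \<beta> i"
  shows "\<alpha> j = \<beta> j"
proof (cases "i = j")
  case False
  obtain x where x: "M x" using mds_ex[OF M ij(1)] by blast
  have "M (x(i := x i \<oplus> \<alpha> i, j := x j \<oplus> \<alpha> j))" "M (x(i := x i \<oplus> \<alpha> i, j := x j \<oplus> \<beta> j))"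
    using invariantD[OF inv(1) ij(1,2) False x] invariantD[OF inv(2) ij(1,2) False x] ij(3)
    unfolding sh_def by metis+
  then show ?thesis using mds_unique[OF M ij(2)] xor_simps(7) by metis
qed (use ij in simp)

section \<open>Subcodes and full codes\<close>

definition subcode :: "'i \<Rightarrow> q \<Rightarrow> (('i \<Rightarrow> q) \<Rightarrow> bool) \<Rightarrow> ('i \<Rightarrow> q) \<Rightarrow> bool" where
  "subcode k v M = (\<lambda>x. M (x(k := v)))"

definition restrict_code :: "'i set \<Rightarrow> ('i \<Rightarrow> q) \<Rightarrow> (('i \<Rightarrow> q) \<Rightarrow> bool) \<Rightarrow> ('i \<Rightarrow> q) \<Rightarrow> bool" where
  "restrict_code T w M = (\<lambda>x. M (override_on w x T))"

lemma mds_subcode: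
  assumes M: "mds I M"
  shows "mds (I - {k}) (subcode k v M)"
  unfolding mds_def subcode_def
proof (intro conjI allI impI ballI)
  show "finite (I - {k})" using mds_finite[OF M] by simp
next
  fix x y :: "'a \<Rightarrow> q" assume "\<forall>i\<in>I - {k}. x i = y i"
  then show "M (x(k := v)) = M (y(k := v))" by (intro mds_agree[OF M]) auto
next
  fix i and x :: "'a \<Rightarrow> q" assume i: "i \<in> I - {k}"
  then have "(x(i := u))(k := v) = (x(k := v))(i := u)" for u by (auto simp: fun_upd_twist)
  then show "\<exists>!u. M ((x(i := u))(k := v))" using M i unfolding mds_def by simp
qed

lemma mds_restrict_code:
  assumes M: "mds I M" and T: "T \<subseteq> I"
  shows "mds T (restrict_code T w M)"
  unfolding mds_def restrict_code_def
proof (intro conjI allI impI ballI)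
  show "finite T" using mds_finite[OF M] T finite_subset by blast
next
  fix x y :: "'a \<Rightarrow> q" assume "\<forall>i\<in>T. x i = y i"
  then show "M (override_on w x T) = M (override_on w y T)" by (intro mds_agree[OF M]) (auto simp: override_on_def)
next
  fix i and x :: "'a \<Rightarrow> q" assume i: "i \<in> T"
  then have "override_on w (x(i := u)) T = (override_on w x T)(i := u)" for u by (auto simp: override_on_def)
  then show "\<exists>!u. M (override_on w (x(i := u)) T)" using M i T unfolding mds_def by (metis subsetD)
qed

lemma invariant_subcode: "invariant I M \<alpha> \<Longrightarrow> invariant (I - {k}) (subcode k v M) \<alpha>"
  by (intro invariantI) (auto simp: subcode_def sh_upd intro: invariantD)

lemma invariant_restrict_code: "invariant I M \<alpha> \<Longrightarrow> T \<subseteq> I \<Longrightarrow> invariant T (restrict_code T w M) \<alpha>"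
  by (intro invariantI) (auto simp: restrict_code_def sh_override intro: invariantD)

lemma subcode_commute: "k \<noteq> m \<Longrightarrow> subcode k v (subcode m a M) = subcode m a (subcode k v M)"
  by (auto simp: subcode_def fun_eq_iff fun_upd_twist)

lemma restrict_subcode: "k \<notin> T \<Longrightarrow> restrict_code T w (subcode k v M) = restrict_code T (w(k := v)) M"
  by (auto simp: restrict_code_def subcode_def fun_eq_iff intro!: arg_cong[of _ _ M] simp: override_on_def)

text \<open>A code is full when its invariant translations take all four values at every coordinate;
  a square is full iff it is isotopic to the Klein four-group.\<close>

definition full :: "'i set \<Rightarrow> (('i \<Rightarrow> q) \<Rightarrow> bool) \<Rightarrow> bool" where
  "full I M \<longleftrightarrow> (\<exists>\<alpha> \<beta>. invariant I M \<alpha> \<and> invariant I M \<beta> \<and> (\<forall>i\<in>I. \<alpha> i \<noteq> c0 \<and> \<beta> i \<noteq> c0 \<and> \<alpha> i \<noteq> \<beta> i))"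

lemma full_restrict_code: "full I M \<Longrightarrow> T \<subseteq> I \<Longrightarrow> full T (restrict_code T w M)"
  unfolding full_def by (meson invariant_restrict_code subsetD)

lemma q_span: "\<alpha> \<noteq> c0 \<Longrightarrow> \<beta> \<noteq> c0 \<Longrightarrow> \<alpha> \<noteq> \<beta> \<Longrightarrow> a = c0 \<or> a = \<alpha> \<or> a = \<beta> \<or> a = \<alpha> \<oplus> \<beta>"
  by (cases \<alpha>; cases \<beta>; cases a) (auto simp: xor_def)

lemma full_ex:
  assumes M: "mds I M" and "full I M" "i \<in> I"
  shows "\<exists>\<gamma>. invariant I M \<gamma> \<and> \<gamma> i = a"
proof -
  obtain \<alpha> \<beta> where *: "invariant I M \<alpha>" "invariant I M \<beta>" "\<forall>i\<in>I. \<alpha> i \<noteq> c0 \<and> \<beta> i \<noteq> c0 \<and> \<alpha> i \<noteq> \<beta> i"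
    using assms unfolding full_def by blast
  consider "a = c0" | "a = \<alpha> i" | "a = \<beta> i" | "a = \<alpha> i \<oplus> \<beta> i"
    using * \<open>i \<in> I\<close> q_span by metis
  then show ?thesis
    by cases (use * invariant_zero[OF M] invariant_xor[OF *(1,2)] in blast)+
qed

lemma invariant_nonzero:
  assumes "mds I M" "invariant I M \<alpha>" "i \<in> I" "\<alpha> i \<noteq> c0" "j \<in> I"
  shows "\<alpha> j \<noteq> c0"
  using invariant_unique[OF assms(1,2) invariant_zero[OF assms(1)] assms(5,3)] assms(4) by auto

text \<open>Translations that differ at one coordinate differ at all, so two nowhere zero ones would
  make the code full. All gluing of translations rests on this uniqueness.\<close>

lemma not_full_unique:
  assumes "mds I M" "\<not> full I M" "invariant I M g" "invariant I M h"
    and "\<And>i. i \<in> I \<Longrightarrow> g i \<noteq> c0" "\<And>i. i \<in> I \<Longrightarrow> h i \<noteq> c0" "j \<in> I"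
  shows "g j = h j"
proof (rule ccontr)
  assume "g j \<noteq> h j"
  then have "\<forall>i\<in>I. g i \<noteq> h i" using invariant_unique[OF assms(1,3,4)] assms(7) by blast
  then show False using assms unfolding full_def by blast
qed

text \<open>One codeword \<open>x0\<close> dictates the candidate: \<open>\<gamma> j\<close> is the
  change at \<open>j\<close> that compensates adding \<open>a\<close> at \<open>k\<close>. Another
  codeword gives the same value, because a move at \<open>i\<close> and \<open>k\<close> stays in a
  square through \<open>k\<close>, \<open>i\<close>, \<open>j\<close>, and that square has a
  translation with value \<open>a\<close> at \<open>k\<close>.\<close>

lemma ex_invariant_if_squares_full:
  assumes M: "mds I M" and o': "k \<in> I" and card: "card I \<ge> 3"
    and squares: "\<And>T w. T \<subseteq> I \<Longrightarrow> card T = 3 \<Longrightarrow> k \<in> T \<Longrightarrow> full T (restrict_code T w M)"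
  shows "\<exists>\<gamma>. invariant I M \<gamma> \<and> \<gamma> k = a"
proof -
  obtain x0 where x0: "M x0" using mds_ex[OF M o'] by blast
  have "\<exists>b. M (x0(k := x0 k \<oplus> a, j := x0 j \<oplus> b))" if "j \<in> I" for j
  proof -
    obtain v where "M (x0(k := x0 k \<oplus> a, j := v))" using mds_ex[OF M \<open>j \<in> I\<close>] by blast
    moreover have "v = x0 j \<oplus> (x0 j \<oplus> v)" by (simp flip: xor_assoc)
    ultimately show ?thesis by metis
  qed
  then obtain b where b: "\<And>j. j \<in> I \<Longrightarrow> M (x0(k := x0 k \<oplus> a, j := x0 j \<oplus> b j))" by metis
  define \<gamma> where "\<gamma> = b(k := a)"
  \<comment> \<open>The case \<open>i = j\<close> occurs as well; then the square is filled up with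
    an arbitrary coordinate.\<close>
  have three: "\<exists>T. T \<subseteq> I \<and> card T = 3 \<and> {k, i, j} \<subseteq> T" if "i \<in> I" "j \<in> I" for i j
  proof -
    have "card {k, i, j} \<le> 3" using card_length[of "[k, i, j]"] by simp
    then show ?thesis
      using exists_subset_between[of "{k, i, j}" 3 I] that o' card mds_finite[OF M] by auto
  qed
  have sq: "\<exists>\<delta>. invariant T (restrict_code T w M) \<delta> \<and> \<delta> k = a" if "T \<subseteq> I" "card T = 3" "k \<in> T" for T w
    using full_ex[OF mds_restrict_code[OF M that(1)] squares[OF that] that(3)] .
  have from_k: "M (sh \<gamma> k j x)" if j: "j \<in> I" "j \<noteq> k" and x: "M x" for x j
  proof (rule mds_connect[OF M o' x0 x, of "\<lambda>u. M (sh \<gamma> k j u)"])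
    show "M (sh \<gamma> k j x0)" using b[of j] j by (simp add: sh_def \<gamma>_def)
  next
    fix u i a' b'
    assume u: "M u" "M (sh \<gamma> k j u)" and i: "i \<in> I" "i \<noteq> k" and u': "M (u(i := a', k := b'))"
    let ?u = "u(i := a', k := b')"
    obtain T where T: "T \<subseteq> I" "card T = 3" "{k, i, j} \<subseteq> T" using three[OF i(1) j(1)] by blast
    obtain \<delta> where \<delta>: "invariant T (restrict_code T u M) \<delta>" "\<delta> k = a"
      using sq[of T u] T by blast
    have ov: "override_on u u T = u" by (auto simp: override_on_def)
    then have "restrict_code T u M u" using u by (simp add: restrict_code_def)
    then have "restrict_code T u M (sh \<delta> k j u)"
      using invariantD[OF \<delta>(1), of k j u] T j by auto
    then have "M (sh \<delta> k j u)" using T ov by (simp add: restrict_code_def sh_override)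
    then have "\<delta> j = \<gamma> j"
      using u(2) mds_unique[OF M j(1), of "u(k := u k \<oplus> a)" "u j \<oplus> \<delta> j" "u j \<oplus> \<gamma> j"] \<delta>(2)
      by (simp add: sh_def \<gamma>_def)
    moreover have "override_on u ?u T = ?u" using T by (auto simp: override_on_def)
    then have "restrict_code T u M (sh \<delta> k j ?u)"
      using invariantD[OF \<delta>(1), of k j ?u] T j u' by (auto simp: restrict_code_def)
    then have "M (sh \<delta> k j ?u)" using T \<open>override_on u ?u T = ?u\<close> by (simp add: restrict_code_def sh_override)
    ultimately show "M (sh \<gamma> k j ?u)" using \<delta>(2) sh_cong[of \<gamma> k \<delta> j] by (simp add: \<gamma>_def)
  next
    fix u v :: "'a \<Rightarrow> q" assume "\<And>i. i \<in> I \<Longrightarrow> u i = v i" "M (sh \<gamma> k j u)"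
    then show "M (sh \<gamma> k j v)" using mds_agree[OF M, of "sh \<gamma> k j u" "sh \<gamma> k j v"] by (simp add: sh_apply)
  qed
  have "invariant I M \<gamma>"
  proof (rule invariantI)
    fix x i j assume ij: "i \<in> I" "j \<in> I" "i \<noteq> j" and x: "M x"
    consider "i = k" | "j = k" | "i \<noteq> k" "j \<noteq> k" by blast
    then show "M (sh \<gamma> i j x)"
    proof cases
      case 3
      have T: "{k, i, j} \<subseteq> I" "card {k, i, j} = 3" using ij 3 o' by auto
      obtain \<delta> where \<delta>: "invariant {k, i, j} (restrict_code {k, i, j} x M) \<delta>" "\<delta> k = a"
        using sq[OF T] by blast
      have ov: "override_on x x {k, i, j} = x" by (auto simp: override_on_def)
      have *: "M (sh \<delta> l l' x)" if "l \<in> {k, i, j}" "l' \<in> {k, i, j}" "l \<noteq> l'" for l l'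
      proof -
        have "restrict_code {k, i, j} x M (sh \<delta> l l' x)"
          using invariantD[OF \<delta>(1) that, of x] x ov by (simp add: restrict_code_def)
        then show ?thesis using that ov by (simp add: restrict_code_def sh_override)
      qed
      have "\<delta> l = \<gamma> l" if "l \<in> {i, j}" for l
        using *[of k l] from_k[of l x] x that 3 ij \<delta>(2)
          mds_unique[OF M, of l "x(k := x k \<oplus> a)" "x l \<oplus> \<delta> l" "x l \<oplus> \<gamma> l"]
        by (auto simp: sh_def \<gamma>_def)
      then show ?thesis using *[of i j] ij sh_cong[of \<gamma> i \<delta> j x] by simp
    qed (use from_k[of j x] from_k[of i x] ij x sh_swap[of k i \<gamma> x] in auto)
  qed
  then show ?thesis by (intro exI[of _ \<gamma>]) (simp add: \<gamma>_def)
qed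

lemma full_if_squares_full:
  assumes M: "mds I M" and k: "k \<in> I" and card: "card I \<ge> 3"
    and squares: "\<And>T w. T \<subseteq> I \<Longrightarrow> card T = 3 \<Longrightarrow> k \<in> T \<Longrightarrow> full T (restrict_code T w M)"
  shows "full I M"
proof -
  obtain \<alpha> \<beta> where *: "invariant I M \<alpha>" "\<alpha> k = c1" "invariant I M \<beta>" "\<beta> k = c2"
    using ex_invariant_if_squares_full[OF assms] by metis
  then have "\<forall>i\<in>I. \<alpha> i \<noteq> c0 \<and> \<beta> i \<noteq> c0"
    using invariant_nonzero[OF M _ k] by (metis prod.inject)
  moreover have "\<forall>i\<in>I. \<alpha> i \<noteq> \<beta> i"
    using invariant_unique[OF M *(1,3) _ k] * by auto
  ultimately show ?thesis using * unfolding full_def by blast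
qed

lemma subcode_xor_iff:
  assumes g: "invariant J N g" and kj: "k \<in> J" "j \<in> J" "k \<noteq> j"
  shows "subcode k v N x \<longleftrightarrow> subcode k (v \<oplus> g k) N (x(j := x j \<oplus> g j))"
proof -
  have "sh g k j (x(k := v)) = (x(j := x j \<oplus> g j))(k := v \<oplus> g k)"
    "sh g k j ((x(j := x j \<oplus> g j))(k := v \<oplus> g k)) = x(k := v)"
    using kj by (auto simp: sh_def fun_eq_iff)
  then show ?thesis
    using invariantD[OF g kj] unfolding subcode_def by metis
qed

lemma invariant_transfer:
  assumes iff: "\<And>x. N x \<longleftrightarrow> N' (x(j := x j \<oplus> c))" and inv: "invariant K N' \<alpha>"
  shows "invariant K N \<alpha>"
proof (rule invariantI)
  fix x i i' assume i: "i \<in> K" "i' \<in> K" "i \<noteq> i'" and "N x"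
  then have "N' (sh \<alpha> i i' (x(j := x j \<oplus> c)))" using iff inv by (blast intro: invariantD)
  also have "sh \<alpha> i i' (x(j := x j \<oplus> c)) = (sh \<alpha> i i' x)(j := sh \<alpha> i i' x j \<oplus> c)"
    using i by (auto simp: sh_def fun_eq_iff xor_ac)
  finally show "N (sh \<alpha> i i' x)" using iff by blast
qed

text \<open>The translation \<open>g\<close> carries one layer to the other up to a shift at the
  single coordinate \<open>j\<close>, and such a shift commutes with all translations.\<close>

lemma full_subcode_xor:
  assumes "invariant J N g" "k \<in> J" "j \<in> J" "k \<noteq> j" "full K (subcode k (v \<oplus> g k) N)"
  shows "full K (subcode k v N)"
proof -
  have "invariant K (subcode k v N) \<alpha>" if "invariant K (subcode k (v \<oplus> g k) N) \<alpha>" for \<alpha>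
    using subcode_xor_iff[OF assms(1-4)] that by (rule invariant_transfer)
  then show ?thesis using assms(5) unfolding full_def by blast
qed

text \<open>\<open>{v, v \<oplus> g}\<close> is a coset of a subgroup of index 2, and
  \<open>g'\<close> lies outside that subgroup.\<close>

lemma q_coset:
  assumes "g \<noteq> c0" "g' \<noteq> c0" "g' \<noteq> g" "x \<noteq> v" "x \<noteq> v \<oplus> g"
  shows "x \<oplus> g' = v \<or> x \<oplus> g' = v \<oplus> g"
  using assms by (cases x; cases v; cases g; cases g') (auto simp: xor_def)

text \<open>Take a slice of the layer \<open>r m\<close>, given by a letter at a further coordinate,
  that is not full: its nowhere zero translation is unique. The subcode of \<open>M\<close> with
  that letter is semilinear and meets all layers of \<open>m\<close>, so it transports
  \<open>g\<close> to the corresponding slices of every layer. Such slices exist at two coordinates,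
  one outside and one inside \<open>T\<close>, and this is enough to get \<open>g\<close> on whole
  layers.\<close>

lemma layers_common_invariant:
  assumes M: "mds I M" and m: "m \<in> I" and card: "card I \<ge> 5"
    and sub: "\<And>k v. k \<in> I \<Longrightarrow> semilinear (I - {k}) (subcode k v M)"
    and T: "T \<subseteq> I - {m}" "card T = 3" and nf: "\<not> full T (restrict_code T r M)"
  shows "\<exists>g. (\<forall>i\<in>I - {m}. g i \<noteq> c0) \<and> (\<forall>c. invariant (I - {m}) (subcode m c M) g)"
proof -
  define J where "J = I - {m}"
  define L where "L c = subcode m c M" for c
  let ?L = "L (r m)"
  have fI: "finite I" using mds_finite[OF M] .
  have cJ: "card J \<ge> 4" "finite J" using card m fI by (auto simp: J_def)
  have mL: "mds J (L c)" for c unfolding L_def J_def by (rule mds_subcode[OF M])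
  have TJ: "T \<subseteq> J" using T J_def by simp
  have fT: "finite T" using TJ cJ finite_subset by blast
  obtain g where g: "\<And>i. i \<in> J \<Longrightarrow> g i \<noteq> c0" "invariant J ?L g"
    using sub[OF m, of "r m"] unfolding semilinear_def L_def J_def by blast
  define V where "V k v \<longleftrightarrow> \<not> full (J - {k}) (subcode k v ?L)" for k v
  have third: "\<exists>p. p \<in> J \<and> p \<noteq> i \<and> p \<noteq> j" for i j
  proof -
    have "\<not> J \<subseteq> {i, j}"
    proof
      assume "J \<subseteq> {i, j}"
      then have "card J \<le> card {i, j}" by (intro card_mono) auto
      also have "card {i, j} \<le> 2" by (cases "i = j") auto
      finally show False using cJ by simp
    qed
    then show ?thesis by auto
  qed
  have rT: "restrict_code T r (subcode k (r k) ?L) = restrict_code T r M" if "k \<notin> T" for k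
    using that T unfolding L_def by (subst restrict_subcode; auto)+
  have V_out: "V k (r k)" if k: "k \<in> J" "k \<notin> T" for k
    using full_restrict_code[of "J - {k}" "subcode k (r k) ?L" T r] rT[OF k(2)] nf k TJ unfolding V_def by auto
  have "T \<noteq> J" using cJ T(2) by auto
  then obtain k where k: "k \<in> J" "k \<notin> T"
    using TJ \<open>T \<noteq> J\<close> by blast
  \<comment> \<open>Otherwise every square through \<open>k\<close> in \<open>insert k T\<close>
    would be full, since it omits an element of \<open>T\<close>; then the code on
    \<open>insert k T\<close> would be full, and so would the square on \<open>T\<close>.\<close>
  have "\<exists>t\<in>T. \<exists>u. V t u"
  proof (rule ccontr)
    assume "\<not> ?thesis"
    then have fl: "full (J - {t}) (subcode t u ?L)" if "t \<in> T" for t u using that V_def by blast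
    define U K where "U = insert k T" and "K = restrict_code U r ?L"
    have UJ: "U \<subseteq> J" using k TJ by (simp add: U_def)
    have cU: "card U = 4" using k T(2) fT by (simp add: U_def)
    have "full U K"
    proof (rule full_if_squares_full)
      show "mds U K" unfolding K_def by (rule mds_restrict_code[OF mL UJ])
      show "k \<in> U" by (simp add: U_def)
      show "card U \<ge> 3" using cU by simp
      fix T' w assume T': "T' \<subseteq> U" "card T' = 3" "k \<in> T'"
      have "T' \<noteq> U" using T' cU by auto
      then obtain t where t: "t \<in> U" "t \<notin> T'" using T' by auto
      then have tT: "t \<in> T" using T'(3) by (auto simp: U_def)
      have fU: "finite U" using UJ cJ finite_subset by blast
      have "T' \<subseteq> U - {t}" using T' t by auto
      moreover have "card (U - {t}) = 3" using cU t fU by simp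
      ultimately have T'_eq: "T' = U - {t}" using T' fU by (metis card_subset_eq finite_Diff)
      have "restrict_code T' w K = restrict_code T' r (subcode t (w t) ?L)"
        unfolding K_def restrict_code_def subcode_def
        by (rule ext, rule arg_cong[of _ _ ?L]) (use t T'_eq in \<open>auto simp: override_on_def fun_eq_iff\<close>)
      then show "full T' (restrict_code T' w K)"
        using full_restrict_code[OF fl[OF tT, of "w t"], of T' r] T'_eq UJ by auto
    qed
    then have "full T (restrict_code T r K)" by (rule full_restrict_code) (simp add: U_def subset_insertI)
    moreover have "restrict_code T r K = restrict_code T r M"
      unfolding K_def L_def restrict_code_def subcode_def
      by (rule ext, rule arg_cong[of _ _ M]) (use T in \<open>auto simp: override_on_def fun_eq_iff U_def\<close>)
    ultimately show False using nf by simp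
  qed
  then obtain t u where t: "t \<in> T" "V t u" by blast
  have tJ: "t \<in> J" "t \<noteq> k" using t TJ k by auto
  have V_xor: "V i (v \<oplus> g i)" if "V i v" "i \<in> J" for i v
  proof -
    obtain j where "j \<in> J" "i \<noteq> j" using third[of i i] by blast
    then show ?thesis using full_subcode_xor[OF g(2) that(2), of j "J - {i}" v] that(1) unfolding V_def by blast
  qed
  \<comment> \<open>\<open>n\<close> works in the slices of all layers at once, and in the layer
    \<open>r m\<close> uniqueness identifies it with \<open>g\<close>.\<close>
  have V_inv: "invariant (J - {i}) (subcode i v (L c)) g" if v: "V i v" "i \<in> J" for i v c
  proof -
    have i: "i \<in> I" "i \<noteq> m" using v J_def by auto
    obtain n where n: "\<And>j. j \<in> I - {i} \<Longrightarrow> n j \<noteq> c0" "invariant (I - {i}) (subcode i v M) n"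
      using sub[OF i(1), of v] unfolding semilinear_def by blast
    have n': "invariant (J - {i}) (subcode i v (L c)) n" for c
      using invariant_subcode[OF n(2), of m c] subcode_commute[OF i(2), of v c M]
      unfolding L_def J_def by (simp add: Diff_insert2[symmetric] insert_commute)
    have "n j = g j" if "j \<in> J - {i}" for j
    proof (rule not_full_unique[OF mds_subcode[OF mL] _ n' invariant_subcode[OF g(2)] _ _ that])
      show "\<not> full (J - {i}) (subcode i v ?L)" using v(1) V_def by simp
    qed (use n(1) g(1) J_def in auto)
    then show ?thesis using invariant_cong[OF n'] by blast
  qed
  have "invariant J (L c) g" for c
  proof -
    obtain g' where g': "\<And>i. i \<in> J \<Longrightarrow> g' i \<noteq> c0" "invariant J (L c) g'"
      using sub[OF m, of c] unfolding semilinear_def L_def J_def by blast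
    \<comment> \<open>The translation \<open>g'\<close> that the layer has by itself coincides with
      \<open>g\<close> as soon as it does so at one of two coordinates satisfying
      \<open>V\<close>.\<close>
    have agree: "g' i = g i" if ik: "V a va" "V b vb" "a \<in> J" "b \<in> J" "a \<noteq> b" "g' a = g a" "i \<in> J" for a b va vb i
    proof -
      have 1: "g' j = g j" if "j \<in> J - {b}" for j
        using invariant_unique[OF mds_subcode[OF mL] invariant_subcode[OF g'(2)] V_inv[OF ik(2,4)], of a j] that ik by auto
      obtain p where p: "p \<in> J" "p \<noteq> a" "p \<noteq> b" using third by blast
      have "g' j = g j" if "j \<in> J - {a}" for j
        using invariant_unique[OF mds_subcode[OF mL] invariant_subcode[OF g'(2)] V_inv[OF ik(1,3)], of p j] that 1[of p] p by auto
      then show ?thesis using 1[of i] ik by (cases "i = b") auto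
    qed
    note Vk = V_out[OF k]
    show ?thesis
    proof (cases "g' k = g k \<or> g' t = g t")
      case True
      then have "g' i = g i" if "i \<in> J" for i
        using agree[OF Vk t(2) k(1) tJ(1) tJ(2)[symmetric] _ that] agree[OF t(2) Vk tJ(1) k(1) tJ(2) _ that] by blast
      then show ?thesis using invariant_cong[OF g'(2)] by blast
    next
      case False
      have good: "L c (sh g i j x)" if x: "L c x" "V k (x k)" "V t (x t)" and ij: "i \<in> J" "j \<in> J" "i \<noteq> j" for x i j
      proof -
        have away: "L c (sh g i j y)" if "L c y" "V l (y l)" "l \<in> J" "l \<noteq> i" "l \<noteq> j" "i \<in> J" "j \<in> J" "i \<noteq> j" for y l i j
        proof -
          have "subcode l (y l) (L c) (sh g i j y)"
            by (rule invariantD[OF V_inv[OF that(2,3)]]) (use that in \<open>auto simp: subcode_def\<close>)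
          then show ?thesis using that by (simp add: subcode_def sh_upd)
        qed
        \<comment> \<open>The pair \<open>k\<close>, \<open>t\<close> leaves neither slice
          untouched, so it is composed of two shifts through a third coordinate. The first keeps the
          letter at \<open>k\<close> in \<open>V\<close> by \<open>V_xor\<close>.\<close>
        have ends: "L c (sh g k t x)"
        proof -
          obtain p where p: "p \<in> J" "p \<noteq> k" "p \<noteq> t" using third by blast
          have "L c (sh g k p x)" using away[OF x(1,3) tJ(1), of k p] p tJ k by auto
          moreover have "V k (sh g k p x k)" using V_xor[OF x(2) k(1)] by (simp add: sh_apply)
          ultimately have "L c (sh g p t (sh g k p x))" using away[of "sh g k p x" k p t] p tJ k by auto
          then show ?thesis using p tJ sh_compose[of k p t g x] by auto
        qed
        consider "k \<noteq> i" "k \<noteq> j" | "t \<noteq> i" "t \<noteq> j" | "i = k" "j = t" | "i = t" "j = k" using ij tJ(2) by blast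
        then show ?thesis
          by cases (use away[OF x(1,2) k(1), of i j] away[OF x(1,3) tJ(1), of i j] ij ends sh_swap[OF tJ(2), of g x] in auto)
      qed
      have V_g': "V i (y \<oplus> g' i)" if i: "V i v" "i \<in> J" "g' i \<noteq> g i" "\<not> V i y" for i v y
        using q_coset[OF g(1)[OF i(2)] g'(1)[OF i(2)] i(3), of y v] V_xor[OF i(1,2)] i by metis
      have Vk': "V k (y \<oplus> g' k)" if "\<not> V k y" for y using V_g'[OF Vk k(1)] False that by blast
      have Vt': "V t (y \<oplus> g' t)" if "\<not> V t y" for y using V_g'[OF t(2) tJ(1)] False that by blast
      show ?thesis
      proof (rule invariantI)
        fix x i j assume ij: "i \<in> J" "j \<in> J" "i \<noteq> j" and x: "L c x"
        \<comment> \<open>Conjugation by \<open>g'\<close>: since \<open>g'\<close> differs from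
          \<open>g\<close> at \<open>k\<close> and \<open>t\<close>, it moves every letter outside
          \<open>V\<close> there into \<open>V\<close>. After that the shift by \<open>g\<close> is
          known to be allowed, and \<open>g'\<close> leads back.\<close>
        have via: "L c (sh g i j x)"
          if "a \<in> J" "b \<in> J" "a \<noteq> b" "V k (sh g' a b x k)" "V t (sh g' a b x t)" for a b
        proof -
          have "L c (sh g i j (sh g' a b x))"
            using good[OF invariantD[OF g'(2) that(1-3) x] that(4,5) ij] .
          then have "L c (sh g' a b (sh g i j (sh g' a b x)))"
            using invariantD[OF g'(2) that(1-3)] by blast
          then show ?thesis using ij that(3) by (simp add: sh_commute[of a b i j])
        qed
        obtain p where p: "p \<in> J" "p \<noteq> k" "p \<noteq> t" using third by blast
        show "L c (sh g i j x)"
        proof (cases "V k (x k)"; cases "V t (x t)")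
          assume "V k (x k)" "V t (x t)"
          then show ?thesis using good[OF x _ _ ij] by blast
        next
          assume "V k (x k)" "\<not> V t (x t)"
          then show ?thesis using via[of t p] p tJ Vt' by (simp add: sh_apply)
        next
          assume "\<not> V k (x k)" "V t (x t)"
          then show ?thesis using via[of k p] p tJ k Vk' by (simp add: sh_apply)
        next
          assume "\<not> V k (x k)" "\<not> V t (x t)"
          then show ?thesis using via[of k t] tJ k Vk' Vt' by (simp add: sh_apply)
        qed
      qed
    qed
  qed
  then show ?thesis using g(1) unfolding J_def L_def by blast
qed

text \<open>A square that is not full misses two coordinates \<open>m1\<close> and
  \<open>m2\<close>. The common translations of their layers agree on the square by uniqueness,
  hence at all coordinates they share. Glued together they handle every pair that avoids
  \<open>m1\<close> or \<open>m2\<close>; the pair \<open>m1\<close>, \<open>m2\<close> itself goes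
  through a point of the square.\<close>

theorem semilinear_if_quaternary_semilinear:
  assumes "mds I M" "card I \<ge> 4"
    and "\<And>T w. T \<subseteq> I \<Longrightarrow> card T = 4 \<Longrightarrow> semilinear T (restrict_code T w M)"
  shows "semilinear I M"
  using assms
proof (induction "card I" arbitrary: I M rule: less_induct)
  case less
  note M = less.prems(1)
  have fI: "finite I" using mds_finite[OF M] .
  show ?case
  proof (cases "card I = 4")
    case True
    have "restrict_code I w M = M" for w
      unfolding restrict_code_def by (intro ext mds_agree[OF M]) simp
    then show ?thesis using less.prems(3)[of I] True by simp
  next
    case False
    then have card: "card I \<ge> 5" using less.prems by simp
    have sub: "semilinear (I - {k}) (subcode k v M)" if "k \<in> I" for k v
    proof (rule less.hyps[OF _ mds_subcode[OF M]])
      show "card (I - {k}) < card I" "card (I - {k}) \<ge> 4" using that fI card by auto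
      fix T w assume "T \<subseteq> I - {k}" "card T = 4"
      then show "semilinear T (restrict_code T w (subcode k v M))"
        using less.prems(3)[of T "w(k := v)"] restrict_subcode[of k T w v M] by (simp add: subset_Diff_insert)
    qed
    show ?thesis
    proof (cases "\<exists>T w. T \<subseteq> I \<and> card T = 3 \<and> \<not> full T (restrict_code T w M)")
      case False
      obtain k where "k \<in> I" using card by fastforce
      then have "full I M" using full_if_squares_full[OF M, of k] card False by auto
      then show ?thesis unfolding full_def semilinear_def by blast
    next
      case True
      then obtain T r where T: "T \<subseteq> I" "card T = 3" "\<not> full T (restrict_code T r M)" by blast
      have fT: "finite T" using T fI finite_subset by blast
      have "card (I - T) \<ge> 2" using T card fT by (simp add: card_Diff_subset)
      then obtain A where "A \<subseteq> I - T" "card A = 2" by (meson obtain_subset_with_card_n)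
      then obtain m1 m2 where m: "m1 \<in> I - T" "m2 \<in> I - T" "m1 \<noteq> m2" by (auto simp: card_2_iff)
      obtain g1 where g1: "\<And>i. i \<in> I - {m1} \<Longrightarrow> g1 i \<noteq> c0" "\<And>c. invariant (I - {m1}) (subcode m1 c M) g1"
        using layers_common_invariant[OF M _ card sub _ T(2,3), of m1] m T(1) by blast
      obtain g2 where g2: "\<And>i. i \<in> I - {m2} \<Longrightarrow> g2 i \<noteq> c0" "\<And>c. invariant (I - {m2}) (subcode m2 c M) g2"
        using layers_common_invariant[OF M _ card sub _ T(2,3), of m2] m T(1) by blast
      have restr: "invariant T (restrict_code T r M) g" if "\<And>c. invariant (I - {m}) (subcode m c M) g" "m \<notin> T" for g m
        using invariant_restrict_code[OF that(1)[of "r m"], of T r] that(2) T(1) restrict_subcode[of m T r "r m" M] by auto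
      have eqT: "g1 i = g2 i" if "i \<in> T" for i
        by (rule not_full_unique[OF mds_restrict_code[OF M T(1)] T(3) restr[OF g1(2)] restr[OF g2(2)]])
          (use m g1(1) g2(1) T(1) that in auto)
      obtain p where p: "p \<in> T" using T(2) by fastforce
      have eq: "g1 i = g2 i" if "i \<in> I" "i \<noteq> m1" "i \<noteq> m2" for i
      proof (rule invariant_unique[where \<alpha> = g1 and \<beta> = g2 and i = p])
        show "mds (I - {m1} - {m2}) (subcode m2 c0 (subcode m1 c0 M))"
          by (intro mds_subcode M)
        show "invariant (I - {m1} - {m2}) (subcode m2 c0 (subcode m1 c0 M)) g1"
          by (intro invariant_subcode g1)
        show "invariant (I - {m1} - {m2}) (subcode m2 c0 (subcode m1 c0 M)) g2"
          using invariant_subcode[OF g2(2), of m1 c0 c0] m(3) subcode_commute[of m1 m2 c0 c0 M]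
          by (simp add: Diff_insert2[symmetric] insert_commute)
        show "p \<in> I - {m1} - {m2}" "i \<in> I - {m1} - {m2}" using p that m T(1) by auto
      qed (use eqT p in auto)
      define \<alpha> where "\<alpha> = g1(m1 := g2 m1)"
      have "\<alpha> i \<noteq> c0" if "i \<in> I" for i using that g1(1) g2(1) m by (auto simp: \<alpha>_def)
      moreover have "invariant I M \<alpha>"
      proof (rule invariantI)
        fix x i j assume ij: "i \<in> I" "j \<in> I" "i \<noteq> j" and x: "M x"
        have 1: "M (sh \<alpha> i j y)" if "i \<in> I" "j \<in> I" "i \<noteq> j" "m1 \<noteq> i" "m1 \<noteq> j" "M y" for i j y
          using invariantD[OF g1(2), of i j "y m1" y] that sh_cong[of \<alpha> i g1 j y]
          by (auto simp: subcode_def sh_upd \<alpha>_def)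
        have 2: "M (sh \<alpha> i j y)" if "i \<in> I" "j \<in> I" "i \<noteq> j" "m2 \<noteq> i" "m2 \<noteq> j" "M y" for i j y
          using invariantD[OF g2(2), of i j "y m2" y] that sh_cong[of \<alpha> i g2 j y] eq[of i] eq[of j]
          by (auto simp: subcode_def sh_upd \<alpha>_def)
        have pI: "p \<in> I" "p \<noteq> m1" "p \<noteq> m2" using p m T(1) by auto
        have 3: "M (sh \<alpha> m1 m2 x)"
          using 1[of p m2 "sh \<alpha> m1 p x"] 2[of m1 p x] x pI m sh_compose[of m1 p m2 \<alpha> x] by auto
        consider "m1 \<noteq> i" "m1 \<noteq> j" | "m2 \<noteq> i" "m2 \<noteq> j" | "i = m1" "j = m2" | "i = m2" "j = m1" using ij m(3) by blast
        then show "M (sh \<alpha> i j x)"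
          by cases (use 1[of i j x] 2[of i j x] ij x 3 sh_swap[OF m(3), of \<alpha> x] in auto)
      qed
      ultimately show ?thesis unfolding semilinear_def by blast
    qed
  qed
qed

section \<open>Quaternary codes and clauses over their cells\<close>

text \<open>\<open>digit\<close>, \<open>twist\<close> and \<open>add4\<close> refer to the numbering \<open>c0, c1, c2, c3\<close> of the alphabet; the transposition
  \<open>\<pi>\<close> is \<open>twist\<close>, which exchanges 0 and 1. The cells of a quaternary code are numbered in base 4.\<close>

definition code4 :: "(q \<Rightarrow> q \<Rightarrow> q \<Rightarrow> q \<Rightarrow> bool) \<Rightarrow> bool" where
  "code4 R \<longleftrightarrow> (\<forall>b c d. \<exists>!a. R a b c d) \<and> (\<forall>a c d. \<exists>!b. R a b c d) \<and>
     (\<forall>a b d. \<exists>!c. R a b c d) \<and> (\<forall>a b c. \<exists>!d. R a b c d)"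

lemma ex1_unique: "\<exists>!x. P x \<Longrightarrow> P a \<Longrightarrow> P b \<Longrightarrow> a = b"
  by blast

lemma code4_ex1:
  assumes "code4 R"
  shows "\<exists>!a. R a b c d" "\<exists>!b. R a b c d" "\<exists>!c. R a b c d" "\<exists>!d. R a b c d"
  by (rule assms[unfolded code4_def, THEN conjunct1, THEN spec, THEN spec, THEN spec])
    (rule assms[unfolded code4_def, THEN conjunct2, THEN conjunct1, THEN spec, THEN spec, THEN spec]
      assms[unfolded code4_def, THEN conjunct2, THEN conjunct2, THEN conjunct1, THEN spec, THEN spec, THEN spec]
      assms[unfolded code4_def, THEN conjunct2, THEN conjunct2, THEN conjunct2, THEN spec, THEN spec, THEN spec])+

lemma code4_unique:
  assumes R: "code4 R"
  shows "R a b c d \<Longrightarrow> R a' b c d \<Longrightarrow> a = a'" "R a b c d \<Longrightarrow> R a b' c d \<Longrightarrow> b = b'"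
    "R a b c d \<Longrightarrow> R a b c' d \<Longrightarrow> c = c'" "R a b c d \<Longrightarrow> R a b c d' \<Longrightarrow> d = d'"
  by (rule ex1_unique[OF code4_ex1(1)[OF R]], assumption+, rule ex1_unique[OF code4_ex1(2)[OF R]], assumption+,
      rule ex1_unique[OF code4_ex1(3)[OF R]], assumption+, rule ex1_unique[OF code4_ex1(4)[OF R]], assumption+)

definition add4 :: "q \<Rightarrow> q \<Rightarrow> q" where
  "add4 a b = (fst a \<noteq> fst b, (snd a \<noteq> snd b) \<noteq> (fst a \<and> fst b))"

definition twist :: "q \<Rightarrow> q" where
  "twist v = (snd v \<noteq> (\<not> fst v), snd v)"

definition twisted :: "q \<Rightarrow> q \<Rightarrow> q \<Rightarrow> q \<Rightarrow> bool" where
  "twisted a b c d \<longleftrightarrow> add4 c d = twist (add4 a b)"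

definition digit :: "nat \<Rightarrow> q" where
  "digit n = (odd n, odd (n div 2))"

text \<open>Only the last four base-4 digits of the index matter, so the offset \<open>256 r\<close>
  of a code number \<open>r\<close> leaves the cell unchanged.\<close>

definition cell :: "(q \<Rightarrow> q \<Rightarrow> q \<Rightarrow> q \<Rightarrow> bool) \<Rightarrow> nat \<Rightarrow> bool" where
  "cell R n = R (digit (n div 64)) (digit (n div 16)) (digit (n div 4)) (digit n)"

text \<open>Different cells of the same code on a common line, that is, with exactly one differing
  digit.\<close>

definition line_ok :: "nat \<Rightarrow> nat \<Rightarrow> bool" where
  "line_ok i j \<longleftrightarrow> i div 256 = j div 256 \<and> i \<noteq> j \<and>
     (i div 4 = j div 4 \<or> i mod 4 = j mod 4 \<and>
      (i div 16 = j div 16 \<or> i div 4 mod 4 = j div 4 mod 4 \<and>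
       (i div 64 = j div 64 \<or> i div 16 mod 4 = j div 16 mod 4)))"

text \<open>A complete line of a code, in increasing order.\<close>

definition pos4_ok :: "nat \<times> nat \<times> nat \<times> nat \<Rightarrow> bool" where
  "pos4_ok = (\<lambda>(i, j, k, l). i div 256 = j div 256 \<and> i div 256 = k div 256 \<and> i div 256 = l div 256 \<and>
     (i mod 4 = 0 \<and> j = i + 1 \<and> k = i + 2 \<and> l = i + 3 \<or>
      i div 4 mod 4 = 0 \<and> j = i + 4 \<and> k = i + 8 \<and> l = i + 12 \<or>
      i div 16 mod 4 = 0 \<and> j = i + 16 \<and> k = i + 32 \<and> l = i + 48 \<or>
      i div 64 mod 4 = 0 \<and> j = i + 64 \<and> k = i + 128 \<and> l = i + 192))"

lemma digit_eq_iff: "digit m = digit n \<longleftrightarrow> m mod 4 = n mod 4"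
proof -
  have 4: "n mod 4 = 2 * (n div 2 mod 2) + n mod 2" for n :: nat
    using mod_mult2_eq[of n 2 2] by simp
  have "n div 2 mod 2 = of_bool (odd (n div 2))" "n mod 2 = of_bool (odd n)" for n :: nat
    by (simp_all add: mod2_eq_if)
  then show ?thesis unfolding digit_def 4[of m] 4[of n] by auto
qed

text \<open>The four letters add up to zero, so the missing one is the sum of the other
  three.\<close>

lemma xor3_distinct: "distinct [a, b, c] \<Longrightarrow> distinct [a \<oplus> b \<oplus> c, a, b, c]"
  by (cases a; cases b; cases c) (auto simp: xor_def)

lemma code4_line:
  assumes R: "code4 R" and "line_ok i j"
  shows "\<not> cell R i \<or> \<not> cell R j"
proof (rule ccontr)
  assume "\<not> ?thesis"
  then have c: "R (digit (i div 64)) (digit (i div 16)) (digit (i div 4)) (digit i)"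
    "R (digit (j div 64)) (digit (j div 16)) (digit (j div 4)) (digit j)" by (simp_all add: cell_def)
  note u = code4_unique[OF R]
  have d16: "n div 16 = n div 4 div 4" and d64: "n div 64 = n div 16 div 4" and d256: "n div 256 = n div 64 div 4" for n :: nat
    by (simp_all flip: div_mult2_eq)
  have eq: "m div 4 = n div 4 \<Longrightarrow> m mod 4 = n mod 4 \<Longrightarrow> m = n" for m n :: nat
    by (metis div_mult_mod_eq)
  consider "i div 4 = j div 4" | "i mod 4 = j mod 4" "i div 16 = j div 16"
    | "i mod 4 = j mod 4" "i div 4 mod 4 = j div 4 mod 4" "i div 64 = j div 64"
    | "i mod 4 = j mod 4" "i div 4 mod 4 = j div 4 mod 4" "i div 16 mod 4 = j div 16 mod 4"
    using assms(2) unfolding line_ok_def by blast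
  then have "i = j"
  proof cases
    case 1
    then have "i div 16 = j div 16" "i div 64 = j div 64" by (simp_all add: d16 d64)
    have "digit i = digit j" by (rule u(4)[OF c(1)]) (use c(2) 1 \<open>i div 16 = j div 16\<close> \<open>i div 64 = j div 64\<close> in simp)
    then show ?thesis using 1 eq digit_eq_iff by blast
  next
    case 2
    then have *: "i div 64 = j div 64" "digit i = digit j" by (simp_all add: d64 digit_eq_iff)
    have "digit (i div 4) = digit (j div 4)" by (rule u(3)[OF c(1)]) (use c(2) 2(2) * in simp)
    then have "i div 4 = j div 4" using 2(2) by - (rule eq, simp_all add: d16 digit_eq_iff)
    then show ?thesis using 2(1) by (rule eq)
  next
    case 3
    then have *: "digit (i div 4) = digit (j div 4)" "digit i = digit j" by (simp_all add: digit_eq_iff)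
    have "digit (i div 16) = digit (j div 16)" by (rule u(2)[OF c(1)]) (use c(2) 3(3) * in simp)
    then have "i div 16 = j div 16" using 3(3) by - (rule eq, simp_all add: d64 digit_eq_iff)
    then have "i div 4 = j div 4" using 3(2) by - (rule eq, simp_all add: d16)
    then show ?thesis using 3(1) by (rule eq)
  next
    case 4
    then have *: "digit (i div 16) = digit (j div 16)" "digit (i div 4) = digit (j div 4)" "digit i = digit j" by (simp_all add: digit_eq_iff)
    have "digit (i div 64) = digit (j div 64)" by (rule u(1)[OF c(1)]) (use c(2) * in simp)
    moreover have "i div 256 = j div 256" using assms(2) by (simp add: line_ok_def)
    ultimately have "i div 64 = j div 64" by - (rule eq, simp_all add: digit_eq_iff d256)
    then have "i div 16 = j div 16" using 4(3) by - (rule eq, simp_all add: d64)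
    then have "i div 4 = j div 4" using 4(2) by - (rule eq, simp_all add: d16)
    then show ?thesis using 4(1) by (rule eq)
  qed
  then show False using assms(2) by (simp add: line_ok_def)
qed

lemma code4_pos:
  assumes R: "code4 R" and "pos4_ok (i, j, k, l)"
  shows "cell R i \<or> cell R j \<or> cell R k \<or> cell R l"
proof -
  have ex: "\<exists>a. R a b c d" "\<exists>b. R a b c d" "\<exists>c. R a b c d" "\<exists>d. R a b c d" for a b c d
    using R unfolding code4_def by (meson ex1_implies_ex)+
  have four: "\<exists>v. P v \<Longrightarrow> e mod 4 = 0 \<Longrightarrow> P (digit e) \<or> P (digit (e + 1)) \<or> P (digit (e + 2)) \<or> P (digit (e + 3))" for P e
  proof -
    assume "\<exists>v. P v" and e: "e mod 4 = 0"
    then obtain v where "P v" by blast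
    have "digit n = digit m" if "n mod 4 = m mod 4" for n m using that by (simp add: digit_eq_iff)
    then have "digit e = digit 0" "digit (e + 1) = digit 1" "digit (e + 2) = digit 2" "digit (e + 3) = digit 3"
      using e by (metis mod_0, metis mod_add_left_eq add_0, metis mod_add_left_eq add_0, metis mod_add_left_eq add_0)
    then have "digit e = (False, False)" "digit (e + 1) = (True, False)" "digit (e + 2) = (False, True)" "digit (e + 3) = (True, True)"
      by (simp_all add: digit_def)
    then show ?thesis using \<open>P v\<close> by (metis (full_types) surj_pair)
  qed
  have d16: "n div 16 = n div 4 div 4" and d64: "n div 64 = n div 16 div 4" for n :: nat
    by (simp_all flip: div_mult2_eq)
  have block: "(n * m + t) div n = m" if "t < n" for t n m :: nat using that by simp
  have split: "n = m * (n div m) + n mod m" for n m :: nat by simp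
  have digit_add: "digit (n + 4 * m) = digit n" for n m by (simp add: digit_eq_iff)
  from assms(2)[unfolded pos4_ok_def prod.case, THEN conjunct2, THEN conjunct2, THEN conjunct2] show ?thesis
  proof (elim disjE conjE)
    assume 1: "i mod 4 = 0" "j = i + 1" "k = i + 2" "l = i + 3"
    have "(i + t) div 4 = i div 4" if "t < 4" for t using block[of t 4 "i div 4"] split[of i 4] 1 that by simp
    then have a: "(i + t) div 4 = i div 4" "(i + t) div 16 = i div 16" "(i + t) div 64 = i div 64" if "t < 4" for t
      using that by (simp_all add: d16 d64)
    have cl: "cell R (i + t) = R (digit (i div 64)) (digit (i div 16)) (digit (i div 4)) (digit (i + t))" if "t < 4" for t
      by (simp only: cell_def a[OF that])
    have t: "(1 :: nat) < 4" "(2 :: nat) < 4" "(3 :: nat) < 4" by simp_all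
    show ?thesis
      unfolding 1(2-4) cl[OF t(1)] cl[OF t(2)] cl[OF t(3)] cell_def[of R i]
      by (rule four[OF ex(4) 1(1)])
  next
    assume 2: "i div 4 mod 4 = 0" "j = i + 4" "k = i + 8" "l = i + 12"
    have r: "i = 16 * (i div 16) + i mod 4" "i mod 4 < 4" using 2(1) split[of i 4] split[of "i div 4" 4] d16[of i] mod_less_divisor[of 4 i] by linarith+
    have "(i + 4 * t) div 16 = i div 16" if "t < 4" for t
          proof -
      have "i + 4 * t = 16 * (i div 16) + (4 * t + i mod 4)" "4 * t + i mod 4 < 16" using r that by linarith+
      then show ?thesis using block by metis
    qed
    then have "(i + 4 * t) div 16 = i div 16" "(i + 4 * t) div 64 = i div 64" "(i + 4 * t) div 4 = i div 4 + t" if "t < 4" for t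
      using that by (simp_all add: d64)
    from this[of 1] this[of 2] this[of 3] show ?thesis
      using 2 four[OF ex(3), of "i div 4" "digit (i div 64)" "digit (i div 16)" "digit i"]
        digit_add[of i 1] digit_add[of i 2] digit_add[of i 3] by (simp add: cell_def)
  next
    assume 3: "i div 16 mod 4 = 0" "j = i + 16" "k = i + 32" "l = i + 48"
    have r: "i = 64 * (i div 64) + i mod 16" "i mod 16 < 16" using 3(1) split[of i 16] split[of "i div 16" 4] d64[of i] mod_less_divisor[of 16 i] by linarith+
    have "(i + 16 * t) div 64 = i div 64" if "t < 4" for t
    proof -
      have "i + 16 * t = 64 * (i div 64) + (16 * t + i mod 16)" "16 * t + i mod 16 < 64" using r that by linarith+
      then show ?thesis using block by metis
    qed
    moreover have "(i + 16 * t) div 4 = i div 4 + 4 * t" for t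
      using div_mult_self2[of 4 i "4 * t"] by simp
    ultimately have "(i + 16 * t) div 64 = i div 64" "(i + 16 * t) div 16 = i div 16 + t" "(i + 16 * t) div 4 = i div 4 + 4 * t" if "t < 4" for t
      using that by simp_all
    from this[of 1] this[of 2] this[of 3] show ?thesis
      using 3 four[OF ex(2), of "i div 16" "digit (i div 64)" "digit (i div 4)" "digit i"]
        digit_add[of i 4] digit_add[of i 8] digit_add[of i 12] digit_add[of "i div 4" 1] digit_add[of "i div 4" 2] digit_add[of "i div 4" 3]
      by (simp add: cell_def)
  next
    assume 4: "i div 64 mod 4 = 0" "j = i + 64" "k = i + 128" "l = i + 192"
    have e: "i + 64 * t = i + 4 * (16 * t)" "i + 64 * t = i + 16 * (4 * t)" for t by simp_all
    have a1: "(i + 64 * t) div 64 = i div 64 + t" for t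
      by (rule trans[OF div_mult_self2 add.commute]) simp
    have a2: "(i + 64 * t) div 16 = i div 16 + 4 * t" for t
      unfolding e(2) by (rule trans[OF div_mult_self2 add.commute]) simp
    have a3: "(i + 64 * t) div 4 = i div 4 + 4 * (4 * t)" for t
    proof -
      have "(i + 4 * (16 * t)) div 4 = i div 4 + 16 * t" by (rule trans[OF div_mult_self2 add.commute]) simp
      then show ?thesis unfolding e(1) by simp
    qed
    have d: "digit (i + 64 * t) = digit i" for t
      unfolding e(1) by (rule digit_add)
    have "cell R (i + 64 * t) = R (digit (i div 64 + t)) (digit (i div 16)) (digit (i div 4)) (digit i)" for t
      unfolding cell_def a1 a2 a3 d digit_add ..
    from this[of 1] this[of 2] this[of 3]
    have *: "cell R (i + 64) = R (digit (i div 64 + 1)) (digit (i div 16)) (digit (i div 4)) (digit i)"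
      "cell R (i + 128) = R (digit (i div 64 + 2)) (digit (i div 16)) (digit (i div 4)) (digit i)"
      "cell R (i + 192) = R (digit (i div 64 + 3)) (digit (i div 16)) (digit (i div 4)) (digit i)"
      by (simp_all only: mult_1_right mult_numeral_1_right arith_simps)
    show ?thesis unfolding 4(2-4) * cell_def[of R i] by (rule four[OF ex(1) 4(1)])
  qed
qed

section \<open>Squares\<close>

lemma q_exhaust: "(v = c0 \<Longrightarrow> P) \<Longrightarrow> (v = c1 \<Longrightarrow> P) \<Longrightarrow> (v = c2 \<Longrightarrow> P) \<Longrightarrow> (v = c3 \<Longrightarrow> P) \<Longrightarrow> P"
  by (cases v) auto

text \<open>The two pairs are the two cosets of \<open>{c0, g}\<close>.\<close>

lemma fourth_xor: "distinct [v, v \<oplus> g, w, w'] \<Longrightarrow> w' = w \<oplus> g"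
  by (rule q_exhaust[of v]; rule q_exhaust[of g]; rule q_exhaust[of w]; rule q_exhaust[of w']; simp add: xor_def)

text \<open>\<open>p\<close>, \<open>s\<close> and the identity never agree anywhere. An even
  derangement of four letters is a double transposition, hence a translation; if \<open>p\<close>
  and \<open>s\<close> are both odd, then \<open>s\<close> after the inverse of \<open>p\<close> is
  an even derangement.\<close>

lemma three_rows:
  fixes p s :: "q \<Rightarrow> q"
  assumes "inj p" "inj s" "\<And>v. p v \<noteq> v" "\<And>v. s v \<noteq> v" "\<And>v. p v \<noteq> s v"
  shows "\<exists>\<gamma>. (\<forall>v. p v = v \<oplus> \<gamma>) \<or> (\<forall>v. s v = v \<oplus> \<gamma>) \<or> (\<forall>v. s v = p v \<oplus> \<gamma>)"
proof -
  \<comment> \<open>The odd derangements, that is the six 4-cycles, as tables of values.\<close>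
  let ?cyc = "[(c1, c2, c3, c0), (c1, c3, c0, c2), (c2, c3, c1, c0), (c2, c0, c3, c1), (c3, c2, c0, c1), (c3, c0, c1, c2)]"
  let ?row = "\<lambda>t :: q \<Rightarrow> q. (t c0, t c1, t c2, t c3)"
  have all: "(\<forall>v. P v) \<longleftrightarrow> P c0 \<and> P c1 \<and> P c2 \<and> P c3" for P :: "q \<Rightarrow> bool"
    by (metis q_exhaust)
  have "(b = c1 \<oplus> a \<and> c = c2 \<oplus> a \<and> d = c3 \<oplus> a) \<or> (a, b, c, d) \<in> set ?cyc"
    if "distinct [a, b, c, d]" "a \<noteq> c0" "b \<noteq> c1" "c \<noteq> c2" "d \<noteq> c3" for a b c d
    by (insert that, (rule q_exhaust[of a]; rule q_exhaust[of b]; rule q_exhaust[of c]; rule q_exhaust[of d]; simp add: xor_def))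
  moreover have "distinct [t c0, t c1, t c2, t c3]" if "inj t" for t :: "q \<Rightarrow> q"
    using that by (simp add: inj_eq)
  moreover have "(\<forall>v. t v = v \<oplus> t c0) \<longleftrightarrow> t c1 = c1 \<oplus> t c0 \<and> t c2 = c2 \<oplus> t c0 \<and> t c3 = c3 \<oplus> t c0" for t
    unfolding all by simp
  ultimately have cyc: "(\<exists>\<gamma>. \<forall>v. t v = v \<oplus> \<gamma>) \<or> ?row t \<in> set ?cyc"
    if "inj t" "\<And>v. t v \<noteq> v" for t :: "q \<Rightarrow> q"
    using that by metis
  have H: "\<forall>x\<in>set ?cyc. \<forall>y\<in>set ?cyc. case x of (a, b, c, d) \<Rightarrow> case y of (a', b', c', d') \<Rightarrow> a \<noteq> a' \<longrightarrow> b \<noteq> b' \<longrightarrow> c \<noteq> c' \<longrightarrow> d \<noteq> d' \<longrightarrow>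
      a' = a \<oplus> (a \<oplus> a') \<and> b' = b \<oplus> (a \<oplus> a') \<and> c' = c \<oplus> (a \<oplus> a') \<and> d' = d \<oplus> (a \<oplus> a')"
    by (simp add: xor_def)
  have *: "(case ?row p of (a, b, c, d) \<Rightarrow> case ?row s of (a', b', c', d') \<Rightarrow> a \<noteq> a' \<longrightarrow> b \<noteq> b' \<longrightarrow> c \<noteq> c' \<longrightarrow> d \<noteq> d' \<longrightarrow>
      a' = a \<oplus> (a \<oplus> a') \<and> b' = b \<oplus> (a \<oplus> a') \<and> c' = c \<oplus> (a \<oplus> a') \<and> d' = d \<oplus> (a \<oplus> a'))"
    if "?row p \<in> set ?cyc" "?row s \<in> set ?cyc"
    by (rule bspec[OF bspec[OF H that(1)] that(2)])
  have "\<exists>\<gamma>. \<forall>v. s v = p v \<oplus> \<gamma>" if "?row p \<in> set ?cyc" "?row s \<in> set ?cyc"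
    using *[OF that, unfolded prod.case] assms(5) unfolding all by blast
  then show ?thesis
    using cyc[OF assms(1,3)] cyc[OF assms(2,4)] by blast
qed

text \<open>Two among three rows differ by a translation \<open>\<gamma>\<close>, and passing to the
  missing letters of each column shows that the other two rows do so too. If \<open>\<gamma>\<close>
  relates two columns in one of the rows, the same argument gives it in all rows and then for the
  other two columns.\<close>

lemma latin_square_translation:
  fixes f :: "q \<Rightarrow> q \<Rightarrow> q"
  assumes row: "\<And>a. inj (f a)" and col: "\<And>b. inj (\<lambda>a. f a b)"
  obtains \<alpha> \<beta> \<gamma> where "\<alpha> \<noteq> c0" "\<beta> \<noteq> c0" "\<gamma> \<noteq> c0"
    "\<And>a b. f (a \<oplus> \<alpha>) b = f a b \<oplus> \<gamma>" "\<And>a b. f a (b \<oplus> \<beta>) = f a b \<oplus> \<gamma>"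
proof -
  have bij: "bij (f a)" for a using row[of a] by (simp add: finite_UNIV_inj_surj bij_def)
  have rne: "f a b = f a b' \<longleftrightarrow> b = b'" for a b b' using row by (simp add: inj_eq)
  have cne: "f a b = f a' b \<longleftrightarrow> a = a'" for a a' b using col[of b] by (auto dest: injD)
  let ?g = "inv (f c0)"
  have g: "f c0 (?g v) = v" "?g (f c0 b) = b" for v b
    using bij by (simp_all add: bij_is_surj surj_f_inv_f bij_is_inj)
  have gi: "inj ?g" using bij by (simp add: bij_imp_bij_inv bij_is_inj)
  have ne: "f c1 (?g v) \<noteq> v" "f c2 (?g v) \<noteq> v" "f c1 (?g v) \<noteq> f c2 (?g v)" for v
    using cne[of c1 "?g v" c0] cne[of c2 "?g v" c0] cne[of c1 "?g v" c2] g(1)[of v] by auto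
  have "\<exists>\<gamma>. (\<forall>v. f c1 (?g v) = v \<oplus> \<gamma>) \<or> (\<forall>v. f c2 (?g v) = v \<oplus> \<gamma>) \<or> (\<forall>v. f c2 (?g v) = f c1 (?g v) \<oplus> \<gamma>)"
    by (rule three_rows) (use inj_compose[OF row gi, unfolded o_def] ne in blast)+
  then obtain \<gamma> where "(\<forall>v. f c1 (?g v) = v \<oplus> \<gamma>) \<or> (\<forall>v. f c2 (?g v) = v \<oplus> \<gamma>) \<or> (\<forall>v. f c2 (?g v) = f c1 (?g v) \<oplus> \<gamma>)"
    by blast
  then have "(\<forall>b. f c1 b = f c0 b \<oplus> \<gamma>) \<or> (\<forall>b. f c2 b = f c0 b \<oplus> \<gamma>) \<or> (\<forall>b. f c2 b = f c1 b \<oplus> \<gamma>)"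
    using g(2) by metis
  then obtain a0 a1 where a: "a0 \<noteq> a1" "\<And>b. f a1 b = f a0 b \<oplus> \<gamma>"
    by (metis prod.inject)
  define \<alpha> where "\<alpha> = a0 \<oplus> a1"
  have \<alpha>: "\<alpha> \<noteq> c0" "a1 = a0 \<oplus> \<alpha>"
    using a(1) unfolding \<alpha>_def by (metis xor_simps(6) xor_simps(4) xor_commute, simp flip: xor_assoc)
  have \<gamma>: "\<gamma> \<noteq> c0" using a cne[of a1 c0 a0] by auto
  have A: "f (a \<oplus> \<alpha>) b = f a b \<oplus> \<gamma>" for a b
  proof (cases "a = a0 \<or> a = a1")
    case True
    then show ?thesis using a(2)[of b] \<alpha>(2) by (elim disjE) simp_all
  next
    case False
    then have "distinct [f a0 b, f a0 b \<oplus> \<gamma>, f a b, f (a \<oplus> \<alpha>) b]"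
      unfolding a(2)[symmetric] using \<alpha> a(1) xor_simps(8)[of a \<alpha> a0] xor_simps(4)[of a \<alpha>] by (auto simp: cne)
    then show ?thesis by (rule fourth_xor)
  qed
  obtain b' where b': "f a0 b' = f a0 c0 \<oplus> \<gamma>" using bij[of a0] by (metis bij_pointE)
  have b0: "b' \<noteq> c0" using b' \<gamma> by auto
  have base: "f a b' = f a c0 \<oplus> \<gamma>" for a
  proof (cases "a = a0 \<or> a = a1")
    case True
    then show ?thesis using a(2)[of c0] a(2)[of b'] b' by (elim disjE) simp_all
  next
    case False
    have "f a b' \<noteq> f a0 c0" using a(2)[of b'] b' cne[of a b' a1] False by auto
    moreover have "f a b' \<noteq> f a0 c0 \<oplus> \<gamma>" using b' cne[of a b' a0] False by auto
    moreover have "f a c0 \<noteq> f a0 c0" using cne[of a c0 a0] False by auto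
    moreover have "f a c0 \<noteq> f a0 c0 \<oplus> \<gamma>" using a(2)[of c0] cne[of a c0 a1] False by auto
    moreover have "f a c0 \<noteq> f a b'" using rne b0 by auto
    ultimately have "distinct [f a0 c0, f a0 c0 \<oplus> \<gamma>, f a c0, f a b']" using \<gamma> by auto
    then show ?thesis by (rule fourth_xor)
  qed
  have B: "f a (b \<oplus> b') = f a b \<oplus> \<gamma>" for a b
  proof (cases "b = c0 \<or> b = b'")
    case True
    then show ?thesis using base[of a] by (elim disjE) simp_all
  next
    case False
    have *: "b \<oplus> b' \<noteq> c0" "b \<oplus> b' \<noteq> b'" "b \<oplus> b' \<noteq> b" "b \<noteq> c0" "b \<noteq> b'"
      using False b0 xor_simps(8)[of b b' b'] xor_simps(8)[of b b' c0] by simp_all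
    have "distinct [f a c0, f a c0 \<oplus> \<gamma>, f a b, f a (b \<oplus> b')]"
      unfolding base[symmetric] using * *[symmetric] b0 b0[symmetric] by (simp add: rne)
    then show ?thesis by (rule fourth_xor)
  qed
  show ?thesis by (rule that[OF \<alpha>(1) b0 \<gamma> A B])
qed

lemma square_function:
  assumes M: "mds T M" and T: "T = {i, j, k}" "i \<noteq> j" "i \<noteq> k" "j \<noteq> k"
  obtains f where "\<And>x. M x \<longleftrightarrow> x k = f (x i) (x j)" "\<And>a. inj (f a)" "\<And>b. inj (\<lambda>a. f a b)"
proof -
  define z where "z a b v = (\<lambda>_. c0)(i := a, j := b, k := v)" for a b v
  have M_z: "M x = M (z (x i) (x j) (x k))" for x
    by (rule mds_agree[OF M]) (use T in \<open>auto simp: z_def\<close>)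
  have ex1: "\<exists>!v. M (z a b v)" for a b
    using M T unfolding mds_def z_def by blast
  define f where "f a b = (THE v. M (z a b v))" for a b
  have f: "M (z a b v) \<longleftrightarrow> v = f a b" for a b v
    using theI'[OF ex1, of a b] ex1[of a b] unfolding f_def by blast
  have "a = a'" if "f a b = f a' b" for a a' b
  proof -
    have z: "z a b v = (z c0 b v)(i := a)" for a v unfolding z_def using T by (simp add: fun_upd_twist)
    have "M ((z c0 b (f a b))(i := a))" "M ((z c0 b (f a b))(i := a'))"
      unfolding z[symmetric] using f that by blast+
    then show ?thesis using mds_unique[OF M] T(1) by blast
  qed
  moreover have "b = b'" if "f a b = f a b'" for a b b'
  proof -
    have z: "z a b v = (z a c0 v)(j := b)" for b v unfolding z_def using T by (simp add: fun_upd_twist)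
    have "M ((z a c0 (f a b))(j := b))" "M ((z a c0 (f a b))(j := b'))"
      unfolding z[symmetric] using f that by blast+
    then show ?thesis using mds_unique[OF M] T(1) by blast
  qed
  ultimately have "inj (f a)" "inj (\<lambda>a. f a b)" for a b by (metis injI)+
  then show ?thesis using that[of f] M_z f by blast
qed

lemma square_semilinear:
  assumes M: "mds T M" and "card T = 3"
  shows "semilinear T M"
proof -
  obtain i j k where T: "T = {i, j, k}" "i \<noteq> j" "i \<noteq> k" "j \<noteq> k"
    using assms(2) by (auto simp: card_3_iff)
  obtain f where f: "\<And>x. M x \<longleftrightarrow> x k = f (x i) (x j)" "\<And>a. inj (f a)" "\<And>b. inj (\<lambda>a. f a b)"
    using square_function[OF M T] by blast
  obtain \<alpha> \<beta> \<gamma> where *: "\<alpha> \<noteq> c0" "\<beta> \<noteq> c0" "\<gamma> \<noteq> c0"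
    "\<And>a b. f (a \<oplus> \<alpha>) b = f a b \<oplus> \<gamma>" "\<And>a b. f a (b \<oplus> \<beta>) = f a b \<oplus> \<gamma>"
    using latin_square_translation[OF f(2,3)] by blast
  define g where "g = (\<lambda>_. \<gamma>)(i := \<alpha>, j := \<beta>)"
  have g: "g i = \<alpha>" "g j = \<beta>" "g k = \<gamma>" using T by (auto simp: g_def)
  have "invariant T M g"
    using T g * by (intro invariantI) (auto simp: f(1) sh_apply)
  moreover have "\<forall>m\<in>T. g m \<noteq> c0" using T g * by auto
  ultimately show ?thesis unfolding semilinear_def by blast
qed

section \<open>Quaternary codes that are not semilinear\<close>

definition neg4 :: "q \<Rightarrow> q" where
  "neg4 v = (fst v, snd v \<noteq> fst v)"

lemma add4_commute: "add4 a b = add4 b a"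
  by (auto simp: add4_def)

lemma add4_assoc: "add4 (add4 a b) c = add4 a (add4 b c)"
  by (rule q_exhaust[of a]; rule q_exhaust[of b]; rule q_exhaust[of c]; simp add: add4_def)

lemma add4_zero [simp]: "add4 c0 a = a" "add4 a c0 = a"
  by (cases a; simp add: add4_def)+

lemma add4_neg4 [simp]: "add4 a (neg4 a) = c0" "add4 (neg4 a) a = c0"
  by (cases a; auto simp: add4_def neg4_def)+

lemma add4_eq_iff: "add4 a b = v \<longleftrightarrow> a = add4 v (neg4 b)"
  by (metis add4_assoc add4_neg4 add4_zero(2))

lemma twist_twist [simp]: "twist (twist v) = v"
  by (cases v) (auto simp: twist_def)

lemma twisted_iff:
  "twisted a b c d \<longleftrightarrow> a = add4 (twist (add4 c d)) (neg4 b)"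
  "twisted a b c d \<longleftrightarrow> b = add4 (twist (add4 c d)) (neg4 a)"
  "twisted a b c d \<longleftrightarrow> c = add4 (twist (add4 a b)) (neg4 d)"
  "twisted a b c d \<longleftrightarrow> d = add4 (twist (add4 a b)) (neg4 c)"
  unfolding twisted_def by (metis add4_eq_iff add4_commute twist_twist)+

lemma code4I:
  assumes "\<And>b c d. \<exists>!a. R a b c d" "\<And>a c d. \<exists>!b. R a b c d" "\<And>a b d. \<exists>!c. R a b c d" "\<And>a b c. \<exists>!d. R a b c d"
  shows "code4 R"
  unfolding code4_def by (intro conjI allI; rule assms)

lemma code4_twisted: "code4 twisted"
proof -
  have "\<exists>!a. twisted a b c d" "\<exists>!b. twisted a b c d" "\<exists>!c. twisted a b c d" "\<exists>!d. twisted a b c d" for a b c d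
    unfolding twisted_iff(1)[of _ b c d] twisted_iff(2)[of a _ c d] twisted_iff(3)[of a b _ d] twisted_iff(4)[of a b c]
    by simp_all
  then show ?thesis by (intro code4I)
qed

text \<open>The relabeling by which the second completion of the two layers in
  \<open>twisted_layers\<close> differs from \<open>twisted\<close> with two coordinates
  exchanged.\<close>

definition swap23 :: "q \<Rightarrow> q" where
  "swap23 v = (fst v \<noteq> snd v, snd v)"

lemma swap23_swap23 [simp]: "swap23 (swap23 v) = v"
  by (cases v) (auto simp: swap23_def)

lemma bij_swap23: "bij swap23"
  by (rule o_bij[of swap23]) (auto simp: fun_eq_iff)

lemma code4_relabel:
  assumes R: "code4 R" and f: "bij f" "bij g" "bij h" "bij k"
  shows "code4 (\<lambda>a b c d. R (f a) (g b) (h c) (k d))"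
proof -
  have ex: "\<exists>!a. P (f a)" if "\<exists>!a. P a" "bij f" for P and f :: "q \<Rightarrow> q"
    using that by (metis bij_pointE)
  show ?thesis
  proof (rule code4I)
    fix a b c d
    show "\<exists>!a. R (f a) (g b) (h c) (k d)" by (rule ex[where P = "\<lambda>v. R v (g b) (h c) (k d)", OF code4_ex1(1)[OF R] f(1)])
    show "\<exists>!b. R (f a) (g b) (h c) (k d)" by (rule ex[where P = "\<lambda>v. R (f a) v (h c) (k d)", OF code4_ex1(2)[OF R] f(2)])
    show "\<exists>!c. R (f a) (g b) (h c) (k d)" by (rule ex[where P = "\<lambda>v. R (f a) (g b) v (k d)", OF code4_ex1(3)[OF R] f(3)])
    show "\<exists>!d. R (f a) (g b) (h c) (k d)" by (rule ex[where P = "\<lambda>v. R (f a) (g b) (h c) v", OF code4_ex1(4)[OF R] f(4)])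
  qed
qed

lemma code4_swap:
  assumes R: "code4 R"
  shows "code4 (\<lambda>a b c d. R a c b d)"
  by (rule code4I; rule code4_ex1[OF R])

lemma code4_eqI:
  assumes R: "code4 R" and S: "code4 S" and sub: "\<And>a b c d. S a b c d \<Longrightarrow> R a b c d"
  shows "R a b c d \<longleftrightarrow> S a b c d"
proof
  assume r: "R a b c d"
  obtain d' where "S a b c d'" using code4_ex1(4)[OF S] by blast
  then have "d' = d" using code4_unique(4)[OF R] sub r by blast
  then show "S a b c d" using \<open>S a b c d'\<close> by simp
qed (rule sub)

text \<open>The clauses are an unsatisfiable core, found with a SAT solver, of the defining clauses of a
  quaternary code with two prescribed layers that differs from both completions.\<close>

lemma twisted_layers_certificate:
  assumes 2: "list_all (\<lambda>(i, j). \<not> x i \<or> \<not> x j) [(1,5),(1,13),(1,33),(1,129),(1,193),(6,14),(7,11),(11,15),(11,43),(11,75),(11,139),(11,203),(14,30),(14,46),(14,78),(16,18),(19,51),(22,23),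
  (23,31),(23,87),(23,151),(23,215),(25,57),(26,218),(29,93),(29,221),(34,98),(34,162),(35,51),(37,101),(37,229),(38,54),(47,175),(47,239),
  (49,51),(51,115),(51,243),(54,182),(57,58),(57,121),(57,249),(60,62),(64,65),(64,66),(64,67),(64,72),(64,192),(68,116),(69,85),(70,102),
  (70,134),(71,79),(73,77),(73,105),(74,122),(74,202),(77,125),(82,83),(84,116),(86,102),(86,150),(88,89),(88,90),(94,95),(97,113),(97,161),
  (99,103),(100,116),(106,122),(107,123),(108,109),(108,110),(108,111),(112,116),(116,120),(116,124),(123,127),(123,187),(125,126),(130,194),
  (133,135),(134,150),(135,143),(141,173),(143,191),(146,150),(149,150),(156,158),(156,159),(164,165),(164,166),(164,167),(171,235),(176,177),
  (176,178),(176,188),(176,240),(186,190),(195,199),(195,211),(197,198),(200,248),(201,202),(201,217),(204,205),(204,207),(212,213),(212,214),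
  (224,225),(224,227),(224,236),(230,231),(230,238),(231,247),(233,237),(234,235),(234,238),(241,245),(248,250),(248,251)]"
    and 4: "list_all (\<lambda>(i, j, k, l). x i \<or> x j \<or> x k \<or> x l) [(5,69,133,197),(6,70,134,198),(7,71,135,199),(13,77,141,205),(15,79,143,207),(18,82,146,210),(19,83,147,211),(22,86,150,214),(25,89,153,217),
  (30,94,158,222),(31,95,159,223),(33,97,161,225),(35,99,163,227),(38,102,166,230),(43,107,171,235),(46,110,174,238),(49,113,177,241),
  (58,122,186,250),(62,126,190,254),(65,69,73,77),(66,70,74,78),(67,83,99,115),(68,69,70,71),(72,73,74,75),(77,93,109,125),(79,95,111,127),
  (82,86,90,94),(84,85,86,87),(97,101,105,109),(98,102,106,110),(100,101,102,103),(112,113,114,115),(120,121,122,123),(124,125,126,127),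
  (129,145,161,177),(130,146,162,178),(133,149,165,181),(134,150,166,182),(135,151,167,183),(139,155,171,187),(143,159,175,191),
  (161,165,169,173),(188,189,190,191),(192,193,194,195),(197,213,229,245),(199,215,231,247),(200,201,202,203),(201,217,233,249),
  (202,218,234,250),(203,219,235,251),(209,213,217,221),(227,231,235,239),(236,237,238,239),(240,241,242,243),(243,247,251,255)]"
    and 1: "list_all x [1,11,14,16,23,26,29,34,37,47,51,54,57,60,64,88,108,116,156,164,176,204,212,224,248]"
  shows "list_all x [71,74,77,82,85,95,99,102,105,113,123,126,130,133,143,147,150,153,161,171,174,183,186,189,195,198,201,209,219,222,231,234,237,242,245,255] \<or>
    list_all x [70,73,79,83,85,94,97,103,106,114,123,125,130,135,141,145,150,155,163,169,174,181,186,191,195,197,202,210,217,223,230,235,237,241,247,254]"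
  using assms unfolding list.pred_inject prod.case by sat

text \<open>A code has 64 words. Outside the two prescribed layers, which share 4 of their 16 words
  each, 36 remain; these are the two long lists, one for each completion. Once a code contains a
  completion, it equals it.\<close>

lemma twisted_layers:
  assumes R: "code4 R" and d: "\<And>a b c. R a b c c0 = twisted a b c c0" and a: "\<And>b c d. R c0 b c d = twisted c0 b c d"
  shows "(\<forall>a b c d. R a b c d = twisted a b c d) \<or> (\<forall>a b c d. R a b c d = twisted a (swap23 c) (swap23 b) d)"
proof -
  have mono: "list_all P xs \<Longrightarrow> (\<And>t. P t \<Longrightarrow> Q t) \<Longrightarrow> list_all Q xs" for P Q and xs :: "'x list"
    by (auto simp: list_all_iff)
  have N2: "list_all (\<lambda>(i, j). line_ok i j) [(1,5),(1,13),(1,33),(1,129),(1,193),(6,14),(7,11),(11,15),(11,43),(11,75),(11,139),(11,203),(14,30),(14,46),(14,78),(16,18),(19,51),(22,23),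
  (23,31),(23,87),(23,151),(23,215),(25,57),(26,218),(29,93),(29,221),(34,98),(34,162),(35,51),(37,101),(37,229),(38,54),(47,175),(47,239),
  (49,51),(51,115),(51,243),(54,182),(57,58),(57,121),(57,249),(60,62),(64,65),(64,66),(64,67),(64,72),(64,192),(68,116),(69,85),(70,102),
  (70,134),(71,79),(73,77),(73,105),(74,122),(74,202),(77,125),(82,83),(84,116),(86,102),(86,150),(88,89),(88,90),(94,95),(97,113),(97,161),
  (99,103),(100,116),(106,122),(107,123),(108,109),(108,110),(108,111),(112,116),(116,120),(116,124),(123,127),(123,187),(125,126),(130,194),
  (133,135),(134,150),(135,143),(141,173),(143,191),(146,150),(149,150),(156,158),(156,159),(164,165),(164,166),(164,167),(171,235),(176,177),
  (176,178),(176,188),(176,240),(186,190),(195,199),(195,211),(197,198),(200,248),(201,202),(201,217),(204,205),(204,207),(212,213),(212,214),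
  (224,225),(224,227),(224,236),(230,231),(230,238),(231,247),(233,237),(234,235),(234,238),(241,245),(248,250),(248,251)]"
    unfolding list.pred_inject prod.case line_ok_def by simp
  have P4: "list_all pos4_ok [(5,69,133,197),(6,70,134,198),(7,71,135,199),(13,77,141,205),(15,79,143,207),(18,82,146,210),(19,83,147,211),(22,86,150,214),(25,89,153,217),
  (30,94,158,222),(31,95,159,223),(33,97,161,225),(35,99,163,227),(38,102,166,230),(43,107,171,235),(46,110,174,238),(49,113,177,241),
  (58,122,186,250),(62,126,190,254),(65,69,73,77),(66,70,74,78),(67,83,99,115),(68,69,70,71),(72,73,74,75),(77,93,109,125),(79,95,111,127),
  (82,86,90,94),(84,85,86,87),(97,101,105,109),(98,102,106,110),(100,101,102,103),(112,113,114,115),(120,121,122,123),(124,125,126,127),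
  (129,145,161,177),(130,146,162,178),(133,149,165,181),(134,150,166,182),(135,151,167,183),(139,155,171,187),(143,159,175,191),
  (161,165,169,173),(188,189,190,191),(192,193,194,195),(197,213,229,245),(199,215,231,247),(200,201,202,203),(201,217,233,249),
  (202,218,234,250),(203,219,235,251),(209,213,217,221),(227,231,235,239),(236,237,238,239),(240,241,242,243),(243,247,251,255)]"
    unfolding list.pred_inject prod.case pos4_ok_def by simp
  have "list_all (cell R) [71,74,77,82,85,95,99,102,105,113,123,126,130,133,143,147,150,153,161,171,174,183,186,189,195,198,201,209,219,222,231,234,237,242,245,255] \<or> list_all (cell R) [70,73,79,83,85,94,97,103,106,114,123,125,130,135,141,145,150,155,163,169,174,181,186,191,195,197,202,210,217,223,230,235,237,241,247,254]"
  proof (rule twisted_layers_certificate)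
    show "list_all (\<lambda>(i, j). \<not> cell R i \<or> \<not> cell R j) [(1,5),(1,13),(1,33),(1,129),(1,193),(6,14),(7,11),(11,15),(11,43),(11,75),(11,139),(11,203),(14,30),(14,46),(14,78),(16,18),(19,51),(22,23),
  (23,31),(23,87),(23,151),(23,215),(25,57),(26,218),(29,93),(29,221),(34,98),(34,162),(35,51),(37,101),(37,229),(38,54),(47,175),(47,239),
  (49,51),(51,115),(51,243),(54,182),(57,58),(57,121),(57,249),(60,62),(64,65),(64,66),(64,67),(64,72),(64,192),(68,116),(69,85),(70,102),
  (70,134),(71,79),(73,77),(73,105),(74,122),(74,202),(77,125),(82,83),(84,116),(86,102),(86,150),(88,89),(88,90),(94,95),(97,113),(97,161),
  (99,103),(100,116),(106,122),(107,123),(108,109),(108,110),(108,111),(112,116),(116,120),(116,124),(123,127),(123,187),(125,126),(130,194),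
  (133,135),(134,150),(135,143),(141,173),(143,191),(146,150),(149,150),(156,158),(156,159),(164,165),(164,166),(164,167),(171,235),(176,177),
  (176,178),(176,188),(176,240),(186,190),(195,199),(195,211),(197,198),(200,248),(201,202),(201,217),(204,205),(204,207),(212,213),(212,214),
  (224,225),(224,227),(224,236),(230,231),(230,238),(231,247),(233,237),(234,235),(234,238),(241,245),(248,250),(248,251)]"
      by (rule mono[OF N2]) (use code4_line[OF R] in blast)
    show "list_all (\<lambda>(i, j, k, l). cell R i \<or> cell R j \<or> cell R k \<or> cell R l) [(5,69,133,197),(6,70,134,198),(7,71,135,199),(13,77,141,205),(15,79,143,207),(18,82,146,210),(19,83,147,211),(22,86,150,214),(25,89,153,217),
  (30,94,158,222),(31,95,159,223),(33,97,161,225),(35,99,163,227),(38,102,166,230),(43,107,171,235),(46,110,174,238),(49,113,177,241),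
  (58,122,186,250),(62,126,190,254),(65,69,73,77),(66,70,74,78),(67,83,99,115),(68,69,70,71),(72,73,74,75),(77,93,109,125),(79,95,111,127),
  (82,86,90,94),(84,85,86,87),(97,101,105,109),(98,102,106,110),(100,101,102,103),(112,113,114,115),(120,121,122,123),(124,125,126,127),
  (129,145,161,177),(130,146,162,178),(133,149,165,181),(134,150,166,182),(135,151,167,183),(139,155,171,187),(143,159,175,191),
  (161,165,169,173),(188,189,190,191),(192,193,194,195),(197,213,229,245),(199,215,231,247),(200,201,202,203),(201,217,233,249),
  (202,218,234,250),(203,219,235,251),(209,213,217,221),(227,231,235,239),(236,237,238,239),(240,241,242,243),(243,247,251,255)]"
      by (rule mono[OF P4]) (use code4_pos[OF R] in blast)
    show "list_all (cell R) [1,11,14,16,23,26,29,34,37,47,51,54,57,60,64,88,108,116,156,164,176,204,212,224,248]"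
      by (simp add: cell_def digit_def a d twisted_def twist_def add4_def)
  qed
  then show ?thesis
  proof
    assume *: "list_all (cell R) [71,74,77,82,85,95,99,102,105,113,123,126,130,133,143,147,150,153,161,171,174,183,186,189,195,198,201,209,219,222,231,234,237,242,245,255]"
    have "R a b c d" if "twisted a b c d" for a b c d
      by (insert that, rule q_exhaust[of a]; rule q_exhaust[of b]; rule q_exhaust[of c]; rule q_exhaust[of d];
          simp add: *[unfolded cell_def digit_def, simplified] assms(2,3) twisted_def twist_def add4_def)
    then show ?thesis using code4_eqI[OF R code4_twisted] by blast
  next
    assume *: "list_all (cell R) [70,73,79,83,85,94,97,103,106,114,123,125,130,135,141,145,150,155,163,169,174,181,186,191,195,197,202,210,217,223,230,235,237,241,247,254]"
    have "R a b c d" if "twisted a (swap23 c) (swap23 b) d" for a b c d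
      by (insert that, rule q_exhaust[of a]; rule q_exhaust[of b]; rule q_exhaust[of c]; rule q_exhaust[of d];
          simp add: *[unfolded cell_def digit_def, simplified] assms(2,3) twisted_def twist_def add4_def swap23_def)
    moreover have "code4 (\<lambda>a b c d. twisted a (swap23 c) (swap23 b) d)"
      by (rule code4_relabel[OF code4_swap[OF code4_twisted] bij_id bij_swap23 bij_swap23 bij_id, unfolded id_apply])
    ultimately show ?thesis using code4_eqI[OF R] by blast
  qed
qed

text \<open>In a layer the translations along pairs of coordinates leave four representatives free.\<close>

lemma normalized_layers:
  assumes R: "code4 R"
    and ab: "\<And>a b c. R a b c c0 \<Longrightarrow> R (a \<oplus> c2) (b \<oplus> c2) c c0"
    and bc: "\<And>a b c. R a b c c0 \<Longrightarrow> R a (b \<oplus> c2) (c \<oplus> c3) c0"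
    and bc': "\<And>b c d. R c0 b c d \<Longrightarrow> R c0 (b \<oplus> c3) (c \<oplus> c2) d"
    and cd: "\<And>b c d. R c0 b c d \<Longrightarrow> R c0 b (c \<oplus> c2) (d \<oplus> c2)"
    and base: "R c0 c0 c1 c0" "R c1 c0 c0 c0" "R c0 c0 c0 c1"
    and nd: "\<And>F. (\<And>a b c. R a b c c0 = (c = c1 \<oplus> F a \<oplus> F b)) \<Longrightarrow>
      (\<And>v. F (v \<oplus> c1) = F v \<oplus> c1) \<Longrightarrow> False"
    and na: "\<And>F. (\<And>b c d. R c0 b c d = (d = c1 \<oplus> F b \<oplus> c)) \<Longrightarrow>
      (\<And>v. F (v \<oplus> c2) = F v \<oplus> c3) \<Longrightarrow> False"
  shows "(\<forall>a b c. R a b c c0 = twisted a b c c0) \<and> (\<forall>b c d. R c0 b c d = twisted c0 b c d)"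
proof -
  have uc: "R a b c d \<Longrightarrow> R a b c' d \<longleftrightarrow> c' = c" for a b c c' d
    using code4_unique(3)[OF R] by blast
  have ub: "R a b c d \<Longrightarrow> R a b' c d \<longleftrightarrow> b' = b" for a b b' c d
    using code4_unique(2)[OF R] by blast
  have ud: "R a b c d \<Longrightarrow> R a b c d' \<longleftrightarrow> d' = d" for a b c d d'
    using code4_unique(4)[OF R] by blast
  have ua: "R a b c d \<Longrightarrow> R a' b c d \<longleftrightarrow> a' = a" for a a' b c d
    using code4_unique(1)[OF R] by blast
  have four: "v = c0 \<or> v = c1 \<or> v = c2 \<or> v = c3" for v by (rule q_exhaust) auto
  have xx: "c2 \<oplus> c2 = c0" "c1 \<oplus> c2 = c3" "c1 \<oplus> c3 = c2" "c3 \<oplus> c2 = c1" "c3 \<oplus> c3 = c0" "c2 \<oplus> c3 = c1"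
    by (simp_all add: xor_def)
  have ac: "R (a \<oplus> c2) b (c \<oplus> c3) c0" if "R a b c c0" for a b c
    using bc[OF ab[OF that]] by simp
  have bd: "R c0 (b \<oplus> c3) c (d \<oplus> c2)" if "R c0 b c d" for b c d
    using cd[OF bc'[OF that]] by simp
  have b010: "R c0 c1 c0 c0" using bc[OF bc'[OF base(1)]] by (simp add: xor_def)
  have layer_d: "R a b (G a b) c0" if G: "\<And>a b. G (a \<oplus> c2) b = G a b \<oplus> c3" "\<And>a b. G a (b \<oplus> c2) = G a b \<oplus> c3"
    and r: "R c0 c0 (G c0 c0) c0" "R c1 c0 (G c1 c0) c0" "R c0 c1 (G c0 c1) c0" "R c1 c1 (G c1 c1) c0" for G a b
  proof -
    have 1: "R (a \<oplus> c2) b (G (a \<oplus> c2) b) c0" "R a (b \<oplus> c2) (G a (b \<oplus> c2)) c0" if "R a b (G a b) c0" for a b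
      using ac[OF that] bc[OF that] G by simp_all
    have 2: "R a c0 (G a c0) c0" "R a c1 (G a c1) c0" for a
      using four[of a] r r[THEN 1(1)] by (auto simp: xor_def)
    show ?thesis using four[of b] 2[of a] 2[of a, THEN 1(2)] by (auto simp: xor_def)
  qed
  have layer_a: "R c0 b c (G b c)" if G: "\<And>b c. G (b \<oplus> c3) c = G b c \<oplus> c2" "\<And>b c. G b (c \<oplus> c2) = G b c \<oplus> c2"
    and r: "R c0 c0 c0 (G c0 c0)" "R c0 c1 c0 (G c1 c0)" "R c0 c0 c1 (G c0 c1)" "R c0 c1 c1 (G c1 c1)" for G b c
  proof -
    have 1: "R c0 (b \<oplus> c3) c (G (b \<oplus> c3) c)" "R c0 b (c \<oplus> c2) (G b (c \<oplus> c2))" if "R c0 b c (G b c)" for b c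
      using bd[OF that] cd[OF that] G by simp_all
    have 2: "R c0 b c0 (G b c0)" "R c0 b c1 (G b c1)" for b
      using four[of b] r r[THEN 1(1)] by (auto simp: xor_def)
    show ?thesis using four[of c] 2[of b] 2[of b, THEN 1(2)] by (auto simp: xor_def)
  qed
  \<comment> \<open>\<open>(c1, c1)\<close> is the only representative not yet known. The value
    \<open>c1\<close> would give the layer the affine form excluded by \<open>nd\<close>, and two
    further values already occur on its lines, so \<open>c2\<close> remains.\<close>
  have "\<not> R c1 c1 c1 c0"
  proof
    assume r: "R c1 c1 c1 c0"
    let ?F = "\<lambda>v :: q. (fst v \<noteq> snd v, snd v)"
    have "R a b (c1 \<oplus> ?F a \<oplus> ?F b) c0" for a b
      by (rule layer_d) (use base b010 r in \<open>auto simp: xor_def\<close>)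
    then show False using uc by (intro nd[of ?F]) (blast, auto simp: xor_def)
  qed
  moreover have "\<not> R c1 c1 c0 c0" using ub[OF base(2)] by simp
  moreover have "\<not> R c1 c1 c3 c0" using ub[OF bc[OF base(2)], of c1] by (simp add: xor_def)
  moreover obtain c where "R c1 c1 c c0" using code4_ex1(3)[OF R] by blast
  ultimately have r1: "R c1 c1 c2 c0" using four[of c] by blast
  have "\<not> R c0 c1 c1 c1"
  proof
    assume r: "R c0 c1 c1 c1"
    let ?F = "\<lambda>v :: q. (fst v \<noteq> snd v, snd v)"
    have "R c0 b c (c1 \<oplus> ?F b \<oplus> c)" for b c
      by (rule layer_a) (use base b010 r in \<open>auto simp: xor_def\<close>)
    then show False using ud by (intro na[of ?F]) (blast, auto simp: xor_def)
  qed
  moreover have "\<not> R c0 c1 c1 c0" using ub[OF base(1)] by simp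
  moreover have "\<not> R c0 c1 c1 c2" using uc[OF cd[OF b010], of c1] by (simp add: xor_def)
  moreover obtain d where "R c0 c1 c1 d" using code4_ex1(4)[OF R] by blast
  ultimately have r2: "R c0 c1 c1 c3" using four[of d] by blast
  let ?G = "\<lambda>a b :: q. twist (add4 a b)"
  have d: "R a b (?G a b) c0" for a b
    by (rule layer_d) (use base b010 r1 in \<open>auto simp: xor_def twist_def add4_def\<close>)
  \<comment> \<open>The second summand is the negative of \<open>c\<close> modulo 4, so
    \<open>?H\<close> solves the equation of \<open>twisted\<close> for the last letter.\<close>
  let ?H = "\<lambda>b c :: q. add4 (?G c0 b) (fst c, fst c \<noteq> snd c)"
  have a: "R c0 b c (?H b c)" for b c
    by (rule layer_a) (use base b010 r2 in \<open>auto simp: xor_def twist_def add4_def\<close>)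
  have "twisted a b c c0 \<longleftrightarrow> c = ?G a b" "twisted c0 b c d \<longleftrightarrow> d = ?H b c" for a b c d
    by (cases a; cases b; cases c; cases d; auto simp: twisted_def twist_def add4_def)+
  then show ?thesis using uc[OF d] ud[OF a] by simp
qed

section \<open>Rows that form no transversal with the twisted code\<close>

text \<open>The lists contain an unsatisfiable core of the clauses for three quaternary codes that form no
  transversal with the twisted code; cell \<open>n\<close> of the code number \<open>r\<close> has the index \<open>256 r + n\<close>.\<close>

definition "neg3_0 = ([(0,341,766),(0,343,698),(0,343,701),(0,343,749),(0,347,686),(0,357,702),(0,358,731),(0,359,733),(0,359,766),(0,363,670),(0,363,765),(0,367,725),
  (0,373,686),(0,373,734),(0,374,733),(0,375,666),(0,375,669),(0,375,729),(0,375,750),(0,377,670),(0,379,749),(0,382,725),(0,405,618),(0,407,634),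
  (0,407,766),(0,409,638),(0,411,622),(0,421,734),(0,421,762),(0,423,729),(0,427,606),(0,427,766),(0,437,622),(0,437,746),(0,439,602),(0,439,605),
  (0,439,734),(0,443,733),(0,443,750),(0,469,638),(0,469,686),(0,471,618),(0,471,702),(0,485,670),(0,485,698),(0,487,638),(0,491,702),(0,501,606),
  (0,501,682),(0,502,671),(0,503,622),(0,503,670),(0,505,678),(0,507,669),(0,507,686),(1,340,682),(1,343,686),(1,347,766),(1,359,670),(1,363,702),
  (1,372,686),(1,372,734),(1,375,746),(1,379,686),(1,379,734),(1,404,618),(1,404,750),(1,407,622),(1,407,762),(1,411,750),(1,411,758),(1,420,602),
  (1,420,638),(1,423,606),(1,423,766),(1,427,638),(1,427,734),(1,436,746),(1,439,730),(1,439,750),(1,443,622),(1,468,686),(1,471,698),(1,475,638),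
  (1,475,686),(1,484,670),(1,487,634),(1,487,702),(1,491,630),(1,491,670),(1,500,606),(1,503,618),(1,503,666),(1,503,686),(1,507,606),(2,345,767),
  (2,363,668),(2,423,605),(2,423,765),(2,427,764)] :: (nat \<times> nat \<times> nat) list)"

definition "neg3_1 = ([(2,475,637),(2,487,636),(2,487,701),(3,340,701),(3,357,732),(3,361,702),(3,372,750),(3,404,766),(3,405,622),(3,421,766),(3,468,702),(3,484,638),
  (3,489,670),(3,501,686),(4,403,766),(4,415,746),(4,427,734),(4,491,670),(4,507,606),(5,339,686),(8,343,766),(8,355,670),(8,357,766),(8,359,669),
  (8,359,702),(8,359,722),(8,375,734),(8,423,638),(8,423,734),(8,437,734),(8,437,738),(8,439,622),(8,471,686),(8,485,638),(8,487,670),(8,501,622),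
  (9,339,766),(9,343,684),(9,343,702),(9,356,671),(9,375,670),(9,407,638),(9,423,604),(9,423,764),(9,439,606),(9,439,748),(9,471,622),(9,484,638),
  (9,486,607),(9,487,606),(9,500,595),(9,503,658),(10,500,669),(12,407,746),(12,423,761),(12,435,729),(12,471,682),(12,471,690),(12,503,602),
  (13,407,634),(16,325,766),(16,327,701),(16,359,702),(16,361,718),(16,363,654),(16,363,766),(16,373,718),(16,375,650),(16,375,686),(16,377,742),
  (16,379,750),(16,391,766),(16,393,638),(16,395,622),(16,399,618),(16,421,718),(16,423,638),(16,427,590),(16,439,622),(16,439,718),(16,439,746),
  (16,441,623),(16,453,686),(16,455,702),(16,459,701),(16,485,634),(16,487,586),(16,491,638),(16,501,590),(16,503,654),(16,503,682),(16,505,686),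
  (16,507,622),(17,327,686),(17,331,766),(17,359,654),(17,359,698),(17,359,766),(17,363,700),(17,375,750)] :: (nat \<times> nat \<times> nat) list)"

definition "neg3_2 = ([(17,379,718),(17,391,622),(17,391,636),(17,391,762),(17,395,750),(17,423,590),(17,423,634),(17,423,764),(17,427,718),(17,439,714),(17,440,623),
  (17,442,748),(17,452,686),(17,459,686),(17,459,694),(17,484,634),(17,487,588),(17,487,638),(17,491,654),(17,503,622),(17,503,650),(17,507,590),
  (17,507,652),(24,327,766),(24,355,654),(24,439,738),(25,387,750),(25,423,766),(25,439,590),(32,327,730),(32,327,766),(32,331,670),(32,331,726),
  (32,343,702),(32,343,714),(32,347,766),(32,375,670),(32,375,718),(32,379,669),(32,379,734),(32,389,734),(32,395,606),(32,407,638),(32,407,762),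
  (32,407,765),(32,411,590),(32,439,606),(32,439,730),(32,442,733),(32,455,638),(32,459,702),(32,471,586),(32,471,698),(32,475,694),(32,503,590),
  (32,503,666),(32,507,589),(32,507,606),(33,327,670),(33,327,732),(33,331,702),(33,331,764),(33,343,654),(33,343,716),(33,343,766),(33,372,730),
  (33,375,666),(33,375,714),(33,375,734),(33,379,654),(33,391,606),(33,391,766),(33,395,734),(33,407,590),(33,407,634),(33,411,718),(33,436,590),
  (33,436,714),(33,439,602),(33,439,718),(33,439,732),(33,455,702),(33,471,638),(33,503,586),(33,503,606),(33,503,654),(33,507,588),(35,389,766),
  (35,453,702),(40,327,669),(40,327,702),(40,391,638),(41,324,766),(41,343,718),(41,471,590),(48,327,750),(48,341,746),(48,343,686),(48,347,685),
  (48,347,750)] :: (nat \<times> nat \<times> nat) list)"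

definition "neg3_3 = ([(48,357,654),(48,359,670),(48,359,718),(48,391,602),(48,391,734),(48,393,735),(48,395,733),(48,395,750),(48,407,586),(48,407,622),(48,407,718),
  (48,407,749),(48,409,750),(48,411,582),(48,411,742),(48,421,714),(48,423,606),(48,423,730),(48,423,733),(48,453,606),(48,455,622),(48,455,670),
  (48,459,686),(48,471,654),(48,471,682),(48,475,622),(48,487,590),(48,487,666),(48,487,669),(48,491,606),(49,327,668),(49,327,746),(49,331,748),
  (49,343,682),(49,343,750),(49,347,718),(49,359,666),(49,359,714),(49,359,734),(49,363,654),(49,391,730),(49,391,750),(49,407,618),(49,407,714),
  (49,411,716),(49,423,602),(49,423,718),(49,423,732),(49,427,590),(49,427,604),(49,455,686),(49,459,606),(49,471,622),(49,471,650),(49,475,590),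
  (49,479,586),(49,487,606),(49,487,654),(49,487,668),(53,347,654),(56,341,686),(56,343,718),(56,423,717),(57,327,738),(57,359,732),(57,422,604),
  (61,347,740),(64,277,682),(64,277,766),(64,279,698),(64,279,701),(64,279,746),(64,279,749),(64,281,750),(64,282,701),(64,283,686),(64,283,742),
  (64,287,682),(64,293,666),(64,293,702),(64,295,730),(64,295,733),(64,295,766),(64,297,734),(64,299,670),(64,303,666),(64,309,686),(64,309,734),
  (64,311,666),(64,311,750),(64,313,670),(64,317,726),(64,405,554),(64,405,762),(64,407,570),(64,407,573),(64,407,750),(64,411,558),(64,411,566),
  (64,411,766)] :: (nat \<times> nat \<times> nat) list)"

definition "neg3_4 = ([(64,415,554),(64,415,745),(64,421,538),(64,421,574),(64,423,734),(64,423,762),(64,423,765),(64,425,735),(64,425,766),(64,427,542),(64,427,565),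
  (64,431,538),(64,437,558),(64,437,730),(64,439,538),(64,439,541),(64,439,746),(64,441,750),(64,443,734),(64,469,574),(64,469,698),(64,470,573),
  (64,471,554),(64,471,686),(64,475,550),(64,475,702),(64,487,538),(64,487,574),(64,487,670),(64,487,698),(64,489,542),(64,491,534),(64,501,542),
  (64,501,666),(64,503,558),(64,503,682),(64,507,670),(64,507,678),(65,279,686),(65,279,700),(65,282,767),(65,283,766),(65,287,762),(65,295,670),
  (65,295,732),(65,295,762),(65,299,702),(65,299,764),(65,308,734),(65,310,684),(65,311,668),(65,311,728),(65,311,746),(65,314,668),(65,315,686),
  (65,315,734),(65,319,730),(65,407,558),(65,407,572),(65,407,746),(65,407,766),(65,423,542),(65,423,730),(65,423,764),(65,427,574),(65,427,726),
  (65,427,732),(65,431,570),(65,436,558),(65,436,730),(65,439,540),(65,439,734),(65,439,748),(65,443,558),(65,471,556),(65,471,702),(65,475,574),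
  (65,487,540),(65,487,570),(65,487,666),(65,487,700),(65,500,539),(65,500,542),(65,503,554),(65,503,670),(65,503,684),(65,504,686),(65,506,543),
  (65,507,542),(65,507,556),(66,279,685),(66,423,541),(67,281,766),(67,292,766),(67,484,574),(72,279,685),(72,279,766),(72,291,670),(72,294,703),
  (72,295,702)] :: (nat \<times> nat \<times> nat) list)"

definition "neg3_5 = ([(72,309,750),(72,311,686),(72,311,734),(72,407,562),(72,419,542),(72,423,541),(72,423,574),(72,439,558),(72,471,574),(72,487,690),(72,499,670),
  (72,503,542),(73,279,702),(73,291,702),(73,307,686),(73,308,750),(73,311,670),(73,419,574),(73,439,542),(73,439,750),(73,471,558),(73,487,562),
  (73,503,686),(74,311,669),(74,467,700),(74,503,672),(75,305,748),(75,501,686),(80,263,698),(80,263,746),(80,267,686),(80,293,762),(80,295,702),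
  (80,295,714),(80,295,717),(80,297,718),(80,299,654),(80,299,766),(80,309,718),(80,311,650),(80,311,686),(80,315,750),(80,391,570),(80,391,750),
  (80,395,558),(80,395,766),(80,421,522),(80,423,574),(80,423,718),(80,427,526),(80,437,714),(80,437,750),(80,438,559),(80,439,522),(80,439,558),
  (80,441,526),(80,443,718),(80,447,714),(80,453,574),(80,453,698),(80,455,554),(80,455,557),(80,455,686),(80,459,702),(80,485,570),(80,485,702),
  (80,487,522),(80,487,654),(80,491,574),(80,501,526),(80,501,686),(80,507,558),(80,507,654),(80,511,650),(81,263,686),(81,267,766),(81,295,654),
  (81,295,698),(81,295,766),(81,311,682),(81,311,750),(81,315,718),(81,391,558),(81,391,746),(81,391,766),(81,423,526),(81,423,570),(81,423,714),
  (81,423,760),(81,427,566),(81,427,572),(81,427,716),(81,431,762),(81,436,714),(81,436,750),(81,439,524),(81,439,554),(81,439,718),(81,443,550),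
  (81,443,750)] :: (nat \<times> nat \<times> nat) list)"

definition "neg3_6 = ([(81,452,574),(81,452,698),(81,455,682),(81,455,702),(81,459,574),(81,487,574),(81,487,650),(81,488,526),(81,491,702),(81,500,650),(81,503,558),
  (81,503,654),(81,503,680),(81,507,686),(82,311,684),(82,395,764),(83,293,766),(83,485,574),(83,489,702),(88,311,718),(88,487,702),(88,503,526),
  (89,439,716),(90,261,672),(96,263,730),(96,263,733),(96,263,766),(96,279,702),(96,279,714),(96,283,654),(96,283,701),(96,283,766),(96,309,654),
  (96,311,670),(96,311,718),(96,315,734),(96,391,734),(96,391,765),(96,395,542),(96,395,733),(96,405,766),(96,407,574),(96,407,718),(96,437,526),
  (96,437,734),(96,439,542),(96,441,718),(96,455,541),(96,455,574),(96,455,670),(96,455,698),(96,459,669),(96,469,570),(96,469,702),(96,471,522),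
  (96,471,654),(96,473,526),(96,475,574),(96,503,526),(96,503,650),(96,506,653),(96,507,542),(97,263,670),(97,263,732),(97,263,762),(97,267,702),
  (97,279,654),(97,279,698),(97,279,766),(97,310,652),(97,311,714),(97,311,734),(97,315,654),(97,391,542),(97,391,730),(97,395,574),(97,407,526),
  (97,407,570),(97,407,714),(97,411,766),(97,436,734),(97,439,538),(97,439,716),(97,443,526),(97,443,534),(97,443,734),(97,455,570),(97,455,666),
  (97,459,566),(97,468,702),(97,471,574),(97,471,650),(97,475,646),(97,475,652),(97,475,702),(97,503,522),(97,503,542),(97,507,670),(98,263,669),
  (99,500,526)] :: (nat \<times> nat \<times> nat) list)"

definition "neg3_7 = ([(99,505,670),(104,263,702),(104,311,654),(104,311,733),(104,437,542),(104,439,734),(105,391,722),(105,439,718),(106,469,652),(112,261,734),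
  (112,263,666),(112,263,750),(112,267,662),(112,267,749),(112,279,653),(112,279,686),(112,283,750),(112,293,654),(112,293,730),(112,295,670),
  (112,295,718),(112,299,669),(112,299,734),(112,391,538),(112,391,541),(112,391,746),(112,395,734),(112,405,750),(112,407,522),(112,407,558),
  (112,410,525),(112,411,718),(112,421,526),(112,421,734),(112,423,542),(112,423,714),(112,423,717),(112,453,542),(112,455,558),(112,455,685),
  (112,457,686),(112,459,533),(112,459,670),(112,469,554),(112,475,558),(112,475,654),(112,485,538),(112,485,670),(112,487,526),(112,487,650),
  (112,491,525),(112,491,542),(113,263,668),(113,267,686),(113,267,734),(113,279,682),(113,279,750),(113,283,718),(113,295,648),(113,295,666),
  (113,295,734),(113,299,668),(113,391,734),(113,404,750),(113,407,554),(113,407,718),(113,411,750),(113,420,734),(113,423,538),(113,423,716),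
  (113,423,728),(113,427,734),(113,455,554),(113,455,670),(113,459,542),(113,471,558),(113,471,654),(113,475,526),(113,475,686),(113,484,538),
  (113,487,522),(113,487,542),(113,491,670),(114,279,684),(114,295,668),(114,295,716),(114,391,733),(115,260,750),(115,261,668),(115,281,718),
  (115,389,734),(115,420,542),(115,485,542),(116,301,666),(120,263,658),(120,263,686),(120,277,686),(120,279,718),(120,291,734),(120,487,642)] :: (nat \<times> nat \<times> nat) list)"

definition "neg3_8 = ([(121,391,750),(122,295,652),(124,487,666),(128,279,634),(128,279,766),(128,281,638),(128,283,622),(128,283,765),(128,293,638),(128,293,734),
  (128,299,606),(128,299,766),(128,303,762),(128,309,622),(128,309,746),(128,311,602),(128,311,605),(128,311,734),(128,315,598),(128,315,750),
  (128,343,570),(128,343,750),(128,347,558),(128,347,766),(128,357,538),(128,357,574),(128,359,734),(128,359,762),(128,363,542),(128,373,558),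
  (128,375,538),(128,375,541),(128,375,746),(128,375,749),(128,379,734),(128,469,634),(128,471,574),(128,471,622),(128,473,623),(128,475,638),
  (128,485,542),(128,485,570),(128,487,606),(128,487,634),(128,489,638),(128,491,574),(128,491,630),(128,501,554),(128,501,602),(128,503,542),
  (128,503,618),(128,503,621),(128,507,558),(128,507,606),(129,276,750),(129,278,616),(129,278,623),(129,279,622),(129,279,744),(129,279,762),
  (129,283,750),(129,283,758),(129,292,602),(129,292,734),(129,294,636),(129,295,606),(129,295,766),(129,299,638),(129,299,734),(129,311,604),
  (129,311,730),(129,311,750),(129,315,622),(129,315,732),(129,343,558),(129,343,572),(129,343,746),(129,343,766),(129,347,742),(129,347,748),
  (129,351,564),(129,356,767),(129,359,542),(129,359,730),(129,359,764),(129,360,534),(129,363,574),(129,363,726),(129,367,756),(129,375,540),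
  (129,375,734),(129,375,748),(129,379,558),(129,468,558),(129,471,570),(129,471,618),(129,471,638),(129,475,558),(129,479,554),(129,484,570)] :: (nat \<times> nat \<times> nat) list)"

definition "neg3_9 = ([(129,487,574),(129,487,602),(129,491,542),(129,495,538),(129,503,538),(129,503,558),(129,503,606),(129,503,620),(129,507,540),(130,277,748),
  (130,311,732),(130,343,748),(130,347,556),(130,375,536),(131,277,622),(131,280,622),(131,293,766),(131,309,604),(131,309,730),(132,289,734),
  (132,483,606),(134,355,541),(135,378,749),(136,279,621),(136,279,750),(136,295,605),(136,295,721),(136,295,734),(136,295,765),(136,309,734),
  (136,311,622),(136,370,725),(136,371,734),(136,375,733),(136,469,622),(136,471,558),(136,485,606),(136,499,606),(136,501,542),(137,276,766),
  (137,291,638),(137,295,764),(137,308,734),(137,311,606),(137,359,540),(137,359,766),(137,375,750),(137,468,574),(137,487,638),(137,503,622),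
  (138,279,748),(140,475,626),(140,503,530),(141,487,634),(144,263,634),(144,263,766),(144,295,638),(144,295,762),(144,311,718),(144,311,746),
  (144,327,750),(144,331,558),(144,331,566),(144,359,574),(144,363,526),(144,363,717),(144,375,558),(144,455,622),(144,485,638),(144,487,570),
  (144,487,590),(144,503,526),(144,507,590),(145,263,622),(145,263,744),(145,267,750),(145,295,590),(145,295,764),(145,315,620),(145,326,747),
  (145,327,558),(145,327,572),(145,327,766),(145,359,526),(145,375,554),(145,375,718),(145,379,750),(145,455,638),(145,487,586),(145,491,526),
  (145,500,622),(145,503,590),(145,507,524),(146,263,621),(147,324,570),(152,295,589),(152,375,750),(152,487,562),(152,503,622),(153,295,766)] :: (nat \<times> nat \<times> nat) list)"

definition "neg3_10 = ([(153,327,738),(153,375,526),(160,279,638),(160,279,762),(160,283,590),(160,283,637),(160,309,714),(160,311,606),(160,311,730),(160,311,733),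
  (160,315,718),(160,327,734),(160,331,542),(160,343,718),(160,373,734),(160,375,542),(160,375,714),(160,455,606),(160,471,590),(160,503,538),
  (160,507,526),(161,263,606),(161,263,766),(161,267,638),(161,279,590),(161,279,764),(161,283,718),(161,308,590),(161,311,602),(161,311,732),
  (161,327,730),(161,343,526),(161,343,570),(161,343,714),(161,347,572),(161,347,716),(161,379,526),(161,379,734),(161,455,574),(161,459,542),
  (161,471,586),(161,475,526),(161,475,638),(161,500,522),(162,500,605),(163,276,638),(163,500,538),(168,311,590),(168,342,573),(168,471,638),
  (169,463,592),(169,503,542),(169,503,590),(176,261,622),(176,263,602),(176,263,605),(176,263,734),(176,267,750),(176,279,589),(176,279,622),
  (176,279,718),(176,279,746),(176,281,719),(176,285,619),(176,293,590),(176,295,606),(176,295,730),(176,295,733),(176,297,710),(176,299,718),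
  (176,325,730),(176,327,538),(176,327,541),(176,327,746),(176,331,734),(176,331,742),(176,341,714),(176,341,750),(176,343,522),(176,343,558),
  (176,345,526),(176,347,718),(176,351,714),(176,357,734),(176,359,542),(176,359,714),(176,359,717),(176,453,602),(176,455,542),(176,455,618),
  (176,459,558),(176,459,606),(176,471,526),(176,471,554),(176,471,617),(176,475,525),(176,475,590),(176,485,606),(176,487,538),(176,487,541)] :: (nat \<times> nat \<times> nat) list)"

definition "neg3_11 = ([(176,487,586),(176,491,526),(177,260,746),(177,263,604),(177,263,730),(177,263,750),(177,267,622),(177,267,732),(177,279,618),(177,279,714),
  (177,279,748),(177,283,614),(177,295,602),(177,295,718),(177,295,732),(177,299,590),(177,299,604),(177,327,734),(177,327,748),(177,340,714),
  (177,343,524),(177,343,554),(177,343,718),(177,347,750),(177,363,734),(177,455,558),(177,455,606),(177,455,620),(177,459,534),(177,459,540),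
  (177,471,522),(177,471,590),(177,475,622),(177,484,522),(177,484,606),(177,486,527),(177,487,526),(177,491,606),(185,295,594),(185,327,542),
  (185,359,718),(185,471,514),(192,277,623),(192,277,638),(192,279,618),(192,279,702),(192,293,607),(192,293,670),(192,294,639),(192,294,669),
  (192,295,638),(192,299,702),(192,309,606),(192,309,682),(192,311,622),(192,311,670),(192,315,621),(192,315,686),(192,319,682),(192,341,574),
  (192,343,554),(192,343,686),(192,345,558),(192,347,685),(192,347,702),(192,359,538),(192,359,574),(192,359,670),(192,359,698),(192,363,573),
  (192,373,542),(192,373,666),(192,375,558),(192,375,682),(192,379,670),(192,383,666),(192,407,574),(192,407,622),(192,411,638),(192,421,542),
  (192,422,541),(192,423,537),(192,423,606),(192,423,637),(192,427,574),(192,427,605),(192,427,630),(192,438,543),(192,439,542),(192,439,618),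
  (192,443,541),(192,443,558),(192,443,606),(193,279,620),(193,279,698),(193,283,638),(193,283,686),(193,283,694),(193,292,698),(193,294,668)] :: (nat \<times> nat \<times> nat) list)"

definition "neg3_12 = ([(193,295,604),(193,295,634),(193,295,664),(193,295,702),(193,299,636),(193,299,670),(193,308,606),(193,310,680),(193,311,618),(193,311,666),
  (193,311,686),(193,315,606),(193,343,556),(193,343,682),(193,343,702),(193,347,574),(193,359,540),(193,359,570),(193,359,666),(193,359,700),
  (193,375,554),(193,375,670),(193,375,684),(193,379,542),(193,406,556),(193,407,570),(193,407,618),(193,407,638),(193,411,558),(193,411,614),
  (193,420,542),(193,423,536),(193,423,574),(193,423,602),(193,427,542),(193,427,598),(193,439,538),(193,439,558),(193,439,606),(193,439,620),
  (193,443,540),(194,423,601),(195,373,670),(195,437,606),(196,307,622),(197,296,638),(200,279,610),(200,279,638),(200,279,686),(200,295,594),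
  (200,295,670),(200,311,606),(200,343,574),(200,359,530),(200,374,557),(200,375,674),(200,419,574),(200,423,542),(201,275,686),(201,275,700),
  (201,276,702),(201,279,622),(201,339,574),(201,343,674),(201,343,700),(201,359,658),(201,359,702),(201,375,668),(201,375,686),(201,407,562),
  (201,407,610),(201,407,636),(201,423,638),(201,439,530),(201,439,622),(202,279,621),(202,423,540),(204,277,674),(208,263,702),(208,295,698),
  (208,299,638),(208,311,682),(208,315,622),(208,325,574),(208,327,554),(208,331,702),(208,357,570),(208,359,654),(208,379,558),(208,391,622),
  (208,395,638),(208,423,570),(208,423,573),(208,423,590),(208,439,526),(208,439,554),(208,443,590),(209,267,686),(209,295,638),(209,299,654)] :: (nat \<times> nat \<times> nat) list)"

definition "neg3_13 = ([(209,308,590),(209,311,622),(209,311,684),(209,327,702),(209,359,574),(209,363,702),(209,375,558),(209,375,654),(209,379,526),(209,379,686),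
  (209,391,638),(209,395,620),(209,423,586),(209,427,526),(209,427,638),(209,439,556),(209,439,590),(209,443,622),(210,423,588),(212,363,702),
  (216,391,558),(216,421,590),(216,423,526),(217,295,590),(217,295,702),(217,419,638),(220,327,570),(224,263,602),(224,263,638),(224,267,702),
  (224,279,586),(224,283,638),(224,309,602),(224,315,654),(224,319,650),(224,327,670),(224,375,526),(224,391,606),(224,391,637),(224,395,605),
  (224,407,590),(224,437,522),(224,437,606),(224,439,541),(225,263,702),(225,279,638),(225,283,654),(225,311,606),(225,311,654),(225,327,570),
  (225,343,574),(225,347,702),(225,351,698),(225,375,522),(225,375,542),(225,378,532),(225,379,670),(225,391,574),(225,391,602),(225,408,574),
  (225,411,638),(225,439,526),(225,443,606),(232,261,638),(232,311,653),(232,373,526),(232,391,542),(233,391,638),(233,439,542),(240,263,622),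
  (240,263,670),(240,267,669),(240,267,686),(240,279,654),(240,279,682),(240,283,622),(240,293,602),(240,295,590),(240,295,666),(240,299,606),
  (240,303,602),(240,327,558),(240,327,682),(240,341,686),(240,347,558),(240,347,654),(240,359,526),(240,359,650),(240,363,525),(240,363,542),
  (240,391,542),(240,395,541),(240,395,558),(240,399,602),(240,405,586),(240,407,526),(240,407,554),(240,411,550),(240,411,590),(240,415,586)] :: (nat \<times> nat \<times> nat) list)"

definition "neg3_14 = ([(240,423,538),(240,423,541),(240,423,586),(240,423,589),(240,427,534),(241,260,682),(241,263,618),(241,263,686),(241,267,606),(241,276,590),
  (241,279,622),(241,279,650),(241,283,590),(241,283,652),(241,287,676),(241,295,606),(241,295,654),(241,295,668),(241,324,666),(241,327,670),
  (241,331,542),(241,340,526),(241,343,558),(241,343,654),(241,347,526),(241,347,686),(241,356,670),(241,359,542),(241,363,670),(241,391,538),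
  (241,391,558),(241,391,606),(241,395,540),(241,407,522),(241,407,590),(241,411,622),(241,420,606),(241,423,526),(241,423,600),(241,427,606),
  (242,295,588),(243,277,650),(243,301,598),(243,341,654),(243,345,686),(243,357,542),(243,409,622),(248,261,622),(248,263,606),(248,343,686),
  (248,407,622),(248,423,606),(249,292,590),(249,295,652)] :: (nat \<times> nat \<times> nat) list)"

definition "neg2_0 = ([(0,1),(0,8),(0,16),(0,32),(0,48),(0,64),(0,112),(0,128),(0,192),(1,9),(1,17),(1,33),(1,49),(1,65),(1,113),(1,129),(1,193),(2,50),(2,114),(3,51),
  (3,115),(8,9),(8,10),(8,56),(16,17),(16,19),(16,24),(16,48),(16,80),(16,208),(17,18),(17,49),(17,81),(17,145),(17,209),(32,33),(32,40),(32,48),(32,96),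
  (32,160),(33,49),(33,97),(33,161),(48,49),(48,56),(48,112),(48,176),(48,240),(49,51),(49,57),(49,113),(49,177),(49,241),(64,65),(64,66),(64,67),
  (64,72),(64,80),(64,96),(64,112),(64,128),(64,192),(65,66),(65,67),(65,73),(65,81),(65,97),(65,113),(65,129),(65,193),(66,114),(67,115),(68,72),
  (69,73),(72,74),(72,76),(72,88),(73,74),(73,77),(80,81),(80,82),(80,83),(80,112),(80,144),(80,208),(81,89),(81,97),(81,113),(81,145),(81,209),(96,97),
  (96,99),(96,104),(96,112),(96,160),(97,98),(97,99),(97,113),(97,161),(97,225)] :: (nat \<times> nat) list)"

definition "neg2_1 = ([(112,113),(112,176),(112,240),(113,177),(113,241),(120,121),(128,129),(128,130),(128,131),(128,144),(128,160),(128,176),(129,130),(129,131),(129,133),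
  (129,137),(129,145),(129,161),(129,177),(129,193),(131,163),(132,136),(136,137),(136,184),(137,138),(144,145),(144,176),(145,153),(145,177),(160,161),
  (160,176),(161,169),(161,177),(168,169),(176,177),(176,178),(176,179),(176,184),(176,240),(177,178),(177,179),(177,185),(177,241),(192,193),(192,194),
  (192,195),(192,196),(192,200),(192,204),(192,208),(192,224),(192,240),(193,194),(193,195),(193,201),(193,205),(193,209),(193,225),(193,241),(200,201),
  (208,209),(208,240),(216,217),(224,225),(224,232),(224,240),(225,227),(225,241),(240,241),(240,242),(240,243),(241,242),(241,249),(261,262),(261,263),
  (263,267),(263,271),(263,279),(263,295),(263,311),(263,327),(263,391),(263,455),(267,395),(267,459),(273,275),(276,279),(277,279),(277,309),(278,279),
  (279,283),(279,295),(279,311),(279,343),(279,407),(279,471),(283,287),(283,315),(283,347),(283,411)] :: (nat \<times> nat) list)"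

definition "neg2_2 = ([(283,475),(289,291),(292,293),(292,295),(292,484),(293,295),(293,297),(293,309),(294,295),(295,299),(295,311),(295,359),(295,423),(295,487),(297,299),
  (299,303),(299,315),(299,363),(299,427),(299,491),(303,367),(308,309),(308,311),(309,311),(309,313),(311,315),(311,375),(311,439),(311,503),(313,315),
  (315,507),(325,326),(325,327),(325,329),(325,389),(327,331),(327,335),(327,343),(327,359),(327,391),(327,455),(331,347),(335,367),(340,343),(341,343),
  (342,343),(343,347),(343,359),(343,375),(343,407),(343,471),(347,363),(347,411),(347,475),(356,357),(356,359),(357,359),(357,361),(358,374),(359,363),
  (359,367),(359,375),(359,423),(359,487),(361,363),(363,427),(367,495),(372,373),(372,375),(373,375),(374,375),(375,379),(375,439),(375,503),(377,379),
  (379,383),(379,443),(383,511),(389,391),(389,453),(391,395),(391,407),(391,423),(391,439),(391,455),(395,459),(403,407),(405,407),(407,411),(407,423),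
  (407,439),(407,471),(409,411),(411,427),(411,443),(411,475),(415,447),(420,423),(421,423),(421,425)] :: (nat \<times> nat) list)"

definition "neg2_3 = ([(422,438),(423,427),(423,431),(423,439),(423,487),(424,427),(425,427),(427,443),(427,491),(436,439),(437,439),(437,441),(438,439),(439,443),(439,447),
  (439,503),(452,453),(452,455),(453,455),(454,502),(455,459),(455,471),(455,487),(468,471),(469,471),(469,473),(469,501),(471,475),(471,487),(471,503),
  (475,491),(484,485),(484,487),(485,487),(485,501),(487,491),(487,503),(489,491),(491,495),(491,507),(500,501),(500,503),(501,503),(501,505),(503,507),
  (503,511),(518,526),(518,550),(522,526),(522,586),(522,714),(524,526),(524,716),(525,526),(525,717),(526,542),(526,558),(526,574),(526,590),(526,654),
  (526,718),(527,543),(534,542),(535,543),(538,542),(538,554),(538,730),(540,541),(540,542),(541,542),(541,733),(542,558),(542,574),(542,606),(542,670),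
  (542,734),(546,554),(554,558),(554,570),(556,557),(556,558),(557,558),(558,574),(558,622),(558,686),(558,750),(567,575),(570,574),(572,574),(573,574),
  (574,638),(574,702),(574,766),(586,590),(586,602),(588,590),(590,606),(590,622),(590,638),(590,654)] :: (nat \<times> nat) list)"

definition "neg2_4 = ([(590,718),(591,639),(593,605),(594,602),(594,606),(598,602),(598,606),(600,604),(602,606),(602,618),(602,634),(603,619),(604,605),(604,606),(604,636),
  (605,606),(605,621),(606,622),(606,638),(606,670),(606,734),(610,622),(614,618),(614,622),(616,620),(618,622),(618,634),(620,621),(620,622),(620,748),
  (621,622),(622,638),(622,686),(622,750),(634,638),(636,638),(637,638),(638,702),(638,766),(650,654),(650,666),(652,654),(653,654),(653,669),(654,655),
  (654,670),(654,686),(654,702),(654,718),(662,666),(662,670),(664,666),(666,670),(666,682),(666,698),(666,730),(668,669),(668,670),(668,684),(669,670),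
  (670,686),(670,702),(670,734),(678,682),(678,686),(682,686),(684,685),(684,686),(685,686),(686,702),(686,750),(690,702),(694,702),(696,698),(698,702),
  (700,702),(701,702),(702,766),(710,718),(714,718),(714,762),(716,718),(716,719),(717,718),(717,765),(718,734),(718,750),(718,766),(722,734),(726,730),
  (730,734),(730,762),(731,735),(732,733),(732,734),(733,734),(734,750),(734,766),(736,738),(742,750)] :: (nat \<times> nat) list)"

definition "neg2_5 = ([(746,750),(748,749),(748,750),(749,750),(750,766),(752,754),(758,766),(762,766),(763,767),(764,766),(765,766)] :: (nat \<times> nat) list)"

definition "pos4_0 = ([(0,1,2,3),(0,4,8,12),(0,16,32,48),(0,64,128,192),(1,17,33,49),(1,65,129,193),(2,66,130,194),(3,19,35,51),(3,67,131,195),(4,68,132,196),(5,69,133,197),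
  (8,24,40,56),(8,72,136,200),(9,25,41,57),(9,73,137,201),(10,74,138,202),(12,76,140,204),(13,77,141,205),(16,80,144,208),(17,81,145,209),
  (18,82,146,210),(24,88,152,216),(25,89,153,217),(32,96,160,224),(33,97,161,225),(35,99,163,227),(40,104,168,232),(41,105,169,233),(48,112,176,240),
  (49,53,57,61),(49,113,177,241),(50,114,178,242),(51,115,179,243),(56,120,184,248),(57,121,185,249),(64,65,66,67),(64,80,96,112),(65,81,97,113),
  (66,82,98,114),(67,83,99,115),(72,73,74,75),(72,88,104,120),(73,89,105,121),(74,90,106,122),(112,113,114,115),(112,116,120,124),(128,132,136,140),
  (128,144,160,176),(129,145,161,177),(131,147,163,179),(132,133,134,135),(136,152,168,184),(137,153,169,185),(160,161,162,163),(192,196,200,204),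
  (192,208,224,240),(193,209,225,241),(200,216,232,248),(201,217,233,249),(208,212,216,220),(240,241,242,243),(260,276,292,308),(261,277,293,309),
  (261,325,389,453),(262,278,294,310),(263,279,295,311),(263,327,391,455),(267,283,299,315),(267,331,395,459),(271,335,399,463),(273,277,281,285),
  (275,279,283,287),(275,339,403,467),(276,277,278,279),(276,340,404,468),(277,341,405,469),(278,342,406,470),(279,343,407,471),(280,281,282,283),
  (281,345,409,473),(283,347,411,475),(287,351,415,479),(289,293,297,301),(291,295,299,303),(292,293,294,295),(292,356,420,484),(293,357,421,485),
  (294,358,422,486),(295,359,423,487),(296,360,424,488),(297,361,425,489),(299,363,427,491),(303,367,431,495),(305,309,313,317),(307,311,315,319),
  (308,309,310,311),(308,372,436,500),(309,373,437,501),(310,374,438,502),(311,375,439,503)] :: (nat \<times> nat \<times> nat \<times> nat) list)"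

definition "pos4_1 = ([(313,377,441,505),(314,378,442,506),(315,379,443,507),(319,383,447,511),(324,325,326,327),(324,340,356,372),(325,341,357,373),(326,342,358,374),
  (327,343,359,375),(329,345,361,377),(331,347,363,379),(335,351,367,383),(339,343,347,351),(355,359,363,367),(370,374,378,382),(371,375,379,383),
  (372,373,374,375),(387,391,395,399),(389,405,421,437),(391,407,423,439),(393,409,425,441),(395,411,427,443),(403,407,411,415),(408,409,410,411),
  (419,423,427,431),(420,421,422,423),(435,439,443,447),(436,437,438,439),(440,441,442,443),(452,453,454,455),(452,468,484,500),(453,469,485,501),
  (455,471,487,503),(457,473,489,505),(459,475,491,507),(483,487,491,495),(484,485,486,487),(499,503,507,511),(500,501,502,503),(504,505,506,507),
  (514,518,522,526),(518,534,550,566),(522,538,554,570),(522,586,650,714),(524,525,526,527),(524,540,556,572),(524,588,652,716),(525,541,557,573),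
  (525,589,653,717),(526,542,558,574),(526,590,654,718),(527,591,655,719),(530,534,538,542),(530,594,658,722),(532,533,534,535),(534,598,662,726),
  (536,537,538,539),(536,600,664,728),(538,602,666,730),(540,541,542,543),(540,604,668,732),(541,605,669,733),(542,606,670,734),(546,610,674,738),
  (550,614,678,742),(554,618,682,746),(556,557,558,559),(556,620,684,748),(557,621,685,749),(558,622,686,750),(562,566,570,574),(564,565,566,567),
  (566,630,694,758),(570,634,698,762),(572,573,574,575),(572,636,700,764),(573,637,701,765),(574,638,702,766),(582,598,614,630),(586,602,618,634),
  (588,604,620,636),(589,605,621,637),(590,606,622,638),(592,593,594,595),(594,598,602,606),(600,601,602,603),(604,605,606,607),(610,614,618,622),
  (616,617,618,619),(620,621,622,623),(626,630,634,638),(636,637,638,639),(642,658,674,690),(646,662,678,694),(648,664,680,696),(650,666,682,698),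
  (652,668,684,700),(653,669,685,701),(654,670,686,702),(668,669,670,671)] :: (nat \<times> nat \<times> nat \<times> nat) list)"

definition "pos4_2 = ([(672,676,680,684),(674,678,682,686),(690,694,698,702),(700,701,702,703),(710,726,742,758),(714,730,746,762),(716,717,718,719),(716,732,748,764),
  (717,733,749,765),(718,734,750,766),(721,725,729,733),(722,726,730,734),(728,729,730,731),(732,733,734,735),(736,740,744,748),(738,742,746,750),
  (744,745,746,747),(752,756,760,764),(754,758,762,766),(760,761,762,763),(764,765,766,767)] :: (nat \<times> nat \<times> nat \<times> nat) list)"

definition "neg3 = [neg3_0, neg3_1, neg3_2, neg3_3, neg3_4, neg3_5, neg3_6, neg3_7, neg3_8, neg3_9, neg3_10, neg3_11, neg3_12, neg3_13, neg3_14]"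
definition "neg2 = [neg2_0, neg2_1, neg2_2, neg2_3, neg2_4, neg2_5]"
definition "pos4 = [pos4_0, pos4_1, pos4_2]"

lemma certificate:
  assumes 3: "list_all (list_all (\<lambda>(i, j, k). \<not> x i \<or> \<not> x j \<or> \<not> x k)) neg3"
    and 2: "list_all (list_all (\<lambda>(i, j). \<not> x i \<or> \<not> x j)) neg2"
    and 4: "list_all (list_all (\<lambda>(i, j, k, l). x i \<or> x j \<or> x k \<or> x l)) pos4"
  shows False
  using 3[unfolded neg3_def neg3_0_def neg3_1_def neg3_2_def neg3_3_def neg3_4_def neg3_5_def neg3_6_def neg3_7_def neg3_8_def neg3_9_def neg3_10_def neg3_11_def neg3_12_def neg3_13_def neg3_14_def list.pred_inject prod.case]
    2[unfolded neg2_def neg2_0_def neg2_1_def neg2_2_def neg2_3_def neg2_4_def neg2_5_def list.pred_inject prod.case]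
    4[unfolded pos4_def pos4_0_def pos4_1_def pos4_2_def list.pred_inject prod.case]
  by sat

text \<open>Three words that differ everywhere have only one possible fourth row, namely their sum.
  The clause is justified if that row belongs to \<open>twisted\<close>.\<close>

definition neg3_ok :: "nat \<times> nat \<times> nat \<Rightarrow> bool" where
  "neg3_ok = (\<lambda>(i, j, k). i div 256 = 0 \<and> j div 256 = 1 \<and> k div 256 = 2 \<and>
     (let a = digit (i div 64); b = digit (i div 16); c = digit (i div 4); d = digit i;
          a' = digit (j div 64); b' = digit (j div 16); c' = digit (j div 4); d' = digit j;
          a'' = digit (k div 64); b'' = digit (k div 16); c'' = digit (k div 4); d'' = digit k
      in distinct [a, a', a''] \<and> distinct [b, b', b''] \<and> distinct [c, c', c''] \<and> distinct [d, d', d''] \<and>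
        twisted (a \<oplus> a' \<oplus> a'') (b \<oplus> b' \<oplus> b'') (c \<oplus> c' \<oplus> c'') (d \<oplus> d' \<oplus> d'')))"

text \<open>112 is the cell \<open>(c1, c3, c0, c0)\<close>: the four pairs
  \<open>(i, i + 112)\<close> deny the conclusion of \<open>twisted_family\<close>, one for each
  last letter.\<close>

definition neg2_ok :: "nat \<times> nat \<Rightarrow> bool" where
  "neg2_ok = (\<lambda>(i, j). line_ok i j \<or> i < 4 \<and> j = i + 112)"

lemma neg3_0_ok: "list_all neg3_ok neg3_0"
  unfolding neg3_0_def list.pred_inject prod.case neg3_ok_def by (simp add: Let_def neg3_ok_def digit_def twisted_def add4_def twist_def xor_def)

lemma neg3_1_ok: "list_all neg3_ok neg3_1"
  unfolding neg3_1_def list.pred_inject prod.case neg3_ok_def by (simp add: Let_def neg3_ok_def digit_def twisted_def add4_def twist_def xor_def)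

lemma neg3_2_ok: "list_all neg3_ok neg3_2"
  unfolding neg3_2_def list.pred_inject prod.case neg3_ok_def by (simp add: Let_def neg3_ok_def digit_def twisted_def add4_def twist_def xor_def)

lemma neg3_3_ok: "list_all neg3_ok neg3_3"
  unfolding neg3_3_def list.pred_inject prod.case neg3_ok_def by (simp add: Let_def neg3_ok_def digit_def twisted_def add4_def twist_def xor_def)

lemma neg3_4_ok: "list_all neg3_ok neg3_4"
  unfolding neg3_4_def list.pred_inject prod.case neg3_ok_def by (simp add: Let_def neg3_ok_def digit_def twisted_def add4_def twist_def xor_def)

lemma neg3_5_ok: "list_all neg3_ok neg3_5"
  unfolding neg3_5_def list.pred_inject prod.case neg3_ok_def by (simp add: Let_def neg3_ok_def digit_def twisted_def add4_def twist_def xor_def)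

lemma neg3_6_ok: "list_all neg3_ok neg3_6"
  unfolding neg3_6_def list.pred_inject prod.case neg3_ok_def by (simp add: Let_def neg3_ok_def digit_def twisted_def add4_def twist_def xor_def)

lemma neg3_7_ok: "list_all neg3_ok neg3_7"
  unfolding neg3_7_def list.pred_inject prod.case neg3_ok_def by (simp add: Let_def neg3_ok_def digit_def twisted_def add4_def twist_def xor_def)

lemma neg3_8_ok: "list_all neg3_ok neg3_8"
  unfolding neg3_8_def list.pred_inject prod.case neg3_ok_def by (simp add: Let_def neg3_ok_def digit_def twisted_def add4_def twist_def xor_def)

lemma neg3_9_ok: "list_all neg3_ok neg3_9"
  unfolding neg3_9_def list.pred_inject prod.case neg3_ok_def by (simp add: Let_def neg3_ok_def digit_def twisted_def add4_def twist_def xor_def)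

lemma neg3_10_ok: "list_all neg3_ok neg3_10"
  unfolding neg3_10_def list.pred_inject prod.case neg3_ok_def by (simp add: Let_def neg3_ok_def digit_def twisted_def add4_def twist_def xor_def)

lemma neg3_11_ok: "list_all neg3_ok neg3_11"
  unfolding neg3_11_def list.pred_inject prod.case neg3_ok_def by (simp add: Let_def neg3_ok_def digit_def twisted_def add4_def twist_def xor_def)

lemma neg3_12_ok: "list_all neg3_ok neg3_12"
  unfolding neg3_12_def list.pred_inject prod.case neg3_ok_def by (simp add: Let_def neg3_ok_def digit_def twisted_def add4_def twist_def xor_def)

lemma neg3_13_ok: "list_all neg3_ok neg3_13"
  unfolding neg3_13_def list.pred_inject prod.case neg3_ok_def by (simp add: Let_def neg3_ok_def digit_def twisted_def add4_def twist_def xor_def)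

lemma neg3_14_ok: "list_all neg3_ok neg3_14"
  unfolding neg3_14_def list.pred_inject prod.case neg3_ok_def by (simp add: Let_def neg3_ok_def digit_def twisted_def add4_def twist_def xor_def)

lemma neg3_ok: "list_all (list_all neg3_ok) neg3"
  by (simp add: neg3_def neg3_0_ok neg3_1_ok neg3_2_ok neg3_3_ok neg3_4_ok neg3_5_ok neg3_6_ok neg3_7_ok neg3_8_ok neg3_9_ok neg3_10_ok neg3_11_ok neg3_12_ok neg3_13_ok neg3_14_ok)

lemma neg2_0_ok: "list_all neg2_ok neg2_0"
  unfolding neg2_0_def list.pred_inject prod.case neg2_ok_def by (simp add: Let_def neg2_ok_def line_ok_def)

lemma neg2_1_ok: "list_all neg2_ok neg2_1"
  unfolding neg2_1_def list.pred_inject prod.case neg2_ok_def by (simp add: Let_def neg2_ok_def line_ok_def)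

lemma neg2_2_ok: "list_all neg2_ok neg2_2"
  unfolding neg2_2_def list.pred_inject prod.case neg2_ok_def by (simp add: Let_def neg2_ok_def line_ok_def)

lemma neg2_3_ok: "list_all neg2_ok neg2_3"
  unfolding neg2_3_def list.pred_inject prod.case neg2_ok_def by (simp add: Let_def neg2_ok_def line_ok_def)

lemma neg2_4_ok: "list_all neg2_ok neg2_4"
  unfolding neg2_4_def list.pred_inject prod.case neg2_ok_def by (simp add: Let_def neg2_ok_def line_ok_def)

lemma neg2_5_ok: "list_all neg2_ok neg2_5"
  unfolding neg2_5_def list.pred_inject prod.case neg2_ok_def by (simp add: Let_def neg2_ok_def line_ok_def)

lemma neg2_ok: "list_all (list_all neg2_ok) neg2"
  by (simp add: neg2_def neg2_0_ok neg2_1_ok neg2_2_ok neg2_3_ok neg2_4_ok neg2_5_ok)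

lemma pos4_0_ok: "list_all pos4_ok pos4_0"
  unfolding pos4_0_def list.pred_inject prod.case pos4_ok_def by (simp add: Let_def pos4_ok_def)

lemma pos4_1_ok: "list_all pos4_ok pos4_1"
  unfolding pos4_1_def list.pred_inject prod.case pos4_ok_def by (simp add: Let_def pos4_ok_def)

lemma pos4_2_ok: "list_all pos4_ok pos4_2"
  unfolding pos4_2_def list.pred_inject prod.case pos4_ok_def by (simp add: Let_def pos4_ok_def)

lemma pos4_ok: "list_all (list_all pos4_ok) pos4"
  by (simp add: pos4_def pos4_0_ok pos4_1_ok pos4_2_ok)

text \<open>One position is enough here, because the symmetries of \<open>twisted\<close> will carry
  it to all other triples of letters.\<close>

lemma twisted_family:
  assumes R: "code4 R2" "code4 R3" "code4 R4"
    and nt: "\<And>a1 b1 v1 d1 a2 b2 v2 d2 a3 b3 v3 d3 a4 b4 v4 d4. twisted a1 b1 v1 d1 \<Longrightarrow>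
      R2 a2 b2 v2 d2 \<Longrightarrow> R3 a3 b3 v3 d3 \<Longrightarrow> R4 a4 b4 v4 d4 \<Longrightarrow> distinct [a1, a2, a3, a4] \<Longrightarrow>
      distinct [b1, b2, b3, b4] \<Longrightarrow> distinct [v1, v2, v3, v4] \<Longrightarrow> distinct [d1, d2, d3, d4] \<Longrightarrow> False"
  shows "\<exists>d. R2 c0 c0 c0 d \<and> R2 c1 c3 c0 d"
proof (rule ccontr)
  assume no: "\<not> ?thesis"
  define x where "x n = (if n div 256 = 0 then cell R2 n else if n div 256 = 1 then cell R3 n else cell R4 n)" for n
  have line: "\<not> x i \<or> \<not> x j" if "line_ok i j" for i j
    using code4_line[OF R(1) that] code4_line[OF R(2) that] code4_line[OF R(3) that] that
    by (auto simp: x_def line_ok_def)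
  have "\<not> x i \<or> \<not> x j \<or> \<not> x k" if "neg3_ok (i, j, k)" for i j k
  proof -
    note ok = that[unfolded neg3_ok_def prod.case Let_def]
    note * = ok[THEN conjunct1] ok[THEN conjunct2, THEN conjunct1] ok[THEN conjunct2, THEN conjunct2, THEN conjunct1]
    note d = ok[THEN conjunct2, THEN conjunct2, THEN conjunct2, THEN conjunct1] ok[THEN conjunct2, THEN conjunct2, THEN conjunct2, THEN conjunct2, THEN conjunct1] ok[THEN conjunct2, THEN conjunct2, THEN conjunct2, THEN conjunct2, THEN conjunct2, THEN conjunct1] ok[THEN conjunct2, THEN conjunct2, THEN conjunct2, THEN conjunct2, THEN conjunct2, THEN conjunct2, THEN conjunct1]
    show ?thesis
    proof (rule ccontr)
      assume "\<not> ?thesis"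
      then have "cell R2 i" "cell R3 j" "cell R4 k" using * by (auto simp: x_def)
      note c = this[unfolded cell_def]
      show False
        by (rule nt[OF ok[THEN conjunct2, THEN conjunct2, THEN conjunct2, THEN conjunct2, THEN conjunct2, THEN conjunct2, THEN conjunct2] c xor3_distinct[OF d(1)] xor3_distinct[OF d(2)] xor3_distinct[OF d(3)] xor3_distinct[OF d(4)]])
    qed
  qed
  moreover have "\<not> x i \<or> \<not> x j" if "neg2_ok (i, j)" for i j
  proof (cases "line_ok i j")
    case False
    then have ij: "i < 4" "j = i + 112" using that by (auto simp: neg2_ok_def)
    then have "i = 0 \<or> i = 1 \<or> i = 2 \<or> i = 3" by linarith
    then have "cell R2 i = R2 c0 c0 c0 (digit i)" "cell R2 j = R2 c1 c3 c0 (digit i)"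
      using ij by (auto simp: cell_def digit_def)
    moreover have "x i = cell R2 i" "x j = cell R2 j" using ij by (auto simp: x_def)
    ultimately show ?thesis using no by blast
  qed (rule line)
  moreover have "x i \<or> x j \<or> x k \<or> x l" if "pos4_ok (i, j, k, l)" for i j k l
  proof -
    have "i div 256 = j div 256 \<and> i div 256 = k div 256 \<and> i div 256 = l div 256"
      using that unfolding pos4_ok_def prod.case by (elim conjE, intro conjI)
    then show ?thesis
      using code4_pos[OF R(1) that] code4_pos[OF R(2) that] code4_pos[OF R(3) that] by (simp add: x_def)
  qed
  ultimately have *: "\<And>t. neg3_ok t \<Longrightarrow> (\<lambda>(i, j, k). \<not> x i \<or> \<not> x j \<or> \<not> x k) t"
    "\<And>t. neg2_ok t \<Longrightarrow> (\<lambda>(i, j). \<not> x i \<or> \<not> x j) t"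
    "\<And>t. pos4_ok t \<Longrightarrow> (\<lambda>(i, j, k, l). x i \<or> x j \<or> x k \<or> x l) t"
    by (simp_all only: split_paired_all prod.case)
  have nested: "list_all (list_all P) xs \<Longrightarrow> (\<And>t. P t \<Longrightarrow> Q t) \<Longrightarrow> list_all (list_all Q) xs" for P Q xs
    by (auto simp: list_all_iff)
  show False
    by (rule certificate[OF nested[OF neg3_ok *(1)] nested[OF neg2_ok *(2)] nested[OF pos4_ok *(3)]])
qed

section \<open>Affine labels and the normal form of quaternary codes that are not semilinear\<close>

definition aff :: "q \<Rightarrow> q \<Rightarrow> q \<Rightarrow> q \<Rightarrow> q" where
  "aff u \<alpha> \<beta> v = u \<oplus> (if fst v then \<alpha> else c0) \<oplus> (if snd v then \<beta> else c0)"

lemma xor_ground: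
  "c1 \<oplus> c2 = c3" "c2 \<oplus> c1 = c3" "c1 \<oplus> c3 = c2" "c3 \<oplus> c1 = c2" "c2 \<oplus> c3 = c1" "c3 \<oplus> c2 = c1"
  by (simp_all add: xor_def)

lemma xor_xor_left: "a \<oplus> (a \<oplus> b) = b"
  by (simp flip: xor_assoc)

lemma xor_eq_right: "a \<oplus> b = b \<longleftrightarrow> a = c0"
  by (metis xor_commute xor_simps(5))

lemma aff_simps:
  "aff u \<alpha> \<beta> c0 = u" "aff u \<alpha> \<beta> c1 = u \<oplus> \<alpha>"
  "aff u \<alpha> \<beta> (v \<oplus> c1) = aff u \<alpha> \<beta> v \<oplus> \<alpha>" "aff u \<alpha> \<beta> (v \<oplus> c2) = aff u \<alpha> \<beta> v \<oplus> \<beta>"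
  "aff u \<alpha> \<beta> (v \<oplus> c3) = aff u \<alpha> \<beta> v \<oplus> (\<alpha> \<oplus> \<beta>)"
  by (rule q_exhaust[of v]; simp add: aff_def xor_ground xor_xor_left xor_ac)+

lemma bij_aff:
  assumes "\<alpha> \<noteq> c0" "\<beta> \<noteq> c0" "\<alpha> \<noteq> \<beta>"
  shows "bij (aff u \<alpha> \<beta>)"
proof -
  have "\<alpha> \<oplus> \<beta> \<noteq> c0" using assms(3) by (metis xor_simps(3,8))
  moreover have "aff u \<alpha> \<beta> v = aff u \<alpha> \<beta> w \<longleftrightarrow> aff c0 \<alpha> \<beta> v = aff c0 \<alpha> \<beta> w" for v w
    unfolding aff_def xor_assoc by simp
  ultimately have "inj (aff u \<alpha> \<beta>)"
    using assms by (intro injI) (auto simp: aff_def xor_eq_right split: if_splits)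
  then show ?thesis by (simp add: bij_def finite_UNIV_inj_surj)
qed

text \<open>The layers with last letter \<open>r\<close> and with first letter \<open>v\<close> have
  translations that disagree at both shared coordinates. Hence affine labels can turn both into
  standard ones at once. \<open>nfd\<close> and \<open>nfa\<close> exclude the affine forms of the
  two layers, which leaves the layers of \<open>twisted\<close> and so one of the two
  completions.\<close>

lemma twisted_labels:
  assumes P: "code4 P"
    and gab: "\<And>a b c. P a b c r \<Longrightarrow> P (a \<oplus> gi) (b \<oplus> gj) c r"
    and gbc: "\<And>a b c. P a b c r \<Longrightarrow> P a (b \<oplus> gj) (c \<oplus> gk) r"
    and nbc: "\<And>b c d. P v b c d \<Longrightarrow> P v (b \<oplus> nj) (c \<oplus> nk) d"
    and ncd: "\<And>b c d. P v b c d \<Longrightarrow> P v b (c \<oplus> nk) (d \<oplus> nl)"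
    and nz: "gi \<noteq> c0" "gj \<noteq> c0" "gk \<noteq> c0" "nj \<noteq> c0" "nk \<noteq> c0" "nl \<noteq> c0" "gj \<noteq> nj" "gk \<noteq> nk"
    and nfd: "\<And>ei ej ek. ei \<noteq> c0 \<Longrightarrow> ei \<noteq> gi \<Longrightarrow> ej \<noteq> c0 \<Longrightarrow> ej \<noteq> gj \<Longrightarrow> ek \<noteq> c0 \<Longrightarrow> ek \<noteq> gk \<Longrightarrow>
      (\<And>a b c. P a b c r \<Longrightarrow> P (a \<oplus> ei) (b \<oplus> ej) c r) \<Longrightarrow>
      (\<And>a b c. P a b c r \<Longrightarrow> P a (b \<oplus> ej) (c \<oplus> ek) r) \<Longrightarrow> False"
    and nfa: "\<And>e. e \<noteq> c0 \<Longrightarrow> (\<And>b c d. P v b c d \<Longrightarrow> P v (b \<oplus> gj) (c \<oplus> gk) d) \<Longrightarrow>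
      (\<And>b c d. P v b c d \<Longrightarrow> P v b (c \<oplus> gk) (d \<oplus> e)) \<Longrightarrow> False"
  shows "\<exists>f g h k. bij f \<and> bij g \<and> bij h \<and> bij k \<and>
    ((\<forall>a b c d. P (f a) (g b) (h c) (k d) = twisted a b c d) \<or>
     (\<forall>a b c d. P (f a) (g b) (h c) (k d) = twisted a (swap23 c) (swap23 b) d))"
proof -
  note u = code4_unique[OF P]
  define pj pk where "pj = nj \<oplus> gj" and "pk = nk \<oplus> gk"
  have p: "pj \<noteq> c0" "pk \<noteq> c0" "pj \<noteq> gj" "pk \<noteq> nk" "pj \<oplus> gj = nj" "pk \<oplus> nk = gk" "pk \<noteq> gk"
  proof -
    show "pj \<noteq> c0" "pk \<noteq> c0" using nz(7,8) unfolding pj_def pk_def by (metis xor_simps(3,8))+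
    show "pj \<noteq> gj" "pk \<noteq> nk" "pk \<noteq> gk" using nz(3,4,5) unfolding pj_def pk_def by (metis xor_simps(5) xor_commute)+
    show "pj \<oplus> gj = nj" "pk \<oplus> nk = gk" unfolding pj_def pk_def by (metis xor_simps(4) xor_commute)+
  qed
  obtain \<kappa> where \<kappa>: "P v c0 \<kappa> r" using code4_ex1(3)[OF P] by blast
  define uk where "uk = \<kappa> \<oplus> pk"
  obtain w where w: "P w c0 uk r" using code4_ex1(1)[OF P] by blast
  define hi where "hi = v \<oplus> w"
  have w_hi: "w = v \<oplus> hi" unfolding hi_def by (simp flip: xor_assoc)
  obtain w' where w': "P v c0 uk w'" using code4_ex1(4)[OF P] by blast
  define hl where "hl = r \<oplus> w'"
  have w_hl: "w' = r \<oplus> hl" unfolding hl_def by (simp flip: xor_assoc)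
  have uk: "uk \<noteq> \<kappa>" "uk \<oplus> pk = \<kappa>" "uk \<noteq> \<kappa> \<oplus> gk" "uk \<noteq> \<kappa> \<oplus> nk" using p unfolding uk_def by simp_all
  have hi: "hi \<noteq> c0" "hi \<noteq> gi"
  proof -
    show "hi \<noteq> c0" using u(3)[OF \<kappa>, of uk] w uk(1) unfolding w_hi by auto
    have "P (v \<oplus> gi) c0 (\<kappa> \<oplus> gk) r" using gbc[OF gab[OF \<kappa>]] by simp
    then show "hi \<noteq> gi" using u(3)[of "v \<oplus> gi" c0 "\<kappa> \<oplus> gk" r uk] w uk(3) unfolding w_hi by auto
  qed
  have hl: "hl \<noteq> c0" "hl \<noteq> nl"
  proof -
    show "hl \<noteq> c0" using u(3)[OF \<kappa>, of uk] w' uk(1) unfolding w_hl by auto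
    have "P v c0 (\<kappa> \<oplus> nk) (r \<oplus> nl)" using ncd[OF \<kappa>] .
    then show "hl \<noteq> nl" using u(3)[of v c0 "\<kappa> \<oplus> nk" "r \<oplus> nl" uk] w' uk(4) unfolding w_hl by auto
  qed
  \<comment> \<open>At the second coordinate \<open>c2\<close> stands for \<open>gj\<close> and
    \<open>c3\<close> for \<open>nj\<close>, at the third \<open>c2\<close> for \<open>nk\<close>
    and \<open>c3\<close> for \<open>gk\<close>; this is possible as the translations disagree
    there. \<open>uk\<close>, \<open>hi\<close> and \<open>hl\<close> were chosen so that the three
    words \<open>base\<close> of \<open>normalized_layers\<close> are codewords.\<close>
  define f g h k where "f = aff v hi gi" and "g = aff c0 pj gj" and "h = aff uk pk nk" and "k = aff r hl nl"
  note defs = f_def g_def h_def k_def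
  have bijs: "bij f" "bij g" "bij h" "bij k"
    unfolding defs using hi hl p nz by (auto intro!: bij_aff)
  define R where "R a b c d = P (f a) (g b) (h c) (k d)" for a b c d
  have R: "code4 R" unfolding R_def by (rule code4_relabel[OF P bijs])
  have f0: "f c0 = v" and k0: "k c0 = r" and g0: "g c0 = c0" and h0: "h c0 = uk"
    and fs: "f (x \<oplus> c1) = f x \<oplus> hi" "f (x \<oplus> c2) = f x \<oplus> gi"
    and gs: "g (x \<oplus> c1) = g x \<oplus> pj" "g (x \<oplus> c2) = g x \<oplus> gj" "g (x \<oplus> c3) = g x \<oplus> nj"
    and hs: "h (x \<oplus> c1) = h x \<oplus> pk" "h (x \<oplus> c2) = h x \<oplus> nk" "h (x \<oplus> c3) = h x \<oplus> gk"
    and ks: "k (x \<oplus> c1) = k x \<oplus> hl" "k (x \<oplus> c2) = k x \<oplus> nl" "k (x \<oplus> c3) = k x \<oplus> (hl \<oplus> nl)" for x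
    unfolding defs aff_simps p(5,6) by simp_all
  have inv: "f (inv f x) = x" "g (inv g x) = x" "h (inv h x) = x" "k (inv k x) = x" for x
    using bijs by (simp_all add: bij_is_surj surj_f_inv_f)
  have "(\<forall>a b c. R a b c c0 = twisted a b c c0) \<and> (\<forall>b c d. R c0 b c d = twisted c0 b c d)"
  proof (rule normalized_layers[OF R])
    show "R (a \<oplus> c2) (b \<oplus> c2) c c0" "R a (b \<oplus> c2) (c \<oplus> c3) c0" if "R a b c c0" for a b c
      using that gab gbc unfolding R_def fs gs hs k0 by blast+
    show "R c0 (b \<oplus> c3) (c \<oplus> c2) d" "R c0 b (c \<oplus> c2) (d \<oplus> c2)" if "R c0 b c d" for b c d
      using that nbc ncd unfolding R_def gs hs ks f0 by blast+
    have "h c1 = \<kappa>" "f c1 = w" "k c1 = w'" using hs(1)[of c0] fs(1)[of c0] ks(1)[of c0] uk(2) h0 f0 k0 w_hi w_hl by simp_all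
    then show "R c0 c0 c1 c0" "R c1 c0 c0 c0" "R c0 c0 c0 c1"
      unfolding R_def f0 g0 h0 k0 using \<kappa> w w' by simp_all
  next
    fix F assume F: "\<And>a b c. R a b c c0 = (c = c1 \<oplus> F a \<oplus> F b)" "\<And>v. F (v \<oplus> c1) = F v \<oplus> c1"
    have Rab: "R (a \<oplus> c1) (b \<oplus> c1) c c0" and Rbc: "R a (b \<oplus> c1) (c \<oplus> c1) c0" if "R a b c c0" for a b c
      using that unfolding F by (simp_all add: xor_ac)
    have "P (a \<oplus> hi) (b \<oplus> pj) c r" "P a (b \<oplus> pj) (c \<oplus> pk) r" if "P a b c r" for a b c
      using Rab[of "inv f a" "inv g b" "inv h c"] Rbc[of "inv f a" "inv g b" "inv h c"] that
      unfolding R_def fs gs hs k0 inv by simp_all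
    then show False by (rule nfd[OF hi p(1,3,2,7)])
  next
    fix F assume F: "\<And>b c d. R c0 b c d = (d = c1 \<oplus> F b \<oplus> c)" "\<And>v. F (v \<oplus> c2) = F v \<oplus> c3"
    have Rbc: "R c0 (b \<oplus> c2) (c \<oplus> c3) d" and Rcd: "R c0 b (c \<oplus> c3) (d \<oplus> c3)" if "R c0 b c d" for b c d
      using that unfolding F by (simp_all add: xor_ac)
    have "P v (b \<oplus> gj) (c \<oplus> gk) d" "P v b (c \<oplus> gk) (d \<oplus> (hl \<oplus> nl))" if "P v b c d" for b c d
      using Rbc[of "inv g b" "inv h c" "inv k d"] Rcd[of "inv g b" "inv h c" "inv k d"] that
      unfolding R_def f0 gs hs ks inv by simp_all
    moreover have "hl \<oplus> nl \<noteq> c0" using hl(2) by (metis xor_simps(3,8))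
    ultimately show False using nfa by blast
  qed
  then have "(\<forall>a b c d. R a b c d = twisted a b c d) \<or> (\<forall>a b c d. R a b c d = twisted a (swap23 c) (swap23 b) d)"
    by (intro twisted_layers[OF R]) blast+
  then show ?thesis unfolding R_def using bijs by blast
qed

definition quad :: "'i \<Rightarrow> 'i \<Rightarrow> 'i \<Rightarrow> 'i \<Rightarrow> q \<Rightarrow> q \<Rightarrow> q \<Rightarrow> q \<Rightarrow> 'i \<Rightarrow> q" where
  "quad i j k l a b c d = (\<lambda>_. c0)(i := a, j := b, k := c, l := d)"

lemma code4_quad:
  assumes M: "mds {i, j, k, l} N" and d: "distinct [i, j, k, l]"
  shows "code4 (\<lambda>a b c d. N (quad i j k l a b c d))"
proof -
  have ex1: "\<exists>!v. N (x(m := v))" if "m \<in> {i, j, k, l}" for m x using M that unfolding mds_def by blast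
  have "\<exists>!a. N (quad i j k l a b c d)" "\<exists>!b. N (quad i j k l a b c d)" "\<exists>!c. N (quad i j k l a b c d)"
    "\<exists>!d. N (quad i j k l a b c d)" for a b c d
  proof -
    have *: "quad i j k l a b c d = (quad i j k l c0 b c d)(i := a)" "quad i j k l a b c d = (quad i j k l a c0 c d)(j := b)"
      "quad i j k l a b c d = (quad i j k l a b c0 d)(k := c)" "quad i j k l a b c d = (quad i j k l a b c c0)(l := d)" for a b c d
      unfolding quad_def using d by (auto simp: fun_eq_iff)
    show "\<exists>!a. N (quad i j k l a b c d)" by (subst *(1)) (rule ex1, simp)
    show "\<exists>!b. N (quad i j k l a b c d)" by (subst *(2)) (rule ex1, simp)
    show "\<exists>!c. N (quad i j k l a b c d)" by (subst *(3)) (rule ex1, simp)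
    show "\<exists>!d. N (quad i j k l a b c d)" by (subst *(4)) (rule ex1, simp)
  qed
  then show ?thesis unfolding code4_def by blast
qed

text \<open>Both are translations of the subcode in which \<open>m\<close> and \<open>m'\<close> are
  fixed, and there one value determines the others.\<close>

lemma layer_invariants_agree:
  assumes N: "mds T N" and T: "m \<in> T" "m' \<in> T" "m \<noteq> m'" "p \<in> T - {m, m'}" "p' \<in> T - {m, m'}"
    and inv: "invariant (T - {m}) (subcode m v N) a" "invariant (T - {m'}) (subcode m' u N) b" and eq: "a p = b p"
  shows "a p' = b p'"
proof -
  have D: "T - {m} - {m'} = T - {m, m'}" "T - {m'} - {m} = T - {m, m'}" by auto
  have M: "mds (T - {m, m'}) (subcode m' u (subcode m v N))"
    using mds_subcode[OF mds_subcode[OF N]] unfolding D(1)[symmetric] by blast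
  have a: "invariant (T - {m, m'}) (subcode m' u (subcode m v N)) a"
    using invariant_subcode[OF inv(1)] unfolding D(1)[symmetric] by blast
  have "invariant (T - {m, m'}) (subcode m v (subcode m' u N)) b"
    using invariant_subcode[OF inv(2)] unfolding D(2)[symmetric] by blast
  then have b: "invariant (T - {m, m'}) (subcode m' u (subcode m v N)) b"
    by (simp only: subcode_commute[OF T(3)])
  show ?thesis by (rule invariant_unique[OF M a b T(4,5) eq])
qed

lemma invariant3I:
  assumes S: "S = {i, j, k}" "distinct [i, j, k]" and M: "\<And>x. M x \<longleftrightarrow> Q (x i) (x j) (x k)"
    and ab: "\<And>a b c. Q a b c \<Longrightarrow> Q (a \<oplus> \<beta> i) (b \<oplus> \<beta> j) c"
    and bc: "\<And>a b c. Q a b c \<Longrightarrow> Q a (b \<oplus> \<beta> j) (c \<oplus> \<beta> k)"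
  shows "invariant S M \<beta>"
proof (rule invariantI)
  fix x m m' assume m: "m \<in> S" "m' \<in> S" "m \<noteq> m'" and "M x"
  then have Q: "Q (x i) (x j) (x k)" using M by blast
  note Q = ab[OF Q] bc[OF Q] bc[OF ab[OF Q], unfolded xor_simps(4)]
  have d: "i \<noteq> j" "i \<noteq> k" "j \<noteq> k" using S(2) by auto
  consider "m = i" "m' = j" | "m = i" "m' = k" | "m = j" "m' = i" | "m = j" "m' = k" | "m = k" "m' = i" | "m = k" "m' = j"
    using m S(1) by auto
  then show "M (sh \<beta> m m' x)"
    by cases (use Q d d[symmetric] in \<open>simp_all add: M sh_apply\<close>)
qed

lemma quad_apply:
  assumes "distinct [i, j, k, l]"
  shows "quad i j k l a b c d i = a" "quad i j k l a b c d j = b" "quad i j k l a b c d k = c" "quad i j k l a b c d l = d"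
  using assms by (auto simp: quad_def)

text \<open>The code is not full, so some layer at a coordinate \<open>l\<close> is not full and has
  a unique nowhere zero translation \<open>g\<close>. If all layers at the other coordinates had
  translations extending \<open>g\<close>, these would glue to one of the whole code. So some layer
  at a coordinate \<open>i\<close> has a translation that conflicts with \<open>g\<close>, and then
  at both shared coordinates, as needed for \<open>twisted_labels\<close>.\<close>

lemma twisted_form:
  assumes N: "mds T N" and card: "card T = 4" and ns: "\<not> semilinear T N"
  shows "\<exists>i j k l \<phi>. T = {i, j, k, l} \<and> distinct [i, j, k, l] \<and> (\<forall>m. bij (\<phi> m)) \<and>
    (\<forall>x. N (\<lambda>m. \<phi> m (x m)) = twisted (x i) (x j) (x k) (x l))"
proof -
  have fT: "finite T" using mds_finite[OF N] .
  have "\<not> full T N" using ns unfolding full_def semilinear_def by blast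
  obtain t where t: "t \<in> T" using card by fastforce
  have "3 \<le> card T" using card by simp
  from full_if_squares_full[OF N t this] \<open>\<not> full T N\<close> obtain S r0 where S: "S \<subseteq> T" "card S = 3" and nf: "\<not> full S (restrict_code S r0 N)"
    by blast
  have "card (T - S) = 1" using S card fT by (simp add: card_Diff_subset finite_subset)
  then obtain l where l: "T - S = {l}" using card_1_singletonE by blast
  then have lT: "l \<in> T" and lS: "l \<notin> S" and TS: "T = insert l S" and Sl: "S = T - {l}" using S by blast+
  define r where "r = r0 l"
  have "restrict_code S r0 N = subcode l r N"
    unfolding restrict_code_def subcode_def r_def
    by (intro ext mds_agree[OF N]) (use TS lS in \<open>auto simp: override_on_def\<close>)
  then have nf: "\<not> full S (subcode l r N)" using nf by simp
  have mS: "mds S (subcode l r N)" using mds_subcode[OF N] Sl by metis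
  obtain g where g: "\<forall>m\<in>S. g m \<noteq> c0" "invariant S (subcode l r N) g"
    using square_semilinear[OF mS S(2)] unfolding semilinear_def by blast
  define good where "good m v n \<longleftrightarrow> invariant (T - {m}) (subcode m v N) n \<and> (\<forall>p\<in>T - {m}. n p \<noteq> c0) \<and> (\<forall>p\<in>S - {m}. n p = g p)" for m v n
  obtain i v where i: "i \<in> S" and bad: "\<And>n. \<not> good i v n"
  proof (rule ccontr)
    assume no: "\<not> thesis"
    have "\<forall>m\<in>S. \<forall>v. \<exists>n. good m v n" using no that by blast
    then obtain n where n: "\<And>m v. m \<in> S \<Longrightarrow> good m v (n m v)" by metis
    have third: "\<exists>p. p \<in> S \<and> p \<noteq> a \<and> p \<noteq> b" for a b
    proof (rule ccontr)
      assume "\<not> ?thesis"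
      then have "S \<subseteq> {a, b}" by blast
      then have "card S \<le> card {a, b}" by (intro card_mono) auto
      then show False using S(2) card_insert_le_m1[of 2 "{b}" a] by (cases "a = b") auto
    qed
    \<comment> \<open>Only the value at \<open>l\<close> is not prescribed by \<open>g\<close>.
      Different layers agree on it because they agree with \<open>g\<close> at a common
      coordinate.\<close>
    have eq: "n m v l = n m' u l" if m: "m \<in> S" "m' \<in> S" "m \<noteq> m'" for m m' v u
    proof -
      obtain p where p: "p \<in> S" "p \<noteq> m" "p \<noteq> m'" using third by blast
      have "n m v p = n m' u p" using n[OF m(1), of v] n[OF m(2), of u] p unfolding good_def by auto
      then show ?thesis
        using layer_invariants_agree[OF N _ _ m(3), of p l v "n m v" u "n m' u"] m p lT lS S n unfolding good_def by blast
    qed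
    obtain s where s: "s \<in> S" using third by blast
    have const: "n m v l = n s c0 l" if "m \<in> S" for m v
    proof (cases "m = s")
      case True
      obtain p where "p \<in> S" "p \<noteq> s" using third by blast
      then show ?thesis using eq[of s p v c0] eq[of s p c0 c0] s True by simp
    qed (use eq that s in blast)
    define \<alpha> where "\<alpha> = g(l := n s c0 l)"
    have agree: "n m v p = \<alpha> p" if "m \<in> S" "p \<in> T - {m}" for m v p
      using n[OF that(1), of v] const[OF that(1)] that(2) TS unfolding good_def \<alpha>_def by auto
    have "invariant T N \<alpha>"
    proof (rule invariantI)
      fix x p p' assume p: "p \<in> T" "p' \<in> T" "p \<noteq> p'" and x: "N x"
      obtain m where m: "m \<in> S" "m \<noteq> p" "m \<noteq> p'" using third by blast
      have "subcode m (x m) N x" using x by (simp add: subcode_def)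
      then have "subcode m (x m) N (sh (n m (x m)) p p' x)"
        using n[OF m(1), of "x m"] p m unfolding good_def by (blast intro: invariantD)
      moreover have "sh (n m (x m)) p p' x = sh \<alpha> p p' x" using agree[OF m(1)] p m by (intro sh_cong) auto
      moreover have "(sh \<alpha> p p' x)(m := x m) = sh \<alpha> p p' x" using m by (auto simp: sh_def fun_eq_iff)
      ultimately show "N (sh \<alpha> p p' x)" by (simp add: subcode_def)
    qed
    moreover have "\<forall>p\<in>T. \<alpha> p \<noteq> c0"
    proof
      fix p assume "p \<in> T"
      show "\<alpha> p \<noteq> c0"
      proof (cases "p = l")
        case True
        then show ?thesis using n[OF s, of c0] lT lS s unfolding \<alpha>_def good_def by auto
      next
        case False
        then show ?thesis using g(1) \<open>p \<in> T\<close> TS unfolding \<alpha>_def by simp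
      qed
    qed
    ultimately show False using ns unfolding semilinear_def by blast
  qed
  have il: "i \<noteq> l" "i \<in> T" using i lS S by auto
  have mi: "mds (T - {i}) (subcode i v N)" using mds_subcode[OF N] .
  have "card (T - {i}) = 3" using card il fT by simp
  then obtain n where n: "\<forall>p\<in>T - {i}. n p \<noteq> c0" "invariant (T - {i}) (subcode i v N) n"
    using square_semilinear[OF mi] unfolding semilinear_def by blast
  have "card (S - {i}) = 2" using S i finite_subset[OF S(1) fT] by simp
  then obtain j k where jk: "S - {i} = {j, k}" "j \<noteq> k" by (auto simp: card_2_iff)
  have Seq: "S = {i, j, k}" and Teq: "T = {i, j, k, l}" and dist: "distinct [i, j, k, l]"
    using jk i TS lS by auto
  have ne: "i \<noteq> j" "i \<noteq> k" "i \<noteq> l" "j \<noteq> k" "j \<noteq> l" "k \<noteq> l" using dist by auto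
  note ne = ne ne[symmetric]
  have agree: "n p' = g p'" if "n p = g p" "p \<in> {j, k}" "p' \<in> {j, k}" for p p'
    using layer_invariants_agree[OF N il(2) lT il(1), of p p' v n r g] n g that jk Sl Teq ne by auto
  have njk: "n j \<noteq> g j" "n k \<noteq> g k"
  proof -
    have "\<not> (n j = g j \<and> n k = g k)" using bad[of n] n jk unfolding good_def by auto
    then show "n j \<noteq> g j" "n k \<noteq> g k" using agree by blast+
  qed
  define P where "P a b c d = N (quad i j k l a b c d)" for a b c d
  have N_P: "N x \<longleftrightarrow> P (x i) (x j) (x k) (x l)" for x
    unfolding P_def by (rule mds_agree[OF N]) (use Teq in \<open>auto simp: quad_apply[OF dist]\<close>)
  have P: "code4 P" unfolding P_def by (rule code4_quad) (use N Teq dist in auto)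
  have Nl: "subcode l r N x \<longleftrightarrow> P (x i) (x j) (x k) r" for x unfolding subcode_def N_P using ne by simp
  have Ni: "subcode i v N x \<longleftrightarrow> P v (x j) (x k) (x l)" for x unfolding subcode_def N_P using ne by simp
  have gS: "P a b c r \<Longrightarrow> P (a \<oplus> g i) (b \<oplus> g j) c r" "P a b c r \<Longrightarrow> P a (b \<oplus> g j) (c \<oplus> g k) r" for a b c
    using invariantD[OF g(2), of i j "quad i j k l a b c r"] invariantD[OF g(2), of j k "quad i j k l a b c r"] Seq ne
    unfolding Nl by (simp_all add: sh_apply quad_apply[OF dist])
  have nT: "P v b c d \<Longrightarrow> P v (b \<oplus> n j) (c \<oplus> n k) d" "P v b c d \<Longrightarrow> P v b (c \<oplus> n k) (d \<oplus> n l)" for b c d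
    using invariantD[OF n(2), of j k "quad i j k l v b c d"] invariantD[OF n(2), of k l "quad i j k l v b c d"] Teq ne
    unfolding Ni by (simp_all add: sh_apply quad_apply[OF dist])
  have "\<exists>f g h k. bij f \<and> bij g \<and> bij h \<and> bij k \<and>
    ((\<forall>a b c d. P (f a) (g b) (h c) (k d) = twisted a b c d) \<or>
     (\<forall>a b c d. P (f a) (g b) (h c) (k d) = twisted a (swap23 c) (swap23 b) d))"
  proof (rule twisted_labels[OF P gS nT])
    show "g i \<noteq> c0" "g j \<noteq> c0" "g k \<noteq> c0" "n j \<noteq> c0" "n k \<noteq> c0" "n l \<noteq> c0" "g j \<noteq> n j" "g k \<noteq> n k"
      using g(1) n(1) njk Seq Teq ne by auto
  next
    fix ei ej ek assume e: "ei \<noteq> c0" "ei \<noteq> g i" "ej \<noteq> c0" "ej \<noteq> g j" "ek \<noteq> c0" "ek \<noteq> g k"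
      and inv: "\<And>a b c. P a b c r \<Longrightarrow> P (a \<oplus> ei) (b \<oplus> ej) c r" "\<And>a b c. P a b c r \<Longrightarrow> P a (b \<oplus> ej) (c \<oplus> ek) r"
    define \<beta> where "\<beta> = (\<lambda>_. c0)(i := ei, j := ej, k := ek)"
    have \<beta>: "\<beta> i = ei" "\<beta> j = ej" "\<beta> k = ek" using ne by (auto simp: \<beta>_def)
    have "invariant S (subcode l r N) \<beta>"
      by (rule invariant3I[OF Seq _ Nl]) (use dist inv \<beta> in auto)
    then have "full S (subcode l r N)"
      unfolding full_def using g e Seq \<beta> by (intro exI[of _ g] exI[of _ \<beta>]) auto
    then show False using nf by blast
  next
    fix e assume e: "e \<noteq> c0" and inv: "\<And>b c d. P v b c d \<Longrightarrow> P v (b \<oplus> g j) (c \<oplus> g k) d"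
      "\<And>b c d. P v b c d \<Longrightarrow> P v b (c \<oplus> g k) (d \<oplus> e)"
    define \<beta> where "\<beta> = g(l := e)"
    have \<beta>: "\<beta> j = g j" "\<beta> k = g k" "\<beta> l = e" using ne by (auto simp: \<beta>_def)
    have "invariant (T - {i}) (subcode i v N) \<beta>"
      by (rule invariant3I[OF _ _ Ni]) (use Teq ne inv \<beta> in auto)
    moreover have "\<forall>p\<in>T - {i}. \<beta> p \<noteq> c0" using Teq e g(1) Seq \<beta> by auto
    moreover have "\<forall>p\<in>S - {i}. \<beta> p = g p" using jk \<beta> by auto
    ultimately show False using bad unfolding good_def by blast
  qed
  then obtain f h1 h2 h3 where bij: "bij f" "bij h1" "bij h2" "bij h3" and
    alt: "(\<forall>a b c d. P (f a) (h1 b) (h2 c) (h3 d) = twisted a b c d) \<or>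
     (\<forall>a b c d. P (f a) (h1 b) (h2 c) (h3 d) = twisted a (swap23 c) (swap23 b) d)" by blast
  from alt show ?thesis
  proof
    assume *: "\<forall>a b c d. P (f a) (h1 b) (h2 c) (h3 d) = twisted a b c d"
    let ?\<phi> = "(\<lambda>_. id)(i := f, j := h1, k := h2, l := h3)"
    have "N (\<lambda>m. ?\<phi> m (x m)) = twisted (x i) (x j) (x k) (x l)" for x
      unfolding N_P using ne by (simp add: *[rule_format])
    moreover have "bij (?\<phi> m)" for m using bij by simp
    ultimately show ?thesis using Teq dist by blast
  next
    \<comment> \<open>The second completion is \<open>twisted\<close> again after exchanging
      \<open>j\<close> with \<open>k\<close> and absorbing \<open>swap23\<close> into the
      labels.\<close>
    assume *: "\<forall>a b c d. P (f a) (h1 b) (h2 c) (h3 d) = twisted a (swap23 c) (swap23 b) d"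
    let ?\<phi> = "(\<lambda>_. id)(i := f, j := h1 \<circ> swap23, k := h2 \<circ> swap23, l := h3)"
    have "N (\<lambda>m. ?\<phi> m (x m)) = twisted (x i) (x k) (x j) (x l)" for x
      unfolding N_P using ne by (simp add: *[rule_format])
    moreover have "bij (?\<phi> m)" for m using bij bij_comp[OF bij_swap23 bij(2)] bij_comp[OF bij_swap23 bij(3)] by simp
    moreover have "T = {i, k, j, l}" "distinct [i, k, j, l]" using Teq ne by auto
    ultimately show ?thesis by blast
  qed
qed

section \<open>Transversals near a twisted subcode\<close>

lemma twist_ground: "twist c0 = c1" "twist c1 = c0" "twist c2 = c2" "twist c3 = c3"
  by (simp_all add: twist_def)

lemma add4_left_commute: "add4 a (add4 b c) = add4 b (add4 a c)"
  by (metis add4_assoc add4_commute)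

lemmas add4_ac = add4_assoc add4_commute add4_left_commute

lemma add4_cancel [simp]: "add4 a c = add4 b c \<longleftrightarrow> a = b"
  by (metis add4_assoc add4_neg4(1) add4_zero(2))

lemma neg4_add4: "neg4 (add4 a b) = add4 (neg4 a) (neg4 b)"
  by (rule q_exhaust[of a]; rule q_exhaust[of b]; simp add: add4_def neg4_def)

definition sg :: "bool \<Rightarrow> q \<Rightarrow> q" where
  "sg e v = (if e then neg4 v else v)"

lemma sg_add4: "sg e (add4 a b) = add4 (sg e a) (sg e b)"
  by (simp add: sg_def neg4_add4)

lemma neg4_neg4 [simp]: "neg4 (neg4 v) = v"
  by (cases v) (auto simp: neg4_def)

lemma sg_eq_iff [simp]: "sg e a = sg e b \<longleftrightarrow> a = b"
  unfolding sg_def by (metis neg4_neg4)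

lemma sg_ground [simp]: "sg e c0 = c0" "sg False v = v" "sg True c1 = c3" "sg True c3 = c1"
  by (simp_all add: sg_def neg4_def)

text \<open>The maps \<open>\<plusminus>t + t0\<close> with the minus sign for odd \<open>t0\<close>
  are the identity and the three double transpositions. They form a normal subgroup of the symmetric
  group, so conjugation by \<open>twist\<close> again yields one of them, in particular an affine
  map.\<close>

lemma twist_affine:
  "\<exists>e' k. \<forall>t. twist (add4 (sg (fst t0) t) t0) = add4 (sg e' (twist t)) k"
proof -
  have all: "(\<forall>v. Q v) \<longleftrightarrow> Q c0 \<and> Q c1 \<and> Q c2 \<and> Q c3" for Q :: "q \<Rightarrow> bool"
    by (metis q_exhaust)
  \<comment> \<open>The signs of the conjugates; \<open>?k\<close> is forced by
    \<open>t = c0\<close>, where \<open>twist c0 = c1\<close>.\<close>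
  let ?e = "\<lambda>t0. t0 = c2 \<or> t0 = c1"
  let ?k = "\<lambda>t0. add4 (twist t0) (neg4 (sg (?e t0) c1))"
  have "\<forall>t. twist (add4 (sg (fst t0) t) t0) = add4 (sg (?e t0) (twist t)) (?k t0)"
    unfolding all by (rule q_exhaust[of t0]; simp add: twist_def add4_def sg_def neg4_def)
  then show ?thesis by blast
qed

lemma bij_add4: "bij (\<lambda>v. add4 (sg e v) a)"
proof -
  have "inj (\<lambda>v. add4 (sg e v) a)" by (intro injI) simp
  then show ?thesis by (simp add: bij_def finite_UNIV_inj_surj)
qed

lemma distinct4_map: "inj f \<Longrightarrow> distinct [a, b, c, d] \<Longrightarrow> distinct [f a, f b, f c, f d]"
  by (simp add: inj_eq)

text \<open>The affine maps below fix the code \<^const>\<open>twisted\<close> and move any triple of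
  coordinates to the origin; they reverse the direction of rotation if the first two
  coordinates have an odd sum.\<close>

lemma twisted_family_rotation:
  assumes R: "code4 R2" "code4 R3" "code4 R4"
    and nt: "\<And>a1 b1 v1 d1 a2 b2 v2 d2 a3 b3 v3 d3 a4 b4 v4 d4. twisted a1 b1 v1 d1 \<Longrightarrow>
      R2 a2 b2 v2 d2 \<Longrightarrow> R3 a3 b3 v3 d3 \<Longrightarrow> R4 a4 b4 v4 d4 \<Longrightarrow> distinct [a1, a2, a3, a4] \<Longrightarrow>
      distinct [b1, b2, b3, b4] \<Longrightarrow> distinct [v1, v2, v3, v4] \<Longrightarrow> distinct [d1, d2, d3, d4] \<Longrightarrow> False"
    and r: "R2 a b c d"
  shows "R2 (add4 a c1) (add4 b c3) c d"
proof -
  have base: "\<exists>d. R2 a0 b0 c' d \<and> R2 (add4 a0 (sg e c1)) (add4 b0 (sg e c3)) c' d"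
    if e: "e = fst (add4 a0 b0)" for a0 b0 c' e
  proof -
    obtain e' k where ek: "\<And>t. twist (add4 (sg e t) (add4 a0 b0)) = add4 (sg e' (twist t)) k"
      using twist_affine[of "add4 a0 b0"] unfolding e by blast
    \<comment> \<open>The offsets of \<open>h\<close> and \<open>u\<close> add up to
      \<open>k\<close>, which is what makes the four maps a symmetry of
      \<open>twisted\<close>.\<close>
    define f g h u where "f v = add4 (sg e v) a0" and "g v = add4 (sg e v) b0" and "h v = add4 (sg e' v) c'"
      and "u v = add4 (sg e' v) (add4 k (neg4 c'))" for v
    have bij: "bij f" "bij g" "bij h" "bij u" unfolding f_def g_def h_def u_def by (rule bij_add4)+
    note inj = bij[THEN bij_is_inj]
    have fg: "add4 (f a) (g b) = add4 (sg e (add4 a b)) (add4 a0 b0)" for a b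
      unfolding f_def g_def sg_add4 by (simp only: add4_ac)
    have "add4 (h c) (u d) = add4 (add4 (sg e' c) (sg e' d)) (add4 (add4 c' (neg4 c')) k)" for c d
      unfolding h_def u_def by (simp only: add4_ac)
    then have hu: "add4 (h c) (u d) = add4 (sg e' (add4 c d)) k" for c d
      by (simp add: sg_add4)
    have tw: "twisted (f a) (g b) (h c) (u d) \<longleftrightarrow> twisted a b c d" for a b c d
      unfolding twisted_def fg hu ek by simp
    have "\<exists>d. R2 (f c0) (g c0) (h c0) (u d) \<and> R2 (f c1) (g c3) (h c0) (u d)"
    proof (rule twisted_family[OF code4_relabel[OF R(1) bij] code4_relabel[OF R(2) bij] code4_relabel[OF R(3) bij]])
      fix a1 b1 v1 d1 a2 b2 v2 d2 a3 b3 v3 d3 a4 b4 v4 d4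
      assume t: "twisted a1 b1 v1 d1" and rows: "R2 (f a2) (g b2) (h v2) (u d2)" "R3 (f a3) (g b3) (h v3) (u d3)" "R4 (f a4) (g b4) (h v4) (u d4)"
        and d: "distinct [a1, a2, a3, a4]" "distinct [b1, b2, b3, b4]" "distinct [v1, v2, v3, v4]" "distinct [d1, d2, d3, d4]"
      show False
        by (rule nt[OF _ rows distinct4_map[OF inj(1) d(1)] distinct4_map[OF inj(2) d(2)] distinct4_map[OF inj(3) d(3)] distinct4_map[OF inj(4) d(4)]])
          (simp add: tw t)
    qed
    then show ?thesis unfolding f_def g_def h_def sg_ground(1) add4_zero by (metis add4_commute)
  qed
  show ?thesis
  proof (cases "fst (add4 a b)")
    case False
    then obtain d' where d': "R2 a b c d'" "R2 (add4 a c1) (add4 b c3) c d'"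
      using base[of False a b c] by auto
    then show ?thesis using code4_unique(4)[OF R(1) r d'(1)] by simp
  next
    case True
    \<comment> \<open>The backward rotation is applied at the rotated triple, whose first two
      letters have the same sum; it leads back to the given triple and so identifies the last
      letter.\<close>
    have "fst (add4 (add4 a c1) (add4 b c3)) = fst (add4 a b)" by (auto simp: add4_def)
    then obtain d' where d': "R2 (add4 a c1) (add4 b c3) c d'"
      "R2 (add4 (add4 a c1) c3) (add4 (add4 b c3) c1) c d'"
      using base[of True "add4 a c1" "add4 b c3" c] True by auto
    have "add4 (add4 a c1) c3 = a" "add4 (add4 b c3) c1 = b" unfolding add4_assoc by (simp_all add: add4_def)
    then show ?thesis using code4_unique(4)[OF R(1) r] d' by metis
  qed
qed

text \<open>Again the facts are an unsatisfiable core found with a SAT solver.\<close>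

lemma latin_certificate:
  assumes un: "\<And>t t' s w. t \<noteq> t' \<Longrightarrow> \<not> L t s w \<or> \<not> L t' s w"
      "\<And>s s' t w. s \<noteq> s' \<Longrightarrow> \<not> L t s w \<or> \<not> L t s' w"
      "\<And>w w' t s. w \<noteq> w' \<Longrightarrow> \<not> L t s w \<or> \<not> L t s w'"
    and ex: "\<And>s w. L c0 s w \<or> L c1 s w \<or> L c2 s w \<or> L c3 s w"
      "\<And>t w. L t c0 w \<or> L t c1 w \<or> L t c2 w \<or> L t c3 w"
      "\<And>t s. L t s c0 \<or> L t s c1 \<or> L t s c2 \<or> L t s c3"
    and zero: "\<And>t. L t (twist t) c0"
    and tri: "\<And>t1 s1 t2 s2 t3 s3. twist (neg4 (add4 t1 (add4 t2 t3))) = neg4 (add4 s1 (add4 s2 s3)) \<Longrightarrow>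
      \<not> L t1 s1 c1 \<or> \<not> L t2 s2 c2 \<or> \<not> L t3 s3 c3"
  shows False
  using zero[of c0, unfolded twist_ground]
    zero[of c1, unfolded twist_ground]
    zero[of c3, unfolded twist_ground]
    un(3)[of c0 c1 c3 c3, simplified]
    un(3)[of c2 c3 c3 c2, simplified]
    un(3)[of c1 c3 c3 c2, simplified]
    un(2)[of c2 c3 c3 c0, simplified]
    un(2)[of c1 c2 c3 c3, simplified]
    un(2)[of c0 c2 c3 c1, simplified]
    un(1)[of c2 c3 c3 c0, simplified]
    un(3)[of c0 c3 c2 c2, simplified]
    un(3)[of c0 c2 c2 c2, simplified]
    un(3)[of c0 c1 c2 c2, simplified]
    un(2)[of c1 c3 c2 c3, simplified]
    un(1)[of c2 c3 c1 c2, simplified]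
    un(1)[of c2 c3 c1 c1, simplified]
    un(3)[of c1 c3 c2 c1, simplified]
    un(1)[of c2 c3 c0 c3, simplified]
    un(1)[of c2 c3 c0 c2, simplified]
    un(3)[of c1 c2 c2 c0, simplified]
    un(1)[of c1 c2 c3 c2, simplified]
    un(3)[of c1 c3 c1 c2, simplified]
    un(3)[of c1 c2 c1 c2, simplified]
    un(1)[of c1 c2 c1 c3, simplified]
    un(1)[of c1 c2 c1 c2, simplified]
    un(1)[of c1 c3 c1 c1, simplified]
    un(2)[of c1 c3 c1 c1, simplified]
    un(2)[of c1 c2 c1 c1, simplified]
    un(3)[of c1 c2 c1 c1, simplified]
    un(1)[of c1 c3 c0 c3, simplified]
    un(2)[of c0 c1 c1 c1, simplified]
    un(1)[of c1 c3 c0 c0, simplified]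
    un(1)[of c1 c2 c0 c0, simplified]
    un(3)[of c0 c2 c1 c0, simplified]
    un(1)[of c0 c2 c3 c2, simplified]
    un(1)[of c0 c3 c3 c0, simplified]
    un(2)[of c2 c3 c0 c3, simplified]
    un(3)[of c1 c3 c0 c2, simplified]
    un(3)[of c1 c2 c0 c2, simplified]
    un(1)[of c0 c2 c1 c3, simplified]
    un(1)[of c0 c1 c1 c3, simplified]
    un(1)[of c0 c3 c1 c0, simplified]
    un(1)[of c0 c2 c1 c0, simplified]
    un(1)[of c0 c1 c1 c0, simplified]
    un(3)[of c0 c1 c0 c1, simplified]
    un(2)[of c0 c3 c0 c1, simplified]
    un(2)[of c0 c2 c0 c1, simplified]
    un(2)[of c0 c1 c0 c0, simplified]
    tri[of c3 c3 c3 c2 c3 c0, simplified twist_def add4_def neg4_def, simplified]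
    tri[of c3 c3 c3 c2 c2 c1, simplified twist_def add4_def neg4_def, simplified]
    tri[of c3 c3 c1 c2 c1 c1, simplified twist_def add4_def neg4_def, simplified]
    tri[of c3 c3 c1 c2 c0 c2, simplified twist_def add4_def neg4_def, simplified]
    tri[of c3 c3 c0 c2 c0 c0, simplified twist_def add4_def neg4_def, simplified]
    tri[of c3 c2 c0 c2 c1 c2, simplified twist_def add4_def neg4_def, simplified]
    tri[of c3 c1 c3 c2 c2 c0, simplified twist_def add4_def neg4_def, simplified]
    tri[of c3 c1 c2 c2 c1 c3, simplified twist_def add4_def neg4_def, simplified]
    tri[of c3 c0 c0 c2 c0 c2, simplified twist_def add4_def neg4_def, simplified]
    tri[of c3 c3 c0 c1 c2 c3, simplified twist_def add4_def neg4_def, simplified]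
    tri[of c3 c3 c1 c1 c1 c2, simplified twist_def add4_def neg4_def, simplified]
    tri[of c3 c2 c3 c1 c3 c3, simplified twist_def add4_def neg4_def, simplified]
    tri[of c3 c1 c1 c1 c3 c1, simplified twist_def add4_def neg4_def, simplified]
    tri[of c3 c1 c0 c1 c2 c0, simplified twist_def add4_def neg4_def, simplified]
    tri[of c3 c1 c1 c1 c1 c3, simplified twist_def add4_def neg4_def, simplified]
    tri[of c3 c0 c2 c1 c3 c1, simplified twist_def add4_def neg4_def, simplified]
    tri[of c3 c0 c1 c1 c2 c0, simplified twist_def add4_def neg4_def, simplified]
    tri[of c3 c0 c0 c1 c0 c3, simplified twist_def add4_def neg4_def, simplified]
    tri[of c3 c3 c1 c0 c2 c2, simplified twist_def add4_def neg4_def, simplified]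
    tri[of c3 c3 c1 c0 c1 c3, simplified twist_def add4_def neg4_def, simplified]
    tri[of c3 c1 c2 c0 c3 c3, simplified twist_def add4_def neg4_def, simplified]
    tri[of c3 c1 c3 c0 c2 c2, simplified twist_def add4_def neg4_def, simplified]
    tri[of c3 c1 c1 c0 c1 c0, simplified twist_def add4_def neg4_def, simplified]
    tri[of c3 c1 c0 c0 c1 c2, simplified twist_def add4_def neg4_def, simplified]
    tri[of c3 c0 c1 c0 c2 c1, simplified twist_def add4_def neg4_def, simplified]
    tri[of c2 c3 c1 c3 c1 c2, simplified twist_def add4_def neg4_def, simplified]
    tri[of c2 c1 c0 c3 c3 c2, simplified twist_def add4_def neg4_def, simplified]
    tri[of c2 c1 c0 c3 c1 c0, simplified twist_def add4_def neg4_def, simplified]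
    ex(3)[of c0 c0]
    ex(1)[of c0 c1]
    ex(2)[of c0 c3]
    ex(1)[of c1 c1]
    ex(1)[of c2 c1]
    ex(1)[of c2 c2]
    ex(1)[of c2 c3]
    ex(3)[of c0 c3]
    ex(1)[of c3 c1]
    ex(1)[of c3 c3]
    ex(2)[of c1 c2]
    ex(2)[of c1 c3]
    ex(3)[of c1 c1]
    ex(2)[of c2 c0]
    ex(2)[of c2 c2]
    ex(2)[of c2 c3]
    ex(3)[of c2 c1]
    ex(3)[of c2 c3]
    ex(3)[of c3 c0]
    ex(2)[of c3 c1]
    ex(2)[of c3 c2]
    ex(3)[of c3 c1]
    ex(3)[of c3 c2]
  by sat

section \<open>Half turns of cyclic labelings\<close>

definition half :: "(q \<Rightarrow> nat) \<Rightarrow> q \<Rightarrow> bool" where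
  "half \<sigma> a \<longleftrightarrow> (\<forall>u. \<sigma> (u \<oplus> a) mod 4 = (\<sigma> u + 2) mod 4)"

lemma label_less: "bij_betw \<sigma> UNIV {..<(4::nat)} \<Longrightarrow> \<sigma> u < 4"
  by (auto simp: bij_betw_def)

lemma label_eq: "bij_betw \<sigma> UNIV {..<(4::nat)} \<Longrightarrow> \<sigma> u = \<sigma> v \<longleftrightarrow> u = v"
  by (auto simp: bij_betw_def inj_eq)

text \<open>Adding 2 to the labels is a fixed-point-free involution of four letters, hence a
  translation.\<close>

lemma half_ex:
  assumes \<sigma>: "bij_betw \<sigma> UNIV {..<4}"
  shows "\<exists>a. half \<sigma> a"
proof -
  have "\<exists>w. \<sigma> w = (\<sigma> u + 2) mod 4" for u
    using \<sigma> unfolding bij_betw_def by (metis (no_types, lifting) imageE lessThan_iff mod_less_divisor zero_less_numeral)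
  then obtain f where f: "\<And>u. \<sigma> (f u) = (\<sigma> u + 2) mod 4" by metis
  have mod: "((n + 2) mod 4 + 2) mod 4 = n mod 4" "(n + 2) mod 4 \<noteq> n mod 4" for n :: nat by presburger+
  have ff: "f (f u) = u" and fne: "f u \<noteq> u" for u
    using f[of u] f[of "f u"] mod[of "\<sigma> u"] label_less[OF \<sigma>, of u] label_eq[OF \<sigma>] by (metis mod_less)+
  have "f u = u \<oplus> f c0" for u
  proof (cases "u = c0 \<or> u = f c0")
    case True
    then show ?thesis using ff[of c0] by (elim disjE) simp_all
  next
    case False
    have "f u \<noteq> c0" "f u \<noteq> f c0" using False ff by metis+
    then have "distinct [c0, c0 \<oplus> f c0, u, f u]" using False fne[of u] fne[of c0] by (simp add: eq_sym_conv)
    then show ?thesis by (rule fourth_xor)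
  qed
  then have "half \<sigma> (f c0)" unfolding half_def using f by (metis mod_mod_trivial)
  then show ?thesis by blast
qed

lemma sum_three:
  assumes "finite J" "p \<in> J" "q' \<in> J" "r \<in> J" "p \<noteq> q'" "p \<noteq> r" "q' \<noteq> r"
  shows "(\<Sum>m\<in>J. \<sigma> m ((x(p := u, q' := v, r := w)) m)) =
    (\<Sum>m\<in>J - {p, q', r}. \<sigma> m (x m)) + \<sigma> p u + \<sigma> q' v + (\<sigma> r w :: nat)"
proof -
  have "(\<Sum>m\<in>J. \<sigma> m ((x(p := u, q' := v, r := w)) m)) =
      (\<Sum>m\<in>J - {p, q', r}. \<sigma> m ((x(p := u, q' := v, r := w)) m)) + (\<Sum>m\<in>{p, q', r}. \<sigma> m ((x(p := u, q' := v, r := w)) m))"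
    using assms by (intro sum.subset_diff) auto
  also have "(\<Sum>m\<in>J - {p, q', r}. \<sigma> m ((x(p := u, q' := v, r := w)) m)) = (\<Sum>m\<in>J - {p, q', r}. \<sigma> m (x m))"
    by (intro sum.cong) auto
  also have "(\<Sum>m\<in>{p, q', r}. \<sigma> m ((x(p := u, q' := v, r := w)) m)) = \<sigma> p u + \<sigma> q' v + \<sigma> r w"
    using assms by simp
  finally show ?thesis by (simp only: add.assoc)
qed

text \<open>Since \<open>r\<close> can complete any two letters at \<open>p\<close> and
  \<open>q'\<close>, the label changes at \<open>p\<close> and \<open>q'\<close> cancel for all
  letters independently, so the change at \<open>p\<close> is constant. Shifting twice changes
  nothing, so twice the constant is zero, while \<open>a \<noteq> c0\<close> keeps the constant
  itself from being zero.\<close>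

lemma half_if_pair_shift:
  assumes J: "finite J" "p \<in> J" "q' \<in> J" "r \<in> J" "p \<noteq> q'" "p \<noteq> r" "q' \<noteq> r"
    and \<sigma>: "\<And>m. m \<in> J \<Longrightarrow> bij_betw (\<sigma> m) UNIV {..<4}"
    and N: "\<And>x. N x \<longleftrightarrow> 4 dvd C + (\<Sum>m\<in>J. \<sigma> m (x m))"
    and shift: "\<And>x. N x \<Longrightarrow> N (x(p := x p \<oplus> a, q' := x q' \<oplus> b))" and a: "a \<noteq> c0"
  shows "half (\<sigma> p) a"
  unfolding half_def
proof
  fix u
  define y :: "'a \<Rightarrow> q" where "y = (\<lambda>_. c0)"
  define X where "X = C + (\<Sum>m\<in>J - {p, q', r}. \<sigma> m (y m))"
  have N3: "N (y(p := u, q' := v, r := w)) \<longleftrightarrow> 4 dvd X + \<sigma> p u + \<sigma> q' v + \<sigma> r w" for u v w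
    unfolding N sum_three[OF J] X_def by (simp add: add.assoc)
  have ex: "\<exists>w. 4 dvd Y + \<sigma> r w" for Y
  proof -
    have "(4 - Y mod 4) mod 4 \<in> {..<4}" by simp
    then obtain w where w: "\<sigma> r w = (4 - Y mod 4) mod 4"
      using \<sigma>[OF J(4)] unfolding bij_betw_def by (metis imageE)
    have "(Y mod 4 + (4 - Y mod 4)) mod 4 = 0" using mod_less_divisor[of 4 Y] by simp
    then have "4 dvd Y + (4 - Y mod 4) mod 4" unfolding dvd_eq_mod_eq_0 by (metis mod_add_left_eq mod_add_right_eq)
    then show ?thesis using w by metis
  qed
  have sh: "4 dvd X + \<sigma> p (u \<oplus> a) + \<sigma> q' (v \<oplus> b) + \<sigma> r w" if "4 dvd X + \<sigma> p u + \<sigma> q' v + \<sigma> r w" for u v w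
  proof -
    have "(y(p := u, q' := v, r := w))(p := (y(p := u, q' := v, r := w)) p \<oplus> a, q' := (y(p := u, q' := v, r := w)) q' \<oplus> b)
      = y(p := u \<oplus> a, q' := v \<oplus> b, r := w)"
      using J by (auto simp: fun_eq_iff)
    then show ?thesis using shift[of "y(p := u, q' := v, r := w)"] that unfolding N3[symmetric] by metis
  qed
  obtain w where w: "4 dvd X + \<sigma> p u + \<sigma> q' c0 + \<sigma> r w" using ex by blast
  obtain w' where w': "4 dvd X + \<sigma> p (u \<oplus> a) + \<sigma> q' c0 + \<sigma> r w'" using ex by blast
  have s: "4 dvd X + \<sigma> p (u \<oplus> a) + \<sigma> q' (c0 \<oplus> b) + \<sigma> r w" "4 dvd X + \<sigma> p u + \<sigma> q' (c0 \<oplus> b) + \<sigma> r w'"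
    using sh[OF w] sh[OF w'] by simp_all
  define A B where "A = \<sigma> p u" and "B = \<sigma> p (u \<oplus> a)"
  have AB: "A < 4" "B < 4" "A \<noteq> B"
    using label_less[OF \<sigma>[OF J(2)]] label_eq[OF \<sigma>[OF J(2)]] a unfolding A_def B_def by auto
  note d = w w' s
  \<comment> \<open>In this combination of the four sums everything at \<open>q'\<close> and
    \<open>r\<close> cancels.\<close>
  have "int 4 dvd int (X + \<sigma> p u + \<sigma> q' c0 + \<sigma> r w) - int (X + \<sigma> p (u \<oplus> a) + \<sigma> q' (c0 \<oplus> b) + \<sigma> r w) -
      (int (X + \<sigma> p (u \<oplus> a) + \<sigma> q' c0 + \<sigma> r w') - int (X + \<sigma> p u + \<sigma> q' (c0 \<oplus> b) + \<sigma> r w'))"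
    using d by (intro dvd_diff) (simp_all only: int_dvd_int_iff)
  also have "\<dots> = 2 * int A - 2 * int B" unfolding A_def B_def by simp
  finally have *: "4 dvd 2 * int A - 2 * int B" by simp
  have "A = 0 \<or> A = 1 \<or> A = 2 \<or> A = 3" "B = 0 \<or> B = 1 \<or> B = 2 \<or> B = 3" using AB by linarith+
  then have "B mod 4 = (A + 2) mod 4" using * AB(3) by (elim disjE) simp_all
  then show "\<sigma> p (u \<oplus> a) mod 4 = (\<sigma> p u + 2) mod 4" unfolding A_def B_def .
qed

lemma pair_shift_if_half:
  assumes J: "finite J" "p \<in> J" "q' \<in> J" "p \<noteq> q'" and h: "half (\<sigma> p) a" "half (\<sigma> q') b"
    and x: "4 dvd (\<Sum>m\<in>J. \<sigma> m (x m))"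
  shows "4 dvd (\<Sum>m\<in>J. \<sigma> m ((x(p := x p \<oplus> a, q' := x q' \<oplus> b)) m))"
proof -
  let ?y = "x(p := x p \<oplus> a, q' := x q' \<oplus> b)" and ?S = "\<Sum>m\<in>J - {p, q'}. \<sigma> m (x m)"
  have split: "(\<Sum>m\<in>J. \<sigma> m (z m)) = (\<Sum>m\<in>J - {p, q'}. \<sigma> m (z m)) + (\<sigma> p (z p) + \<sigma> q' (z q'))" for z
    using J sum.subset_diff[of "{p, q'}" J "\<lambda>m. \<sigma> m (z m)"] by simp
  have y: "(\<Sum>m\<in>J. \<sigma> m (?y m)) = ?S + (\<sigma> p (x p \<oplus> a) + \<sigma> q' (x q' \<oplus> b))"
    unfolding split[of ?y] using J(4) by (intro arg_cong2[of _ _ _ _ "(+)"] sum.cong) auto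
  have "(?S + (\<sigma> p (x p \<oplus> a) + \<sigma> q' (x q' \<oplus> b))) mod 4 = (?S + ((\<sigma> p (x p) + 2) + (\<sigma> q' (x q') + 2))) mod 4"
    using h unfolding half_def by (intro mod_add_cong refl) blast+
  also have "\<dots> = (?S + (\<sigma> p (x p) + \<sigma> q' (x q'))) mod 4"
  proof -
    have "?S + ((\<sigma> p (x p) + 2) + (\<sigma> q' (x q') + 2)) = ?S + (\<sigma> p (x p) + \<sigma> q' (x q')) + 4" by simp
    then show ?thesis by (simp only: mod_add_self2)
  qed
  also have "\<dots> = 0" using x unfolding split[of x] by (simp add: dvd_eq_mod_eq_0)
  finally show ?thesis unfolding y by (simp add: dvd_eq_mod_eq_0)
qed

text \<open>An instance of Hall's theorem: in a finite abelian group, a family indexed by the group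
  with sum zero is a difference of two permutations up to order, that is, it is the sum of two
  bijective families.\<close>

lemma Z4_sum_of_permutations:
  assumes "t0 = neg4 (add4 t1 (add4 t2 t3))"
  shows "\<exists>a b c d. distinct [a, b, c, d] \<and>
    distinct [add4 t0 (neg4 a), add4 t1 (neg4 b), add4 t2 (neg4 c), add4 t3 (neg4 d)]"
proof -
  \<comment> \<open>Adding the same element to \<open>a\<close>, \<open>b\<close>, \<open>c\<close>,
    \<open>d\<close> keeps both conditions, so \<open>a = c0\<close> may be assumed.\<close>
  let ?perms = "[(c0, c1, c2, c3), (c0, c1, c3, c2), (c0, c2, c1, c3), (c0, c2, c3, c1), (c0, c3, c1, c2), (c0, c3, c2, c1)]"
  have "list_ex (\<lambda>(a, b, c, d). distinct [a, b, c, d] \<and>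
    distinct [add4 t0 (neg4 a), add4 t1 (neg4 b), add4 t2 (neg4 c), add4 t3 (neg4 d)]) ?perms"
    unfolding assms
    by (rule q_exhaust[of t1]; rule q_exhaust[of t2]; rule q_exhaust[of t3]; simp add: add4_def neg4_def)
  then show ?thesis unfolding list_ex_iff by blast
qed

section \<open>Codes without transversals that contain the twisted code\<close>

definition rot :: "'i \<Rightarrow> 'i \<Rightarrow> ('i \<Rightarrow> q) \<Rightarrow> 'i \<Rightarrow> q" where
  "rot i j x = x(i := add4 (x i) c1, j := add4 (x j) c3)"

lemma code4_slice:
  assumes M: "mds I M" and I: "{i, j, k, l} \<subseteq> I" and d: "distinct [i, j, k, l]"
  shows "code4 (\<lambda>a b c d. M (y(i := a, j := b, k := c, l := d)))"
proof (rule code4I)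
  have ex1: "\<exists>!v. M (x(m := v))" if "m \<in> {i, j, k, l}" for m x
    by (rule M[unfolded mds_def, THEN conjunct2, THEN conjunct2, THEN bspec, OF subsetD[OF I that], THEN spec])
  fix a b c d'
  have *: "y(i := a, j := b, k := c, l := d') = (y(j := b, k := c, l := d'))(i := a)"
    "y(i := a, j := b, k := c, l := d') = (y(i := a, k := c, l := d'))(j := b)"
    "y(i := a, j := b, k := c, l := d') = (y(i := a, j := b, l := d'))(k := c)" for a b c d'
    using d by (auto simp: fun_eq_iff)
  show "\<exists>!a. M (y(i := a, j := b, k := c, l := d'))" unfolding *(1) by (rule ex1) simp
  show "\<exists>!b. M (y(i := a, j := b, k := c, l := d'))" unfolding *(2) by (rule ex1) simp
  show "\<exists>!c. M (y(i := a, j := b, k := c, l := d'))" unfolding *(3) by (rule ex1) simp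
  show "\<exists>!d'. M (y(i := a, j := b, k := c, l := d'))" by (rule ex1) simp
qed

text \<open>The situation in a smallest counterexample, relabeled so that the twisted subcode sits
  at zero on the remaining coordinates. \<open>IH\<close> is the main theorem for smaller index
  sets; the goal is a contradiction.\<close>

locale twisted_code =
  fixes I :: "'i set" and M :: "('i \<Rightarrow> q) \<Rightarrow> bool" and i j k l :: 'i
  assumes M: "mds I M" and tf: "transversal_free I M"
    and I: "{i, j, k, l} \<subseteq> I" and dist: "distinct [i, j, k, l]"
    and tw: "\<And>x. (\<And>m. m \<in> I - {i, j, k, l} \<Longrightarrow> x m = c0) \<Longrightarrow> M x = twisted (x i) (x j) (x k) (x l)"
    and IH: "\<And>J (N :: ('i \<Rightarrow> q) \<Rightarrow> bool). card J < card I \<Longrightarrow> J \<noteq> {} \<Longrightarrow> mds J N \<Longrightarrow> transversal_free J N \<Longrightarrow>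
      odd (card J) \<and> Z4_code J N"
begin

abbreviation "W \<equiv> I - {i, j, k, l}"

lemma ne: "i \<noteq> j" "i \<noteq> k" "i \<noteq> l" "j \<noteq> k" "j \<noteq> l" "k \<noteq> l" "j \<noteq> i" "k \<noteq> i" "l \<noteq> i" "k \<noteq> j" "l \<noteq> j" "l \<noteq> k"
  using dist by auto

lemma fin: "finite I"
  using mds_finite[OF M] .

text \<open>\<open>twist\<close> is an involution, so whatever is shown for \<open>i\<close>,
  \<open>j\<close> also holds for \<open>k\<close>, \<open>l\<close>.\<close>

lemma swap: "twisted_code I M k l i j"
proof
  show "mds I M" "transversal_free I M" by (rule M, rule tf)
  show "{k, l, i, j} \<subseteq> I" "distinct [k, l, i, j]" using I ne by auto
  have W: "I - {k, l, i, j} = W" by auto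
  show "M x = twisted (x k) (x l) (x i) (x j)" if "\<And>m. m \<in> I - {k, l, i, j} \<Longrightarrow> x m = c0" for x
  proof -
    have "M x = twisted (x i) (x j) (x k) (x l)" using that unfolding W by (rule tw)
    also have "\<dots> = twisted (x k) (x l) (x i) (x j)" unfolding twisted_def by (metis twist_twist)
    finally show ?thesis .
  qed
qed (rule IH)

text \<open>Where \<open>x\<close> has no zero on \<open>W\<close>, two further words
  \<open>y\<close>, \<open>y'\<close> can be chosen so that zero, \<open>x\<close>,
  \<open>y\<close>, \<open>y'\<close> differ at each coordinate of \<open>W\<close>. The slices of
  \<open>M\<close> over these four words then form no transversal, and the slice over zero is
  \<open>twisted\<close>.\<close>

lemma rot_far:
  assumes x: "M x" and far: "\<And>m. m \<in> W \<Longrightarrow> x m \<noteq> c0"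
  shows "M (rot i j x)"
proof -
  define R where "R y a b c d = M (y(i := a, j := b, k := c, l := d))" for y a b c d
  have R: "code4 (R y)" for y unfolding R_def by (rule code4_slice[OF M I dist])
  define y where "y m = (if x m = c1 then c2 else c1)" for m
  define y' where "y' m = x m \<oplus> y m" for m
  have yy: "distinct [c0, x m, y m, y' m]" if "m \<in> W" for m
    using far[OF that] unfolding y_def y'_def by (rule_tac q_exhaust[of "x m"]) (simp_all add: xor_def)
  have "R x (add4 (x i) c1) (add4 (x j) c3) (x k) (x l)"
  proof (rule twisted_family_rotation[OF R[of x] R[of y] R[of y']])
    fix a1 b1 v1 d1 a2 b2 v2 d2 a3 b3 v3 d3 a4 b4 v4 d4
    assume t: "twisted a1 b1 v1 d1" and r: "R x a2 b2 v2 d2" "R y a3 b3 v3 d3" "R y' a4 b4 v4 d4"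
      and d: "distinct [a1, a2, a3, a4]" "distinct [b1, b2, b3, b4]" "distinct [v1, v2, v3, v4]" "distinct [d1, d2, d3, d4]"
    let ?z = "(\<lambda>_. c0)(i := a1, j := b1, k := v1, l := d1)"
    have "?z i = a1" "?z j = b1" "?z k = v1" "?z l = d1" using ne by simp_all
    then have z: "M ?z" using tw[of ?z] t by (metis (no_types, lifting) DiffE fun_upd_other insertCI)
    let ?x = "x(i := a2, j := b2, k := v2, l := d2)" and ?y = "y(i := a3, j := b3, k := v3, l := d3)"
      and ?y' = "y'(i := a4, j := b4, k := v4, l := d4)"
    have "distinct [?z m, ?x m, ?y m, ?y' m]" if "m \<in> I" for m
    proof -
      consider "m = i" | "m = j" | "m = k" | "m = l" | "m \<in> W" using \<open>m \<in> I\<close> by blast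
      then show ?thesis by cases (use d ne yy in auto)
    qed
    then show False using tf z r unfolding R_def transversal_free_def by blast
  next
    show "R x (x i) (x j) (x k) (x l)" using x unfolding R_def by simp
  qed
  moreover have "x(i := add4 (x i) c1, j := add4 (x j) c3, k := x k, l := x l) = rot i j x"
    unfolding rot_def using ne by (auto simp: fun_eq_iff)
  ultimately show ?thesis unfolding R_def by simp
qed

lemma rot_rot: "rot i j (rot i j (rot i j (rot i j x))) = x"
proof -
  have "add4 (add4 (add4 (add4 v c1) c1) c1) c1 = v" "add4 (add4 (add4 (add4 v c3) c3) c3) c3 = v" for v
    by (rule q_exhaust[of v]; simp add: add4_def)+
  then show ?thesis unfolding rot_def using ne by (simp add: fun_eq_iff)
qed

lemma rot_upd: "m \<in> W \<Longrightarrow> rot i j (x(m := v)) = (rot i j x)(m := v)" "m \<in> W \<Longrightarrow> rot i j x m = x m"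
  unfolding rot_def by (auto simp: fun_eq_iff)

text \<open>Induction on the zeros in \<open>W\<close>. Suppose \<open>x m\<close> is zero but the
  rotated word needs \<open>v \<noteq> c0\<close> at \<open>m\<close>. Then \<open>x(m := v)\<close>
  has fewer zeros and its rotation is a codeword; three more rotations lead back to
  \<open>x(m := v)\<close> itself, which cannot be a codeword besides \<open>x\<close>.\<close>

lemma rot_invariant: "M x \<Longrightarrow> M (rot i j x)"
proof (induction "card {m\<in>W. x m = c0}" arbitrary: x rule: less_induct)
  case less
  show ?case
  proof (cases "\<exists>m\<in>W. x m = c0")
    case True
    then obtain m where m: "m \<in> W" "x m = c0" by blast
    obtain v where v: "M ((rot i j x)(m := v))" using mds_ex[OF M] m(1) by blast
    show ?thesis
    proof (cases "v = c0")
      case True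
      then have "(rot i j x)(m := v) = rot i j x" using rot_upd(2)[OF m(1), of x] m(2) by (metis fun_upd_triv)
      then show ?thesis using v by simp
    next
      case False
      define z where "z = x(m := v)"
      have zeros: "{p\<in>W. z' p = c0} \<subset> {p\<in>W. x p = c0}" if "\<And>p. p \<in> W \<Longrightarrow> z' p = z p" for z'
      proof (rule psubsetI)
        have zp: "z' p = (if p = m then v else x p)" if "p \<in> W" for p
          using \<open>\<And>p. p \<in> W \<Longrightarrow> z' p = z p\<close>[OF that] unfolding z_def by simp
        show "{p\<in>W. z' p = c0} \<subseteq> {p\<in>W. x p = c0}"
        proof
          fix p assume "p \<in> {p\<in>W. z' p = c0}"
          then have p: "p \<in> W" "z' p = c0" by blast+
          then have "x p = c0" using zp[OF p(1)] False by (metis (full_types))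
          then show "p \<in> {p\<in>W. x p = c0}" using p(1) by blast
        qed
        have "z' m \<noteq> c0" using zp[OF m(1)] False by simp
        then show "{p\<in>W. z' p = c0} \<noteq> {p\<in>W. x p = c0}" using m by blast
      qed
      have fW: "finite {p\<in>W. x p = c0}" using fin by simp
      have step: "M (rot i j z')" if "M z'" "\<And>p. p \<in> W \<Longrightarrow> z' p = z p" for z'
        using less.hyps[OF psubset_card_mono[OF fW zeros[OF that(2)]] that(1)] .
      have z1: "M (rot i j z)" using v rot_upd(1)[OF m(1)] unfolding z_def by simp
      have z2: "M (rot i j (rot i j z))" using step[OF z1] rot_upd(2) by blast
      have z3: "M (rot i j (rot i j (rot i j z)))" using step[OF z2] rot_upd(2) by simp
      have "M (rot i j (rot i j (rot i j (rot i j z))))" using step[OF z3] rot_upd(2) by simp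
      then have "M (x(m := v))" unfolding rot_rot z_def .
      then have "v = x m" using mds_unique_self[OF M _ less.prems] m(1) by blast
      then show ?thesis using False m(2) by simp
    qed
  next
    case False
    then show ?thesis using rot_far less.prems by blast
  qed
qed

lemma rot_any:
  assumes "M (x(i := a, j := b))"
  shows "M (x(i := add4 a v, j := add4 b (neg4 v)))"
proof -
  have step: "M (x(i := add4 a c1, j := add4 b c3))" if "M (x(i := a, j := b))" for a b
    using rot_invariant[OF that] ne unfolding rot_def by (simp add: fun_upd_twist)
  have "add4 (add4 u c1) c1 = add4 u c2" "add4 (add4 u c3) c3 = add4 u c2"
    "add4 (add4 u c2) c1 = add4 u c3" "add4 (add4 u c2) c3 = add4 u c1" for u
    unfolding add4_assoc by (simp_all add: add4_def)
  note r = this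
  have 1: "M (x(i := add4 a c1, j := add4 b c3))" using step[OF assms] .
  have 2: "M (x(i := add4 a c2, j := add4 b c2))" using step[OF 1] unfolding r .
  have 3: "M (x(i := add4 a c3, j := add4 b c1))" using step[OF 2] unfolding r .
  show ?thesis by (rule q_exhaust[of v]) (use assms 1 2 3 in \<open>simp_all add: neg4_def\<close>)
qed

text \<open>Rotation invariance leaves only the sum of the letters at \<open>i\<close> and
  \<open>j\<close> relevant; \<open>layer t\<close> represents the words with sum
  \<open>t\<close>.\<close>

definition layer :: "q \<Rightarrow> ('i \<Rightarrow> q) \<Rightarrow> bool" where
  "layer t x \<longleftrightarrow> M (x(i := c0, j := t))"

text \<open>A transversal of a layer would lift to \<open>M\<close>: its four words receive the
  letters \<open>v\<close> at \<open>i\<close> and \<open>t - v\<close> at \<open>j\<close>, with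
  \<open>v\<close> running through the alphabet.\<close>

lemma layer_code: "odd (card (I - {i, j}))" "Z4_code (I - {i, j}) (layer t)"
proof -
  have "I - {i, j} = I - {j} - {i}" by auto
  moreover have "layer t = subcode i c0 (subcode j t M)"
    unfolding layer_def subcode_def by auto
  ultimately have m: "mds (I - {i, j}) (layer t)" using mds_subcode[OF mds_subcode[OF M]] by metis
  have tfl: "transversal_free (I - {i, j}) (layer t)"
    unfolding transversal_free_def
  proof (intro notI, elim exE conjE)
    fix x1 x2 x3 x4 assume L: "layer t x1" "layer t x2" "layer t x3" "layer t x4"
      and d: "\<forall>m\<in>I - {i, j}. distinct [x1 m, x2 m, x3 m, x4 m]"
    let ?x = "\<lambda>x v. x(i := add4 c0 v, j := add4 t (neg4 v))"
    have X: "M (?x x1 c0)" "M (?x x2 c1)" "M (?x x3 c2)" "M (?x x4 c3)"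
      by (rule L[unfolded layer_def, THEN rot_any])+
    have "distinct [?x x1 c0 m, ?x x2 c1 m, ?x x3 c2 m, ?x x4 c3 m]" if "m \<in> I" for m
    proof -
      consider "m = i" | "m = j" | "m \<in> I - {i, j}" using \<open>m \<in> I\<close> by blast
      then show ?thesis
      proof cases
        case 2
        have "distinct [add4 t (neg4 c0), add4 t (neg4 c1), add4 t (neg4 c2), add4 t (neg4 c3)]"
          by (rule q_exhaust[of t]) (simp_all add: add4_def neg4_def)
        then show ?thesis using 2 by simp
      qed (use d ne in auto)
    qed
    then show False using tf X unfolding transversal_free_def by blast
  qed
  have "card (I - {i, j}) < card I" using I fin by (intro psubset_card_mono) auto
  moreover have "I - {i, j} \<noteq> {}" using I ne by auto
  ultimately show "odd (card (I - {i, j}))" "Z4_code (I - {i, j}) (layer t)"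
    using IH[OF _ _ m tfl] by blast+
qed

lemma rot_layer: "layer t x \<Longrightarrow> layer t (x(k := add4 (x k) v, l := add4 (x l) (neg4 v)))"
proof -
  assume "layer t x"
  then have "M ((x(i := c0, j := t))(k := x k, l := x l))" unfolding layer_def using ne by (simp add: fun_upd_idem)
  from twisted_code.rot_any[OF swap this, of v]
  have r: "M ((x(i := c0, j := t))(k := add4 (x k) v, l := add4 (x l) (neg4 v)))" .
  have eq: "(x(k := add4 (x k) v, l := add4 (x l) (neg4 v)))(i := c0, j := t) =
      (x(i := c0, j := t))(k := add4 (x k) v, l := add4 (x l) (neg4 v))"
    using ne by (auto simp: fun_eq_iff)
  show ?thesis unfolding layer_def eq by (rule r)
qed

lemma labels:
  obtains \<sigma> where "\<And>t m. m \<in> I - {i, j} \<Longrightarrow> bij_betw (\<sigma> t m) UNIV {..<(4 :: nat)}"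
    "\<And>t x. layer t x \<longleftrightarrow> 4 dvd (\<Sum>m\<in>I - {i, j}. \<sigma> t m (x m))"
proof -
  have "\<forall>t. \<exists>\<sigma> :: 'i \<Rightarrow> q \<Rightarrow> nat. (\<forall>m\<in>I - {i, j}. bij_betw (\<sigma> m) UNIV {..<4}) \<and>
      (\<forall>x. layer t x \<longleftrightarrow> 4 dvd (\<Sum>m\<in>I - {i, j}. \<sigma> m (x m)))"
    using layer_code(2) unfolding Z4_code_def by blast
  from choice[OF this] show ?thesis using that by blast
qed

text \<open>Adding 2 modulo 4 at both \<open>k\<close> and \<open>l\<close> is a power of their
  rotation, and it is also the translation by \<open>c2\<close> in the Klein four-group.\<close>

lemma half_label:
  assumes "\<And>m. m \<in> I - {i, j} \<Longrightarrow> bij_betw (\<sigma> m) UNIV {..<(4 :: nat)}"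
    "\<And>x. layer t x \<longleftrightarrow> 4 dvd (\<Sum>m\<in>I - {i, j}. \<sigma> m (x m))" and r: "r \<in> W"
  shows "half (\<sigma> k) c2"
proof (rule half_if_pair_shift[where J = "I - {i, j}" and q' = l and r = r and C = 0 and N = "layer t" and b = c2])
  show "layer t (x(k := x k \<oplus> c2, l := x l \<oplus> c2))" if "layer t x" for x
  proof -
    have "add4 v c2 = v \<oplus> c2" "add4 v (neg4 c2) = v \<oplus> c2" for v by (auto simp: add4_def neg4_def xor_def)
    then show ?thesis using rot_layer[OF that, of c2] by simp
  qed
qed (use assms fin I ne in auto)

lemma card_W: "card W + 4 = card I"
proof -
  have "card {i, j, k, l} = 4" using ne by simp
  then show ?thesis using I fin card_mono[of I "{i, j, k, l}"] by (simp add: card_Diff_subset)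
qed

lemma odd_card_W: "odd (card W)"
proof -
  have "card (I - {i, j}) + 2 = card I" using I fin ne card_mono[of I "{i, j}"] by (simp add: card_Diff_subset)
  then have "card (I - {i, j}) = card W + 2" using card_W by simp
  then show ?thesis using layer_code(1) by simp
qed

text \<open>Fixing the sum at \<open>i\<close>, \<open>j\<close> and the sum at \<open>k\<close>,
  \<open>l\<close> gives a subcode on \<open>W\<close> that belongs to layers of both kinds. With
  three coordinates in \<open>W\<close>, the half turns at \<open>m\<close> therefore agree for all
  layers. Adding 2 to the sum at \<open>k\<close>, \<open>l\<close> is compensated by this half
  turn, and so is adding 2 to the sum at \<open>i\<close>, \<open>j\<close>. Hence
  \<open>twist\<close> would commute with adding 2, but it sends 0 to 1 and 2 to 2.\<close>

lemma card_W_less_3: "\<not> card W \<ge> 3"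
proof
  assume "card W \<ge> 3"
  then obtain W' where "W' \<subseteq> W" "card W' = 3" using obtain_subset_with_card_n by metis
  then obtain m m2 r where W': "m \<in> W" "m2 \<in> W" "r \<in> W" "m \<noteq> m2" "m \<noteq> r" "m2 \<noteq> r"
    by (auto simp: card_3_iff)
  let ?J = "I - {i, j}" and ?J' = "I - {k, l}" and ?layer' = "twisted_code.layer M k l"
  interpret s: twisted_code I M k l i j by (rule swap)
  obtain \<sigma> where \<sigma>: "\<And>t m. m \<in> ?J \<Longrightarrow> bij_betw (\<sigma> t m) UNIV {..<(4 :: nat)}"
    "\<And>t x. layer t x \<longleftrightarrow> 4 dvd (\<Sum>m\<in>?J. \<sigma> t m (x m))" by (rule labels) blast
  obtain \<tau> where \<tau>: "\<And>t m. m \<in> ?J' \<Longrightarrow> bij_betw (\<tau> t m) UNIV {..<(4 :: nat)}"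
    "\<And>t x. s.layer t x \<longleftrightarrow> 4 dvd (\<Sum>m\<in>?J'. \<tau> t m (x m))" by (rule s.labels) blast
  have r': "r \<in> I - {k, l, i, j}" using W' by auto
  have hk: "half (\<sigma> t k) c2" for t by (rule half_label[OF \<sigma> W'(3)])
  have hi: "half (\<tau> t i) c2" for t by (rule s.half_label[OF \<tau> r'])
  have mJ: "m \<in> ?J" "m2 \<in> ?J" "r \<in> ?J" "k \<in> ?J" "l \<in> ?J" "m \<in> ?J'" "m2 \<in> ?J'" "i \<in> ?J'" using W' I ne by auto
  have mne: "m \<noteq> i" "m \<noteq> j" "m \<noteq> k" "m \<noteq> l" "m2 \<noteq> i" "m2 \<noteq> j" "m2 \<noteq> k" "m2 \<noteq> l" using W' by auto
  have half\<sigma>: "half (\<sigma> t m) a" if a: "half (\<tau> s m) a" for t s a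
  proof -
    have a0: "a \<noteq> c0"
    proof
      assume "a = c0"
      then have "\<tau> s m c0 mod 4 = (\<tau> s m c0 + 2) mod 4" using a unfolding half_def by (metis xor_simps(1))
      then show False using label_less[OF \<tau>(1)[OF mJ(6)], of s c0] by presburger
    qed
    obtain b where b: "half (\<tau> s m2) b" using half_ex[OF \<tau>(1)[OF mJ(7)]] by blast
    define N where "N x = layer t (x(k := c0, l := s))" for x
    show ?thesis
    proof (rule half_if_pair_shift[where J = W and q' = m2 and r = r and C = "\<sigma> t k c0 + \<sigma> t l s" and N = N and b = b])
      show "N x \<longleftrightarrow> 4 dvd \<sigma> t k c0 + \<sigma> t l s + (\<Sum>m\<in>W. \<sigma> t m (x m))" for x
      proof -
        have "(\<Sum>m\<in>?J. \<sigma> t m ((x(k := c0, l := s)) m)) =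
            (\<Sum>m\<in>?J - {k, l}. \<sigma> t m ((x(k := c0, l := s)) m)) + (\<Sum>m\<in>{k, l}. \<sigma> t m ((x(k := c0, l := s)) m))"
          using fin mJ by (intro sum.subset_diff) auto
        also have "?J - {k, l} = W" by auto
        also have "(\<Sum>m\<in>W. \<sigma> t m ((x(k := c0, l := s)) m)) = (\<Sum>m\<in>W. \<sigma> t m (x m))" by (intro sum.cong) auto
        also have "(\<Sum>m\<in>{k, l}. \<sigma> t m ((x(k := c0, l := s)) m)) = \<sigma> t k c0 + \<sigma> t l s" using ne by simp
        finally show ?thesis unfolding N_def \<sigma>(2) by (simp only: add.commute)
      qed
    next
      fix x assume x: "N x"
      have L: "N x \<longleftrightarrow> s.layer s (x(i := c0, j := t))" for x
        unfolding N_def layer_def s.layer_def using ne by (simp add: fun_upd_twist)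
      have "s.layer s ((x(i := c0, j := t))(m := (x(i := c0, j := t)) m \<oplus> a, m2 := (x(i := c0, j := t)) m2 \<oplus> b))"
        using x[unfolded L \<tau>(2)] unfolding \<tau>(2)
        by (intro pair_shift_if_half[OF _ mJ(6,7) W'(4) a b]) (use fin in auto)
      moreover have "(x(i := c0, j := t))(m := (x(i := c0, j := t)) m \<oplus> a, m2 := (x(i := c0, j := t)) m2 \<oplus> b) =
          (x(m := x m \<oplus> a, m2 := x m2 \<oplus> b))(i := c0, j := t)"
        using mne by (auto simp: fun_eq_iff)
      ultimately show "N (x(m := x m \<oplus> a, m2 := x m2 \<oplus> b))" unfolding L by simp
    qed (use W' fin \<sigma> a0 in auto)
  qed
  obtain a where a: "half (\<tau> c3 m) a" using half_ex[OF \<tau>(1)[OF mJ(6)]] by blast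
  have a': "half (\<sigma> c0 m) a" using half\<sigma>[OF a] .
  let ?x0 = "(\<lambda>_. c0)(k := c1)"
  have "M ?x0" by (subst tw) (use ne in \<open>auto simp: twisted_def add4_def twist_def\<close>)
  moreover have "?x0(i := c0, j := c0) = ?x0" using ne by (auto simp: fun_eq_iff)
  ultimately have "layer c0 ?x0" unfolding layer_def by simp
  then have "layer c0 (?x0(k := ?x0 k \<oplus> c2, m := ?x0 m \<oplus> a))"
    unfolding \<sigma>(2) by (intro pair_shift_if_half[OF _ mJ(4,1) _ hk a']) (use fin mne in auto)
  moreover have "?x0(k := ?x0 k \<oplus> c2, m := ?x0 m \<oplus> a) = (\<lambda>_. c0)(k := c3, m := a)"
    using mne by (auto simp: fun_eq_iff xor_def)
  moreover have "((\<lambda>_. c0)(k := c3, m := a))(i := c0, j := c0) = (\<lambda>_. c0)(m := a, k := c3, l := c0)"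
    using mne ne by (auto simp: fun_eq_iff)
  ultimately have "M (((\<lambda>_. c0)(m := a))(k := c3, l := c0))" unfolding layer_def by simp
  \<comment> \<open>Rotation replaces the letters \<open>c3\<close>, \<open>c0\<close> at
    \<open>k\<close>, \<open>l\<close> by \<open>c0\<close>, \<open>c3\<close>, so the word now
    appears in a layer for the other pair.\<close>
  from s.rot_any[OF this, of c1] have "s.layer c3 ((\<lambda>_. c0)(m := a))"
    unfolding s.layer_def by (simp add: add4_def neg4_def)
  then have "s.layer c3 (((\<lambda>_. c0)(m := a))(i := ((\<lambda>_. c0)(m := a)) i \<oplus> c2, m := ((\<lambda>_. c0)(m := a)) m \<oplus> a))"
    unfolding \<tau>(2) by (intro pair_shift_if_half[OF _ mJ(8,6) _ hi a]) (use fin mne in auto)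
  moreover have "((\<lambda>_. c0)(m := a))(i := ((\<lambda>_. c0)(m := a)) i \<oplus> c2, m := ((\<lambda>_. c0)(m := a)) m \<oplus> a) = (\<lambda>_. c0)(i := c2)"
    using mne by (auto simp: fun_eq_iff)
  ultimately have "M ((\<lambda>_. c0)(i := c2, k := c0, l := c3))" unfolding s.layer_def by simp
  moreover have "M ((\<lambda>_. c0)(i := c2, k := c0, l := c3)) = twisted c2 c0 c0 c3"
    by (subst tw) (use ne in auto)
  ultimately show False by (simp add: twisted_def add4_def twist_def)
qed

text \<open>Up to rotations a codeword is given by the sums \<open>t\<close> and \<open>s\<close> at
  the two pairs and its letter at \<open>w\<close>, so \<open>L\<close> is a Latin square with
  \<open>twist\<close> over the letter \<open>c0\<close>. By \<open>Z4_sum_of_permutations\<close>,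
  four triples in \<open>L\<close> with different letters at \<open>w\<close> lift to a transversal
  of \<open>M\<close> if both kinds of sums add up to zero. The certificate shows that no Latin
  square avoids this.\<close>

lemma card_W_neq_1: "card W \<noteq> 1"
proof
  assume "card W = 1"
  then obtain w where W: "W = {w}" by (auto simp: card_1_singleton_iff)
  have w: "w \<in> I" "w \<noteq> i" "w \<noteq> j" "w \<noteq> k" "w \<noteq> l" using W by auto
  have Ieq: "I = {i, j, k, l, w}" using W I by auto
  define z where "z t s v = ((\<lambda>_. c0)(j := t, l := s, w := v) :: 'i \<Rightarrow> q)" for t s v
  define L where "L t s v = M (z t s v)" for t s v
  have zt: "z t s v = (z c0 s v)(j := t)" and zs: "z t s v = (z t c0 v)(l := s)" and zv: "z t s v = (z t s c0)(w := v)" for t s v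
    unfolding z_def using w ne by (auto simp: fun_eq_iff)
  have jlw: "j \<in> I" "l \<in> I" "w \<in> I" using I w by auto
  have un: "t = t'" if "L t s v" "L t' s v" for t t' s v
    using mds_unique[OF M jlw(1)] that unfolding L_def by (metis zt)
  have us: "s = s'" if "L t s v" "L t s' v" for t s s' v
    using mds_unique[OF M jlw(2)] that unfolding L_def by (metis zs)
  have uv: "v = v'" if "L t s v" "L t s v'" for t s v v'
    using mds_unique[OF M jlw(3)] that unfolding L_def by (metis zv)
  have et: "\<exists>t. L t s v" for s v using mds_ex[OF M jlw(1), of "z c0 s v"] unfolding L_def by (metis zt)
  have es: "\<exists>s. L t s v" for t v using mds_ex[OF M jlw(2), of "z t c0 v"] unfolding L_def by (metis zs)
  have ev: "\<exists>v. L t s v" for t s using mds_ex[OF M jlw(3), of "z t s c0"] unfolding L_def by (metis zv)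
  have four: "P c0 \<or> P c1 \<or> P c2 \<or> P c3" if "\<exists>v. P v" for P :: "q \<Rightarrow> bool"
    using that by (metis q_exhaust)
  have z0: "L t (twist t) c0" for t
    unfolding L_def by (subst tw) (use W w ne in \<open>auto simp: z_def twisted_def\<close>)
  have lift: "M ((z t s v)(i := a, j := add4 t (neg4 a), k := c, l := add4 s (neg4 c)))" if "L t s v" for t s v a c
  proof -
    have "(z t s v)(i := c0, j := t) = z t s v" unfolding z_def using w ne by (auto simp: fun_eq_iff)
    then have "M ((z t s v)(i := add4 c0 a, j := add4 t (neg4 a)))" using rot_any[of "z t s v" c0 t a] that unfolding L_def by simp
    moreover have "(z t s v)(i := add4 c0 a, j := add4 t (neg4 a)) =
        ((z t s v)(i := a, j := add4 t (neg4 a)))(k := c0, l := s)"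
      unfolding z_def using w ne by (auto simp: fun_eq_iff)
    ultimately have "M (((z t s v)(i := a, j := add4 t (neg4 a)))(k := c0, l := s))" by simp
    from twisted_code.rot_any[OF swap this, of c] show ?thesis unfolding add4_zero .
  qed
  show False
  proof (rule latin_certificate[of L])
    show "\<not> L t s v \<or> \<not> L t' s v" if "t \<noteq> t'" for t t' s v using un that by blast
    show "\<not> L t s v \<or> \<not> L t s' v" if "s \<noteq> s'" for s s' t v using us that by blast
    show "\<not> L t s v \<or> \<not> L t s v'" if "v \<noteq> v'" for v v' t s using uv that by blast
    show "L c0 s v \<or> L c1 s v \<or> L c2 s v \<or> L c3 s v" for s v by (rule four[OF et])
    show "L t c0 v \<or> L t c1 v \<or> L t c2 v \<or> L t c3 v" for t v by (rule four[OF es])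
    show "L t s c0 \<or> L t s c1 \<or> L t s c2 \<or> L t s c3" for t s by (rule four[OF ev])
    show "L t (twist t) c0" for t by (rule z0)
  next
    fix t1 s1 t2 s2 t3 s3
    assume eq: "twist (neg4 (add4 t1 (add4 t2 t3))) = neg4 (add4 s1 (add4 s2 s3))"
    show "\<not> L t1 s1 c1 \<or> \<not> L t2 s2 c2 \<or> \<not> L t3 s3 c3"
    proof (rule ccontr)
      assume "\<not> ?thesis"
      then have Ls: "L t1 s1 c1" "L t2 s2 c2" "L t3 s3 c3" by blast+
      \<comment> \<open>The triple over \<open>c0\<close> that makes both totals vanish; it lies in
        \<open>L\<close> by the assumption \<open>eq\<close>.\<close>
      define t0 s0 where "t0 = neg4 (add4 t1 (add4 t2 t3))" and "s0 = neg4 (add4 s1 (add4 s2 s3))"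
      have L0: "L t0 s0 c0" using z0[of t0] eq unfolding t0_def s0_def by simp
      obtain a0 a1 a2 a3 where a: "distinct [a0, a1, a2, a3]"
        "distinct [add4 t0 (neg4 a0), add4 t1 (neg4 a1), add4 t2 (neg4 a2), add4 t3 (neg4 a3)]"
        using Z4_sum_of_permutations[OF t0_def] by blast
      obtain b0 b1 b2 b3 where b: "distinct [b0, b1, b2, b3]"
        "distinct [add4 s0 (neg4 b0), add4 s1 (neg4 b1), add4 s2 (neg4 b2), add4 s3 (neg4 b3)]"
        using Z4_sum_of_permutations[OF s0_def] by blast
      define X where "X t s v a c = (z t s v)(i := a, j := add4 t (neg4 a), k := c, l := add4 s (neg4 c))" for t s v a c
      have Xv: "X t s v a c i = a" "X t s v a c j = add4 t (neg4 a)" "X t s v a c k = c" "X t s v a c l = add4 s (neg4 c)" "X t s v a c w = v" for t s v a c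
        unfolding X_def z_def using w ne by simp_all
      have "\<forall>m\<in>I. distinct [X t0 s0 c0 a0 b0 m, X t1 s1 c1 a1 b1 m, X t2 s2 c2 a2 b2 m, X t3 s3 c3 a3 b3 m]"
        unfolding Ieq using a b by (simp add: Xv)
      moreover have "M (X t0 s0 c0 a0 b0)" "M (X t1 s1 c1 a1 b1)" "M (X t2 s2 c2 a2 b2)" "M (X t3 s3 c3 a3 b3)"
        unfolding X_def using lift L0 Ls by blast+
      ultimately show False using tf unfolding transversal_free_def by blast
    qed
  qed
qed

lemma contradiction: False
proof -
  have "card W \<noteq> 0" "card W \<noteq> 2" using odd_card_W by (metis even_zero, metis even_numeral)
  then show False using card_W_neq_1 card_W_less_3 by linarith
qed

end

section \<open>Induction on the number of coordinates\<close>

lemma Z4_code_if_semilinear: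
  assumes M: "mds I M" and ne: "I \<noteq> {}" and tf: "transversal_free I M" and sl: "semilinear I M"
  shows "odd (card I) \<and> Z4_code I M"
proof -
  obtain \<alpha>0 where \<alpha>0: "\<And>i. i \<in> I \<Longrightarrow> \<alpha>0 i \<noteq> c0" "invariant I M \<alpha>0" using sl unfolding semilinear_def by blast
  \<comment> \<open>The value \<open>c2\<close> outside \<open>I\<close> is a default that makes all
    labels bijective; \<open>\<gamma> i\<close> is just another nonzero letter.\<close>
  define \<alpha> where "\<alpha> i = (if i \<in> I then \<alpha>0 i else c2)" for i
  define \<gamma> where "\<gamma> i = (if \<alpha> i = c1 then c2 else c1)" for i
  have \<alpha>: "\<alpha> i \<noteq> c0" "\<gamma> i \<noteq> c0" "\<gamma> i \<noteq> \<alpha> i" for i using \<alpha>0(1) unfolding \<alpha>_def \<gamma>_def by auto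
  have inv: "invariant I M \<alpha>" by (rule invariant_cong[OF \<alpha>0(2)]) (simp add: \<alpha>_def)
  obtain x0 where x0: "M x0" using mds_ex[OF M] ne by blast
  define \<phi> where "\<phi> i = aff (x0 i) (\<gamma> i) (\<alpha> i)" for i
  have \<phi>: "bij (\<phi> i)" for i unfolding \<phi>_def by (rule bij_aff[OF \<alpha>(2,1,3)])
  define N where "N x = M (\<lambda>i. \<phi> i (x i))" for x
  interpret N: normal_semilinear I N
  proof
    show "mds I N" unfolding N_def by (rule mds_relabel[OF M \<phi>])
    show "N (\<lambda>_. c0)" using x0 unfolding N_def \<phi>_def aff_simps .
    show "I \<noteq> {}" by (rule ne)
    show "invariant I N (\<lambda>_. c2)"
    proof (rule invariantI)
      fix x i j assume ij: "i \<in> I" "j \<in> I" "i \<noteq> j" and "N x"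
      then have "M (sh \<alpha> i j (\<lambda>i. \<phi> i (x i)))" unfolding N_def by (intro invariantD[OF inv])
      also have "sh \<alpha> i j (\<lambda>i. \<phi> i (x i)) = (\<lambda>m. \<phi> m (sh (\<lambda>_. c2) i j x m))"
        by (rule ext) (simp add: sh_apply \<phi>_def aff_simps(4))
      finally show "N (sh (\<lambda>_. c2) i j x)" unfolding N_def .
    qed
  qed
  have "transversal_free I N" unfolding N_def by (rule transversal_free_relabel[OF tf \<phi>])
  from N.Z4_code_if_transversal_free[OF this] show ?thesis
    using Z4_code_relabel[of I M \<phi>, OF _ \<phi>] unfolding N_def by blast
qed

text \<open>Semilinearity is shown for each size. A single coordinate has no pairs to shift; two
  coordinates carry a permutation, whose graph is a transversal; three form a Latin square. From
  four coordinates on, a quaternary subcode that is not semilinear produces the refuted situation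
  \<open>twisted_code\<close>.\<close>

theorem Z4_code_if_transversal_free:
  assumes "mds I M" "I \<noteq> {}" "transversal_free I M"
  shows "odd (card I) \<and> Z4_code I M"
  using assms
proof (induction "card I" arbitrary: I M rule: less_induct)
  case less
  note M = less.prems(1) and ne = less.prems(2) and tf = less.prems(3)
  have fin: "finite I" using mds_finite[OF M] .
  have "card I \<noteq> 0" using ne fin by simp
  then consider "card I = 1" | "card I = 2" | "card I = 3" | "card I \<ge> 4" by linarith
  then have "semilinear I M"
  proof cases
    case 1
    then obtain i where "I = {i}" by (auto simp: card_1_singleton_iff)
    then have "invariant I M (\<lambda>_. c1)" unfolding invariant_def by simp
    then show ?thesis unfolding semilinear_def by (intro exI[of _ "\<lambda>_. c1"]) simp
  next
    case 2
    then obtain i j where I: "I = {i, j}" "i \<noteq> j" by (auto simp: card_2_iff)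
    have "\<exists>p. \<forall>v. M (((\<lambda>_. c0)(i := v))(j := p v))" using mds_ex[OF M, of j] I by (intro choice) blast
    then obtain p where p: "\<And>v. M ((\<lambda>_. c0)(i := v, j := p v))" by blast
    have "p v \<noteq> p v'" if "v \<noteq> v'" for v v'
    proof
      assume "p v = p v'"
      then have "M (((\<lambda>_. c0)(j := p v))(i := v))" "M (((\<lambda>_. c0)(j := p v))(i := v'))"
        using p[of v] p[of v'] I(2) by (simp_all add: fun_upd_twist)
      then show False using mds_unique[OF M, of i] I that by blast
    qed
    then have "\<forall>m\<in>I. distinct [((\<lambda>_. c0)(i := c0, j := p c0)) m, ((\<lambda>_. c0)(i := c1, j := p c1)) m,
        ((\<lambda>_. c0)(i := c2, j := p c2)) m, ((\<lambda>_. c0)(i := c3, j := p c3)) m]"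
      using I by simp
    then show ?thesis using tf p unfolding transversal_free_def by blast
  next
    case 3
    then show ?thesis by (rule square_semilinear[OF M])
  next
    case 4
    show ?thesis
    proof (rule semilinear_if_quaternary_semilinear[OF M 4])
      fix T w assume T: "T \<subseteq> I" "card T = 4"
      show "semilinear T (restrict_code T w M)"
      proof (rule ccontr)
        assume ns: "\<not> semilinear T (restrict_code T w M)"
        obtain i j k l \<phi> where t: "T = {i, j, k, l}" "distinct [i, j, k, l]" "\<And>m. bij (\<phi> m)"
          "\<And>x. restrict_code T w M (\<lambda>m. \<phi> m (x m)) = twisted (x i) (x j) (x k) (x l)"
          using twisted_form[OF mds_restrict_code[OF M T(1)] T(2) ns] by blast
        \<comment> \<open>Outside \<open>T\<close> the labels move \<open>w\<close> to zero, where
          \<open>twisted_code\<close> expects the twisted subcode.\<close>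
        define \<psi> where "\<psi> m = (if m \<in> T then \<phi> m else (\<lambda>v. v \<oplus> w m))" for m
        have \<psi>: "bij (\<psi> m)" for m
        proof -
          have "bij (\<lambda>v. v \<oplus> w m)" by (rule o_bij[of "\<lambda>v. v \<oplus> w m"]) (simp_all add: fun_eq_iff)
          then show ?thesis using t(3) unfolding \<psi>_def by simp
        qed
        have "twisted_code I (\<lambda>x. M (\<lambda>m. \<psi> m (x m))) i j k l"
        proof
          show "mds I (\<lambda>x. M (\<lambda>m. \<psi> m (x m)))" by (rule mds_relabel[OF M \<psi>])
          show "transversal_free I (\<lambda>x. M (\<lambda>m. \<psi> m (x m)))" by (rule transversal_free_relabel[OF tf \<psi>])
          show "{i, j, k, l} \<subseteq> I" "distinct [i, j, k, l]" using T(1) t(1,2) by simp_all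
          show "odd (card J) \<and> Z4_code J N" if "card J < card I" "J \<noteq> {}" "mds J N" "transversal_free J N"
            for J and N :: "('a \<Rightarrow> q) \<Rightarrow> bool"
            using less.hyps that by blast
        next
          fix x :: "'a \<Rightarrow> q" assume x: "\<And>m. m \<in> I - {i, j, k, l} \<Longrightarrow> x m = c0"
          have "M (\<lambda>m. \<psi> m (x m)) = M (override_on w (\<lambda>m. \<phi> m (x m)) T)"
          proof (rule mds_agree[OF M])
            fix m assume "m \<in> I"
            then show "\<psi> m (x m) = override_on w (\<lambda>m. \<phi> m (x m)) T m"
              using x[of m] unfolding t(1)[symmetric] \<psi>_def override_on_def by auto
          qed
          also have "\<dots> = twisted (x i) (x j) (x k) (x l)" using t(4) unfolding restrict_code_def .
          finally show "M (\<lambda>m. \<psi> m (x m)) = twisted (x i) (x j) (x k) (x l)" .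
        qed
        then show False by (rule twisted_code.contradiction)
      qed
    qed
  qed
  then show ?case by (rule Z4_code_if_semilinear[OF M ne tf])
qed

section \<open>Quasigroups as codes\<close>

definition encode :: "q \<Rightarrow> nat" where
  "encode v = of_bool (fst v) + 2 * of_bool (snd v)"

lemma bij_encode: "bij_betw encode UNIV {..<4}"
  unfolding bij_betw_def
proof
  show "inj encode" by (rule injI) (auto simp: encode_def of_bool_def split: if_splits)
  show "range encode = {..<4}"
  proof
    show "range encode \<subseteq> {..<4}" by (auto simp: encode_def of_bool_def)
    show "{..<4} \<subseteq> range encode"
    proof
      fix v :: nat assume "v \<in> {..<4}"
      then have "v = 0 \<or> v = 1 \<or> v = 2 \<or> v = 3" unfolding lessThan_iff by linarith
      then have "v = encode (odd v, 2 \<le> v)" by (elim disjE) (simp_all add: encode_def)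
      then show "v \<in> range encode" by (rule range_eqI)
    qed
  qed
qed

definition decode :: "nat \<Rightarrow> q" where
  "decode = the_inv_into UNIV encode"

lemma decode_encode [simp]: "decode (encode v) = v"
  unfolding decode_def by (rule the_inv_into_f_f) (use bij_encode in \<open>auto simp: bij_betw_def\<close>)

lemma encode_decode [simp]: "v < 4 \<Longrightarrow> encode (decode v) = v"
  unfolding decode_def by (rule f_the_inv_into_f) (use bij_encode in \<open>auto simp: bij_betw_def\<close>)

lemma encode_less [simp]: "encode v < 4"
  using bij_encode by (auto simp: bij_betw_def)

lemma encode_eq_iff [simp]: "encode v = encode w \<longleftrightarrow> v = w"
  by (metis decode_encode)

definition word :: "nat \<Rightarrow> (nat \<Rightarrow> q) \<Rightarrow> nat \<Rightarrow> nat" where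
  "word n x = (\<lambda>i\<in>{0..n}. encode (x i))"

lemma word_PiE: "word n x \<in> {0..n} \<rightarrow>\<^sub>E {..<4}"
  by (simp add: word_def)

lemma word_apply: "i \<le> n \<Longrightarrow> word n x i = encode (x i)"
  by (simp add: word_def)

lemma mds_quasigroup:
  assumes f: "nary_quasigroup n 4 f"
  shows "mds {0..n} (\<lambda>x. satisfies_eq n f (word n x))"
  unfolding mds_def
proof (intro conjI allI impI ballI)
  show "finite {0..n}" by simp
next
  fix x y :: "nat \<Rightarrow> q" assume "\<forall>i\<in>{0..n}. x i = y i"
  then have "word n x = word n y" unfolding word_def by (intro restrict_ext) simp
  then show "satisfies_eq n f (word n x) = satisfies_eq n f (word n y)" by simp
next
  fix k and x :: "nat \<Rightarrow> q" assume k: "k \<in> {0..n}"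
  have upd: "word n (x(k := v)) = (word n x)(k := encode v)" for v
    unfolding word_def using k by (auto simp: fun_eq_iff)
  have "\<exists>!v. v \<in> {..<4} \<and> satisfies_eq n f ((word n x)(k := v))"
    using f k word_PiE[of n x] unfolding nary_quasigroup_def by blast
  then obtain v where v: "v < 4" "satisfies_eq n f ((word n x)(k := v))"
    and uniq: "\<And>v'. v' < 4 \<Longrightarrow> satisfies_eq n f ((word n x)(k := v')) \<Longrightarrow> v' = v"
    by (metis lessThan_iff)
  show "\<exists>!v. satisfies_eq n f (word n (x(k := v)))"
    unfolding upd
  proof (rule ex1I[of _ "decode v"])
    show "satisfies_eq n f ((word n x)(k := encode (decode v)))" using v by simp
    show "u = decode v" if "satisfies_eq n f ((word n x)(k := encode u))" for u
      using uniq[OF encode_less that] by (metis decode_encode)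
  qed
qed

lemma transversal_free_quasigroup:
  assumes nt: "\<not> (\<exists>T. transversal n 4 f T)"
  shows "transversal_free {0..n} (\<lambda>x. satisfies_eq n f (word n x))"
  unfolding transversal_free_def
proof (intro notI, elim exE conjE)
  fix x1 x2 x3 x4
  assume s: "satisfies_eq n f (word n x1)" "satisfies_eq n f (word n x2)" "satisfies_eq n f (word n x3)" "satisfies_eq n f (word n x4)"
    and d: "\<forall>i\<in>{0..n}. distinct [x1 i, x2 i, x3 i, x4 i]"
  let ?w = "word n"
  have dk: "distinct [?w x1 k, ?w x2 k, ?w x3 k, ?w x4 k]" if "k \<in> {0..n}" for k
    using d that by (simp add: word_apply)
  have "distinct [?w x1, ?w x2, ?w x3, ?w x4]" using dk[of 0] by auto
  then have "card (set [?w x1, ?w x2, ?w x3, ?w x4]) = 4" by (subst distinct_card) simp_all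
  moreover have "set [?w x1, ?w x2, ?w x3, ?w x4] \<subseteq> {0..n} \<rightarrow>\<^sub>E {..<4}" using word_PiE by auto
  moreover have "\<forall>a\<in>set [?w x1, ?w x2, ?w x3, ?w x4]. satisfies_eq n f a" using s by simp
  moreover have "\<forall>a\<in>set [?w x1, ?w x2, ?w x3, ?w x4]. \<forall>b\<in>set [?w x1, ?w x2, ?w x3, ?w x4]. a \<noteq> b \<longrightarrow> (\<forall>k\<in>{0..n}. a k \<noteq> b k)"
  proof (intro ballI impI)
    fix a b k assume ab: "a \<in> set [?w x1, ?w x2, ?w x3, ?w x4]" "b \<in> set [?w x1, ?w x2, ?w x3, ?w x4]" "a \<noteq> b"
      and "k \<in> {0..n}"
    from dk[OF this(4)] ab show "a k \<noteq> b k"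
      unfolding list.set insert_iff empty_iff by (elim disjE) simp_all
  qed
  ultimately have "transversal n 4 f (set [?w x1, ?w x2, ?w x3, ?w x4])" unfolding transversal_def by blast
  then show False using nt by blast
qed

lemma Z4_linear_if_Z4_code:
  assumes f: "nary_quasigroup n 4 f" and Z4: "Z4_code {0..n} (\<lambda>x. satisfies_eq n f (word n x))"
  shows "Z4_linear n f"
proof -
  obtain \<sigma> :: "nat \<Rightarrow> q \<Rightarrow> nat" where s: "\<forall>i\<in>{0..n}. bij_betw (\<sigma> i) UNIV {..<4}"
    "\<forall>x. satisfies_eq n f (word n x) \<longleftrightarrow> 4 dvd (\<Sum>i\<in>{0..n}. \<sigma> i (x i))"
    using Z4 unfolding Z4_code_def by blast
  have \<sigma>1: "bij_betw (\<sigma> i) UNIV {..<4}" if "i \<le> n" for i using s(1) that by simp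
  note \<sigma> = \<sigma>1 s(2)[rule_format]
  \<comment> \<open>The identity beyond the alphabet is what \<open>permutes\<close>
    demands.\<close>
  define \<tau> where "\<tau> i v = (if v < 4 then \<sigma> i (decode v) else v)" for i v
  have less: "\<tau> i v < 4" if "i \<le> n" "v < 4" for i v
    using label_less[OF \<sigma>(1)[OF that(1)]] that(2) unfolding \<tau>_def by simp
  have perm: "\<tau> i permutes {..<4}" if "i \<le> n" for i
  proof (rule bij_imp_permutes)
    have "inj_on (\<tau> i) {..<4}"
    proof (rule inj_onI)
      fix v w assume vw: "v \<in> {..<(4 :: nat)}" "w \<in> {..<(4 :: nat)}" and "\<tau> i v = \<tau> i w"
      then have "\<sigma> i (decode v) = \<sigma> i (decode w)" by (simp add: \<tau>_def)
      then have "decode v = decode w" using \<sigma>(1)[OF that] unfolding bij_betw_def by (meson UNIV_I inj_onD)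
      then show "v = w" using vw by (metis encode_decode lessThan_iff)
    qed
    then show "bij_betw (\<tau> i) {..<4} {..<4}"
      unfolding bij_betw_def using less[OF that] by (intro conjI endo_inj_surj) auto
    show "\<tau> i v = v" if "v \<notin> {..<4}" for v using that by (simp add: \<tau>_def)
  qed
  have "f x = inv (\<tau> 0) (iterated_Z4 n (\<lambda>i\<in>{1..n}. \<tau> i (x i)))" if x: "x \<in> {1..n} \<rightarrow>\<^sub>E {..<4}" for x
  proof -
    have fx: "f x < 4" using f x unfolding nary_quasigroup_def by auto
    define y where "y = (\<lambda>i. if i = 0 then decode (f x) else decode (x i))"
    have xl: "x i < 4" if "i \<in> {1..n}" for i using x that by auto
    have w0: "word n y 0 = f x" using fx by (simp add: word_apply y_def)
    have "restrict (word n y) {1..n} = x"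
    proof
      fix i
      show "restrict (word n y) {1..n} i = x i"
      proof (cases "i \<in> {1..n}")
        case True
        then have "word n y i = encode (decode (x i))" by (simp add: word_apply y_def)
        then show ?thesis using True xl[OF True] by (simp only: restrict_apply if_True encode_decode)
      next
        case False
        then show ?thesis using PiE_arb[OF x False] by (simp only: restrict_apply if_False)
      qed
    qed
    then have "satisfies_eq n f (word n y)" unfolding satisfies_eq_def w0 by simp
    then have "4 dvd (\<Sum>i\<in>{0..n}. \<sigma> i (y i))" unfolding \<sigma>(2) .
    also have "(\<Sum>i\<in>{0..n}. \<sigma> i (y i)) = \<sigma> 0 (y 0) + (\<Sum>i=1..n. \<sigma> i (y i))"
      by (simp only: sum.atLeast_Suc_atMost[of 0 n] One_nat_def le0)
    also have "\<sigma> 0 (y 0) = \<tau> 0 (f x)" using fx by (simp add: \<tau>_def y_def)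
    also have "(\<Sum>i=1..n. \<sigma> i (y i)) = (\<Sum>i=1..n. (\<lambda>i\<in>{1..n}. \<tau> i (x i)) i)"
      by (rule sum.cong) (use xl in \<open>auto simp: \<tau>_def y_def\<close>)
    finally have "[\<tau> 0 (f x) + (\<Sum>i=1..n. (\<lambda>i\<in>{1..n}. \<tau> i (x i)) i) = 0] (mod 4)" by (simp only: cong_0_iff)
    then have "\<tau> 0 (f x) = iterated_Z4 n (\<lambda>i\<in>{1..n}. \<tau> i (x i))"
      using iterated_Z4_iff[OF less[OF le0 fx]] by blast
    then show ?thesis using permutes_inverses(2)[OF perm[OF le0]] by metis
  qed
  then show ?thesis unfolding Z4_linear_def isotopic_def using perm by (intro exI[of _ \<tau>]) auto
qed

theorem theorem9:
  fixes n :: nat and f :: "(nat \<Rightarrow> nat) \<Rightarrow> nat"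
  assumes "nary_quasigroup n 4 f"
    and "\<not> (\<exists>T. transversal n 4 f T)"
  shows "even n \<and> Z4_linear n f"
proof -
  \<comment> \<open>There are \<open>n + 1\<close> coordinates, so an odd number of them means that
    \<open>n\<close> is even.\<close>
  have "odd (card {0..n}) \<and> Z4_code {0..n} (\<lambda>x. satisfies_eq n f (word n x))"
    by (rule Z4_code_if_transversal_free[OF mds_quasigroup[OF assms(1)] _ transversal_free_quasigroup[OF assms(2)]]) simp
  then show ?thesis using Z4_linear_if_Z4_code[OF assms(1)] by simp
qed

end
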